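(* For any $r\ge1$, any $k_1,\dots,k_r\in\mathbb Z$ and any $t\in(0,1)$, we have $$\widehat\zeta^{\,\rm des}_r(k_1,\dots,k_r)(t)={\rm Li}^{\rm des}(k_1,\dots,k_r)(t).$$ Especially, we have $$\lim_{t\to1-0}{\rm Li}^{\rm des}(k_1,\dots,k_r)(t)=\zeta^{\rm des}_r(k_1,\dots,k_r).$$
   Context: **Hankel contour.** $\mathcal C$ is the Hankel contour: the positive real axis (top side, coming from $+\infty$), a circle around the origin of sufficiently small radius $\epsilon$ (counterclockwise), and the positive real axis (bottom side, going to $+\infty$). **The function $\widehat\zeta^{\,\rm des}_r$.** For $s_1,\dots,s_r\in\mathbb C\setminus\mathbb Z$ and $0<t<1$, $$\widehat\zeta^{\,\rm des}_r(s_1,\dots,s_r)(t):=\prod_{k=1}^r\frac{1}{(e^{2\pi i s_k}-1)\Gamma(s_k)}\int_{\mathcal C^r}\prod_{j=1}^r\left(\frac{1}{\frac1t\exp(\sum_{k=j}^rx_k)-1}+\frac{(\log t-\sum_{k=j}^rx_k)\frac1t\exp(\sum_{k=j}^rx_k)}{\{\frac1t\exp(\sum_{k=j}^rx_k)-1\}^2}\right)\prod_{k=1}^rx_k^{s_k-1}dx_k.$$ For each $t\in(0,1)$ it extends to an entire function of $(s_1,\dots,s_r)\in\mathbb C^r$; values at integer points are those of the extension. **The functions ${\rm Li}^{\rm des}$.** Let $\mathcal P_{(0,1)}:=\{f(t)\in t\mathbb R[[t]] : f(t)\text{ converges for } t\in(0,1)\}$ and let $\mathcal A:=\mathcal P_{(0,1)}[\log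 t]$ be the set of finite sums $\sum_{j=0}^N f_j(t)(\log t)^j$ with $f_j\in\mathcal P_{(0,1)}$. The operators $J[f]:=\int_0^t f(z)\frac{dz}{z}$ and $D[f]:=t\frac{df}{dt}$ map $\mathcal A$ to $\mathcal A$ and are mutually inverse; write $J^{-k}=D^k$ for $k\ge0$. Put ${\rm Li}^{\rm des}(0)(t):=\frac{t}{1-t}+\frac{t\log t}{(1-t)^2}\in\mathcal A$ and, for $(k_1,\dots,k_r)\in\mathbb Z^r$, $${\rm Li}^{\rm des}(k_1,\dots,k_r)(t):=J^{k_r}\Bigl[{\rm Li}^{\rm des}(0)(t)\,J^{k_{r-1}}\bigl[{\rm Li}^{\rm des}(0)(t)\cdots J^{k_1}[{\rm Li}^{\rm des}(0)(t)]\cdots\bigr]\Bigr].$$ **Desingularized multiple zeta function.** For $s_1,\dots,s_r\in\mathbb C\setminus\mathbb Z$, $$\zeta^{\rm des}_r(s_1,\dots,s_r):=\lim_{c\to1,\,c\ne1}\frac{1}{(1-c)^r}\prod_{k=1}^r\frac{1}{(e^{2\pi i s_k}-1)\Gamma(s_k)}\int_{\mathcal C^r}\prod_{j=1}^r\left(\frac{1}{\exp(\sum_{k=j}^rt_k)-1}-\frac{c}{\exp(c\sum_{k=j}^rt_k)-1}\right)\prod_{k=1}^rt_k^{s_k-1}dt_k$$ ($c$ real). It extends to an entire function on $\mathbb C^r$; values at integer points are those of the extension. *)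

theory Defs
  imports "HOL-Analysis.Analysis"
begin

(* Points of C^r are functions nat => complex of which only the coordinates 1, ..., r matter. *)

text \<open>Complex (Frechet) differentiability at every point of \<open>\<complex>\<^sup>r\<close>. As the increment
  is estimated by the coordinates \<open>1, \<dots>, r\<close> alone, an entire \<open>F\<close> depends on no other coordinate.\<close>

definition entire_fun :: "nat \<Rightarrow> ((nat \<Rightarrow> complex) \<Rightarrow> complex) \<Rightarrow> bool" where
  "entire_fun r F \<longleftrightarrow>
     (\<forall>a. \<exists>L :: nat \<Rightarrow> complex. \<forall>e>0. \<exists>d>0. \<forall>z.
        (\<forall>k\<in>{1..r}. norm (z k - a k) < d) \<longrightarrow>
        norm (F z - F a - (\<Sum>k=1..r. L k * (z k - a k))) \<le> e * (\<Sum>k=1..r. norm (z k - a k)))"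

definition entire_extension ::
    "nat \<Rightarrow> ((nat \<Rightarrow> complex) \<Rightarrow> complex) \<Rightarrow> (nat \<Rightarrow> complex) \<Rightarrow> complex" where
  "entire_extension r f =
     (THE F. entire_fun r F \<and> (\<forall>s. (\<forall>k\<in>{1..r}. s k \<notin> \<int>) \<longrightarrow> F s = f s))"

text \<open>The Hankel contour of radius \<open>\<epsilon>\<close>, parametrized by \<open>u \<in> \<real>\<close> and given through the branch of
  \<open>log x\<close> that is continuous along it: the argument is \<open>0\<close> on the incoming ray (\<open>u < 0\<close>,
  \<open>x = \<epsilon> - u\<close>), increases from \<open>0\<close> to \<open>2\<pi>\<close> on the circle, and is \<open>2\<pi>\<close> on the outgoing ray
  (\<open>u > 2\<pi>\<close>, \<open>x = \<epsilon> + u - 2\<pi>\<close>). Powers \<open>x\<^sup>s\<close> on the contour use this branch.\<close>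

definition hankel_log :: "real \<Rightarrow> real \<Rightarrow> complex" where
  "hankel_log \<epsilon> u =
     (if u < 0 then complex_of_real (ln (\<epsilon> - u))
      else if u \<le> 2 * pi then complex_of_real (ln \<epsilon>) + \<i> * complex_of_real u
      else complex_of_real (ln (\<epsilon> + u - 2 * pi)) + \<i> * complex_of_real (2 * pi))"

definition hankel :: "real \<Rightarrow> real \<Rightarrow> complex" where
  "hankel \<epsilon> u = exp (hankel_log \<epsilon> u)"

definition hankel_integral_radius ::
    "real \<Rightarrow> nat \<Rightarrow> ((nat \<Rightarrow> complex) \<Rightarrow> complex) \<Rightarrow> (nat \<Rightarrow> complex) \<Rightarrow> complex" where
  "hankel_integral_radius \<epsilon> r g s =
     (LINT u | Pi\<^sub>M {1..r} (\<lambda>_. lborel).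
        g (\<lambda>k. hankel \<epsilon> (u k)) *
        (\<Prod>k=1..r. exp ((s k - 1) * hankel_log \<epsilon> (u k)) *
                   vector_derivative (hankel \<epsilon>) (at (u k))))"

text \<open>The integral of \<open>g(x\<^sub>1,\<dots>,x\<^sub>r) \<Prod>\<^sub>k x\<^sub>k\<^bsup>s\<^sub>k-1\<^esup> dx\<^sub>k\<close> over the \<open>r\<close>-fold product of
  the Hankel contour: the common value for all sufficiently small radii.\<close>

definition hankel_integral ::
    "nat \<Rightarrow> ((nat \<Rightarrow> complex) \<Rightarrow> complex) \<Rightarrow> (nat \<Rightarrow> complex) \<Rightarrow> complex" where
  "hankel_integral r g s =
     (THE I. \<forall>\<^sub>F \<epsilon> in at_right 0. hankel_integral_radius \<epsilon> r g s = I)"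

definition hankel_factor :: "nat \<Rightarrow> (nat \<Rightarrow> complex) \<Rightarrow> complex" where
  "hankel_factor r s =
     (\<Prod>k=1..r. 1 / ((exp (2 * complex_of_real pi * \<i> * s k) - 1) * Gamma (s k)))"

definition zeta_hat_kernel :: "real \<Rightarrow> complex \<Rightarrow> complex" where
  "zeta_hat_kernel t X =
     1 / (1 / complex_of_real t * exp X - 1) +
     (complex_of_real (ln t) - X) * (1 / complex_of_real t) * exp X /
       (1 / complex_of_real t * exp X - 1)\<^sup>2"

definition zeta_hat_des :: "nat \<Rightarrow> (nat \<Rightarrow> complex) \<Rightarrow> real \<Rightarrow> complex" where
  "zeta_hat_des r s t =
     entire_extension r
       (\<lambda>s. hankel_factor r s *
            hankel_integral r (\<lambda>x. \<Prod>j=1..r. zeta_hat_kernel t (\<Sum>k=j..r. x k)) s) s"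

definition zeta_des_kernel :: "real \<Rightarrow> complex \<Rightarrow> complex" where
  "zeta_des_kernel c X =
     1 / (exp X - 1) - complex_of_real c / (exp (complex_of_real c * X) - 1)"

definition zeta_des :: "nat \<Rightarrow> (nat \<Rightarrow> complex) \<Rightarrow> complex" where
  "zeta_des r =
     entire_extension r
       (\<lambda>s. Lim (at (1::real))
          (\<lambda>c. 1 / (1 - complex_of_real c) ^ r * hankel_factor r s *
               hankel_integral r (\<lambda>x. \<Prod>j=1..r. zeta_des_kernel c (\<Sum>k=j..r. x k)) s))"

text \<open>Elements of the algebra \<open>\<P>\<^sub>(\<^sub>0\<^sub>,\<^sub>1\<^sub>)[log t]\<close> are represented by functions
  \<open>real \<Rightarrow> real\<close>; only their values on \<open>(0,1)\<close> matter.\<close>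

definition J_op :: "(real \<Rightarrow> real) \<Rightarrow> real \<Rightarrow> real" where
  "J_op f t = integral {0..t} (\<lambda>z. f z / z)"

definition D_op :: "(real \<Rightarrow> real) \<Rightarrow> real \<Rightarrow> real" where
  "D_op f t = t * deriv f t"

definition J_pow :: "int \<Rightarrow> (real \<Rightarrow> real) \<Rightarrow> real \<Rightarrow> real" where
  "J_pow k f = (if k \<ge> 0 then (J_op ^^ nat k) f else (D_op ^^ nat (- k)) f)"

definition Li_des_0 :: "real \<Rightarrow> real" where
  "Li_des_0 t = t / (1 - t) + t * ln t / (1 - t)\<^sup>2"

primrec Li_des :: "nat \<Rightarrow> (nat \<Rightarrow> int) \<Rightarrow> real \<Rightarrow> real" where
  "Li_des 0 k = (\<lambda>t. 1)"
| "Li_des (Suc r) k = J_pow (k (Suc r)) (\<lambda>t. Li_des_0 t * Li_des r k t)"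

end

theory Submission
  imports Defs "HOL-Complex_Analysis.Complex_Analysis"
begin

text \<open>
  Put \<open>w = log t\<close> and \<open>q(w) = Li\<^bsup>des\<^esup>(0)(e\<^bsup>w\<^esup>)\<close>; the kernel of the multiple integral is
  \<open>\<Prod>\<^sub>j q(w - x\<^sub>j - \<dots> - x\<^sub>r)\<close>. On functions of \<open>w\<close> that are holomorphic on a half strip around the
  negative axis and decay exponentially, the Hankel integral of \<open>f(w - x) x\<^bsup>s-1\<^esup>\<close>, divided by
  \<open>(e\<^bsup>2\<pi>is\<^esup> - 1) \<Gamma>(s)\<close>, is an entire function \<open>J\<^bsup>s\<^esup> f\<close> of \<open>s\<close> with \<open>J\<^bsup>0\<^esup> = id\<close> and
  \<open>d/dw J\<^bsup>s\<^esup> = J\<^bsup>s-1\<^esup>\<close>, so at integers it is the power of \<open>J\<close> in the definition of \<open>Li\<^bsup>des\<^esup>\<close>. By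
  Fubini the \<open>r\<close>-fold integral is \<open>J\<^bsup>s\<^sub>r\<^esup>[q J\<^bsup>s\<^sub>r\<^sub>-\<^sub>1\<^esup>[q \<dots> J\<^bsup>s\<^sub>1\<^esup>[q]]]\<close>. As the singularity of \<open>q\<close> at
  \<open>w = 0\<close> is removable, the half strip may contain \<open>0\<close>: this function is holomorphic there, and its
  value at \<open>w = 0\<close> is the desingularized zeta function, because the kernel of the latter tends to
  \<open>q(- X)\<close> as \<open>c \<rightarrow> 1\<close>.
\<close>

section \<open>Parameter integrals\<close>

text \<open>Three obstacles shape the estimates. The circle of the contour moves w - x to the right
  and sideways by up to its radius, so every Hankel integral costs a little of the strip; bounds are
  therefore required on \<open>strip \<delta>\<close> for every \<delta> < 1, and radii are chosen
  after the point w. Being entire means joint differentiability in all exponents, so the induction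
  on r cannot work at a fixed w: it carries a first-order expansion uniform on half strips, to which
  the next \<open>J_cpow\<close> is applied as an operator bounded independently of its argument.
  Finally, c -> 1 has to pass under the r-fold integral, which takes a majorant uniform in c. This
  fixes the rates: \<open>li_kernel\<close> decays like |w| e^(Re w), the rate 2/3 absorbs the
  linear factor, and for l \<ge> 3/4 the scaled kernel \<open>li_kernel (l * w)\<close> still has
  the rate 2/3 * 3/4 = 1/2 demanded by \<open>dec_bound\<close>. The given kernels agree with the
  holomorphic ones only off one point, where division by zero yields a default value; sums of
  contour points meet it on a null set.\<close>

lemma has_field_derivative_lint:
  fixes f :: "complex \<Rightarrow> 'a \<Rightarrow> complex"
  assumes U: "open U" "z0 \<in> U"
    and hol: "\<And>x. x \<in> space M \<Longrightarrow> (\<lambda>z. f z x) holomorphic_on U"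
    and meas: "\<And>z. z \<in> U \<Longrightarrow> f z \<in> borel_measurable M"
    and g: "integrable M g"
    and bound: "\<And>z x. z \<in> U \<Longrightarrow> x \<in> space M \<Longrightarrow> norm (f z x) \<le> g x"
  shows "((\<lambda>z. LINT x|M. f z x) has_field_derivative (LINT x|M. deriv (\<lambda>z. f z x) z0)) (at z0)"
    and "integrable M (\<lambda>x. deriv (\<lambda>z. f z x) z0)"
proof -
  obtain e where e: "e > 0" "ball z0 e \<subseteq> U" using U openE by blast
  define \<rho> where "\<rho> = e / 2"
  have \<rho>: "\<rho> > 0" using e by (simp add: \<rho>_def)
  have sub: "y \<in> U" if "z \<in> ball z0 \<rho>" "dist z y \<le> \<rho>" for z y
  proof -
    have "dist z0 y < e"
      using that dist_triangle[of z0 y z] by (simp add: \<rho>_def)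
    thus ?thesis using e by auto
  qed
  \<comment> \<open>Cauchy's estimate on a circle of radius \<rho> turns the majorant of f into one
    of its derivative, hence of all difference quotients; \<open>g\<close> thus dominates everything
    that follows.\<close>
  have dbound: "norm (deriv (\<lambda>z. f z x) z) \<le> g x / \<rho>"
    if "x \<in> space M" "z \<in> ball z0 \<rho>" for x z
  proof -
    have s: "cball z \<rho> \<subseteq> U" using sub[OF that(2)] by auto
    have "norm ((deriv ^^ 1) (\<lambda>z. f z x) z) \<le> fact 1 * g x / \<rho> ^ 1"
    proof (rule Cauchy_inequality)
      show "(\<lambda>z. f z x) holomorphic_on ball z \<rho>"
        using hol[OF that(1)] s ball_subset_cball holomorphic_on_subset by blast
      show "continuous_on (cball z \<rho>) (\<lambda>z. f z x)"
        using holomorphic_on_imp_continuous_on[OF hol[OF that(1)]] s continuous_on_subset by blast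
      show "norm (f y x) \<le> g x" if "norm (z - y) = \<rho>" for y
        using bound[OF _ \<open>x \<in> space M\<close>] s that by (auto simp: dist_norm)
    qed (use \<rho> in auto)
    thus ?thesis by simp
  qed
  have quot: "norm ((f z x - f z0 x) / (z - z0)) \<le> g x / \<rho>"
    if "x \<in> space M" "z \<in> ball z0 \<rho>" "z \<noteq> z0" for x z
  proof -
    have "norm (f z x - f z0 x) \<le> g x / \<rho> * norm (z - z0)"
    proof (rule field_differentiable_bound[where S = "ball z0 \<rho>"])
      show "((\<lambda>z. f z x) has_field_derivative deriv (\<lambda>z. f z x) y) (at y within ball z0 \<rho>)"
        if "y \<in> ball z0 \<rho>" for y
      proof -
        have "y \<in> U" using sub[OF that, of y] \<rho> by auto
        thus ?thesis
          using holomorphic_derivI[OF hol[OF \<open>x \<in> space M\<close>] U(1)] has_field_derivative_at_within by blast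
      qed
    qed (use that dbound \<rho> in auto)
    thus ?thesis using that by (simp add: norm_divide field_simps)
  qed
  have int: "integrable M (f z)" if "z \<in> U" for z
    by (rule Bochner_Integration.integrable_bound[OF g meas[OF that]])
       (use bound[OF that] in \<open>auto intro!: AE_I2 order_trans[OF _ abs_ge_self]\<close>)
  have conv: "(\<lambda>n. (f (X n) x - f z0 x) / (X n - z0)) \<longlonglongrightarrow> deriv (\<lambda>z. f z x) z0"
    if "X \<longlonglongrightarrow> z0" "\<forall>n. X n \<noteq> z0" "x \<in> space M" for X x
  proof -
    have "((\<lambda>z. f z x) has_field_derivative deriv (\<lambda>z. f z x) z0) (at z0)"
      by (rule holomorphic_derivI[OF hol[OF that(3)] U])
    hence "((\<lambda>z. (f z x - f z0 x) / (z - z0)) \<longlongrightarrow> deriv (\<lambda>z. f z x) z0) (at z0)"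
      by (simp add: has_field_derivative_iff)
    thus ?thesis using that
      by (auto simp: tendsto_at_iff_sequentially o_def)
  qed
  have main: "(\<lambda>x. deriv (\<lambda>z. f z x) z0) \<in> borel_measurable M \<and>
      (\<lambda>n. LINT x|M. (f (X n) x - f z0 x) / (X n - z0)) \<longlonglongrightarrow> (LINT x|M. deriv (\<lambda>z. f z x) z0)
      \<and> integrable M (\<lambda>x. deriv (\<lambda>z. f z x) z0)"
    if X: "X \<longlonglongrightarrow> z0" "\<forall>n. X n \<noteq> z0" "\<forall>n. X n \<in> ball z0 \<rho>" for X :: "nat \<Rightarrow> complex"
  proof -
    have XU: "X n \<in> U" for n using sub[of "X n" "X n"] X \<rho> by auto
    have m: "(\<lambda>x. (f (X n) x - f z0 x) / (X n - z0)) \<in> borel_measurable M" for n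
      using meas[OF XU[of n]] meas[OF U(2)] by measurable
    have m2: "(\<lambda>x. deriv (\<lambda>z. f z x) z0) \<in> borel_measurable M"
      by (rule borel_measurable_LIMSEQ_metric[OF m conv[OF X(1,2)]])
    have gi: "integrable M (\<lambda>x. g x / \<rho>)" using g by simp
    have "(\<lambda>n. LINT x|M. (f (X n) x - f z0 x) / (X n - z0)) \<longlonglongrightarrow> (LINT x|M. deriv (\<lambda>z. f z x) z0)"
      by (rule integral_dominated_convergence[OF m2 m gi])
         (use conv[OF X(1,2)] quot X in \<open>auto intro!: AE_I2\<close>)
    moreover have "integrable M (\<lambda>x. deriv (\<lambda>z. f z x) z0)"
      by (rule integrable_dominated_convergence[OF m2 m gi])
         (use conv[OF X(1,2)] quot X in \<open>auto intro!: AE_I2\<close>)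
    ultimately show ?thesis using m2 by blast
  qed
  have int_quot: "(LINT x|M. (f z x - f z0 x) / (z - z0)) =
      ((LINT x|M. f z x) - (LINT x|M. f z0 x)) / (z - z0)" if "z \<in> U" for z
    using int[OF that] int[OF U(2)] by simp
  have "((\<lambda>z. ((LINT x|M. f z x) - (LINT x|M. f z0 x)) / (z - z0)) \<longlongrightarrow>
      (LINT x|M. deriv (\<lambda>z. f z x) z0)) (at z0)"
    unfolding tendsto_at_iff_sequentially
  proof (intro allI impI)
    fix X :: "nat \<Rightarrow> complex" assume X: "\<forall>i. X i \<in> UNIV - {z0}" "X \<longlonglongrightarrow> z0"
    obtain N where N: "\<And>n. n \<ge> N \<Longrightarrow> dist (X n) z0 < \<rho>"
      using X(2) \<rho> unfolding lim_sequentially by blast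
    define Y where "Y = (\<lambda>n. X (n + N))"
    have Y: "Y \<longlonglongrightarrow> z0" "\<forall>n. Y n \<noteq> z0" "\<forall>n. Y n \<in> ball z0 \<rho>"
      using X N LIMSEQ_ignore_initial_segment[OF X(2)] by (auto simp: Y_def dist_commute)
    have YU: "Y n \<in> U" for n using sub[of "Y n" "Y n"] Y \<rho> by auto
    have "(\<lambda>n. ((LINT x|M. f (Y n) x) - (LINT x|M. f z0 x)) / (Y n - z0)) \<longlonglongrightarrow>
        (LINT x|M. deriv (\<lambda>z. f z x) z0)"
      using conjunct1[OF conjunct2[OF main[OF Y]]] unfolding int_quot[OF YU] .
    thus "((\<lambda>z. ((LINT x|M. f z x) - (LINT x|M. f z0 x)) / (z - z0)) \<circ> X) \<longlonglongrightarrow>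
        (LINT x|M. deriv (\<lambda>z. f z x) z0)"
      unfolding o_def Y_def by (rule LIMSEQ_offset)
  qed
  thus "((\<lambda>z. LINT x|M. f z x) has_field_derivative (LINT x|M. deriv (\<lambda>z. f z x) z0)) (at z0)"
    by (simp add: has_field_derivative_iff)
  \<comment> \<open>Integrability of the limit comes out of dominated convergence along a sequence,
    so the second conclusion needs some concrete sequence tending to \<open>z0\<close> inside the
    ball.\<close>
  define y where "y = (\<lambda>n::nat. \<rho> / real (n + 2))"
  have y: "y \<longlonglongrightarrow> 0" "0 < y n" "y n < \<rho>" for n
    using LIMSEQ_ignore_initial_segment[OF lim_const_over_n[of \<rho>], of 2] \<rho>
      divide_strict_left_mono[of 1 "real (n + 2)" \<rho>]
    by (auto simp: y_def)
  have "(\<lambda>n. z0 + of_real (y n)) \<longlonglongrightarrow> z0 + of_real 0" using y(1) by (intro tendsto_intros)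
  moreover have "z0 + of_real (y n) \<in> ball z0 \<rho>" "z0 + of_real (y n) \<noteq> z0" for n
    using y(2,3)[of n] by (auto simp: dist_norm)
  ultimately show "integrable M (\<lambda>x. deriv (\<lambda>z. f z x) z0)"
    using main[of "\<lambda>n. z0 + of_real (y n)"] by simp
qed

text \<open>The integrand itself dominates its truncations to \<open>{a n..b n}\<close>, so the
  fundamental theorem on compact intervals passes to the limit. The finite set \<open>S\<close>
  makes room for the corners of the Hankel contour, where the primitive is continuous but has no
  derivative.\<close>

lemma lint_FTC_exhaust:
  fixes F :: "real \<Rightarrow> complex"
  assumes int: "integrable lborel (\<lambda>u. indicator X u *\<^sub>R f u)"
    and S: "finite S"
    and ab: "\<And>n. a n \<le> b n" and sub: "\<And>n. {a n..b n} \<subseteq> X"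
    and cov: "\<And>u. u \<in> X \<Longrightarrow> eventually (\<lambda>n::nat. u \<in> {a n..b n}) sequentially"
    and cont: "\<And>n. continuous_on {a n..b n} F"
    and der: "\<And>n u. u \<in> {a n<..<b n} - S \<Longrightarrow> (F has_vector_derivative f u) (at u)"
    and lim: "(\<lambda>n. F (b n) - F (a n)) \<longlonglongrightarrow> l"
  shows "(LINT u|lborel. indicator X u *\<^sub>R f u) = l"
proof -
  have eq: "indicator {a n..b n} u *\<^sub>R (indicator X u *\<^sub>R f u) = indicator {a n..b n} u *\<^sub>R f u" for n u
    using sub[of n] by (auto simp: indicator_def)
  have si: "integrable lborel (\<lambda>u. indicator {a n..b n} u *\<^sub>R f u)" for n
    using integrable_mult_indicator[OF _ int, of "{a n..b n}"] unfolding eq by simp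
  have val: "(LINT u|lborel. indicator {a n..b n} u *\<^sub>R f u) = F (b n) - F (a n)" for n
  proof -
    have "((\<lambda>u. indicator {a n..b n} u *\<^sub>R f u) has_integral
        (LINT u|lborel. indicator {a n..b n} u *\<^sub>R f u)) UNIV"
      by (rule has_integral_integral_lborel[OF si])
    hence "(f has_integral (LINT u|lborel. indicator {a n..b n} u *\<^sub>R f u)) {a n..b n}"
      unfolding indicator_scaleR_eq_if has_integral_restrict_UNIV .
    moreover have "(f has_integral F (b n) - F (a n)) {a n..b n}"
      by (rule fundamental_theorem_of_calculus_interior_strong[OF S ab der cont])
    ultimately show ?thesis by (rule has_integral_unique)
  qed
  have "(\<lambda>n. LINT u|lborel. indicator {a n..b n} u *\<^sub>R f u) \<longlonglongrightarrow> (LINT u|lborel. indicator X u *\<^sub>R f u)"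
  proof (rule integral_dominated_convergence)
    show "integrable lborel (\<lambda>u. norm (indicator X u *\<^sub>R f u))" using int by (rule integrable_norm)
    show "(\<lambda>u. indicator X u *\<^sub>R f u) \<in> borel_measurable lborel"
      using int by (rule borel_measurable_integrable)
    show "(\<lambda>u. indicator {a n..b n} u *\<^sub>R f u) \<in> borel_measurable lborel" for n
      using si by (rule borel_measurable_integrable)
    show "AE u in lborel. norm (indicator {a n..b n} u *\<^sub>R f u) \<le> norm (indicator X u *\<^sub>R f u)" for n
      using sub[of n] by (intro AE_I2) (auto simp: indicator_def)
    show "AE u in lborel. (\<lambda>n. indicator {a n..b n} u *\<^sub>R f u) \<longlonglongrightarrow> indicator X u *\<^sub>R f u"
    proof (rule AE_I2)
      fix u
      show "(\<lambda>n. indicator {a n..b n} u *\<^sub>R f u) \<longlonglongrightarrow> indicator X u *\<^sub>R f u"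
      proof (cases "u \<in> X")
        case True
        have "eventually (\<lambda>n. indicator {a n..b n} u *\<^sub>R f u = indicator X u *\<^sub>R f u) sequentially"
          using cov[OF True] by eventually_elim (use True in auto)
        thus ?thesis by (rule tendsto_eventually)
      next
        case False
        hence "u \<notin> {a n..b n}" for n using sub[of n] by blast
        thus ?thesis using False by simp
      qed
    qed
  qed
  with val lim show ?thesis using LIMSEQ_unique by simp
qed

section \<open>Decaying functions on a half strip\<close>

text \<open>One parameter bounds both the width and the right end: subtracting a contour point of
  radius eps then costs exactly eps (\<open>strip_diff_hankel\<close>), and for \<delta> > 0 the
  point 0 is interior.\<close>

definition strip :: "real \<Rightarrow> complex set" where
  "strip \<delta> = {w. Re w < \<delta> \<and> \<bar>Im w\<bar> < \<delta>}"

lemma open_strip: "open (strip \<delta>)"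
  unfolding strip_def
  by (intro open_Collect_conj open_Collect_less continuous_intros)

lemma strip_mono: "\<delta> \<le> \<delta>' \<Longrightarrow> strip \<delta> \<subseteq> strip \<delta>'"
  by (auto simp: strip_def)

lemma strip_shrink:
  assumes "w \<in> strip \<delta>" shows "\<exists>\<delta>'<\<delta>. 0 < \<delta>' \<and> w \<in> strip \<delta>'"
proof -
  define m where "m = max (Re w) \<bar>Im w\<bar>"
  have "m < \<delta>" "0 \<le> m" using assms by (auto simp: m_def strip_def)
  moreover have "w \<in> strip ((m + \<delta>) / 2)"
    using \<open>m < \<delta>\<close> by (auto simp: strip_def m_def max_def split: if_splits)
  ultimately show ?thesis by (intro exI[of _ "(m + \<delta>) / 2"]) auto
qed

text \<open>The constant is explicit so that operators can be bounded linearly in \<open>K\<close>,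
  uniformly over the functions they act on. At w = log t the bound reads K * sqrt t.\<close>

definition dec_bound :: "real \<Rightarrow> real \<Rightarrow> (complex \<Rightarrow> complex) \<Rightarrow> bool" where
  "dec_bound \<delta> K f \<longleftrightarrow> 0 \<le> K \<and> (\<forall>w\<in>strip \<delta>. norm (f w) \<le> K * exp (Re w / 2))"

definition decaying :: "(complex \<Rightarrow> complex) \<Rightarrow> bool" where
  "decaying f \<longleftrightarrow> f holomorphic_on strip 1 \<and> (\<forall>\<delta><1. \<exists>K. dec_bound \<delta> K f)"

lemma strip_radius:
  assumes "w \<in> strip 1" shows "\<exists>eps>0. w \<in> strip (1 - eps)"
  using strip_shrink[OF assms] by (metis diff_diff_eq2 add_diff_cancel_left' diff_gt_0_iff_gt)

lemma dec_boundD: "dec_bound \<delta> K f \<Longrightarrow> w \<in> strip \<delta> \<Longrightarrow> norm (f w) \<le> K * exp (Re w / 2)"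
  by (auto simp: dec_bound_def)

lemma dec_bound_nonneg: "dec_bound \<delta> K f \<Longrightarrow> 0 \<le> K"
  by (auto simp: dec_bound_def)

lemma dec_bound_mono: "dec_bound \<delta>' K f \<Longrightarrow> \<delta> \<le> \<delta>' \<Longrightarrow> dec_bound \<delta> K f"
  using strip_mono by (auto simp: dec_bound_def)

lemma decaying_holomorphic: "decaying f \<Longrightarrow> f holomorphic_on strip 1"
  by (simp add: decaying_def)

lemma decaying_bound: "decaying f \<Longrightarrow> \<delta> < 1 \<Longrightarrow> \<exists>K. dec_bound \<delta> K f"
  by (simp add: decaying_def)

lemma dec_bound_add:
  "dec_bound \<delta> K f \<Longrightarrow> dec_bound \<delta> K' g \<Longrightarrow> dec_bound \<delta> (K + K') (\<lambda>w. f w + g w)"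
  unfolding dec_bound_def by (auto intro!: norm_triangle_le add_mono simp: distrib_right)

lemma dec_bound_cmult:
  "dec_bound \<delta> K f \<Longrightarrow> dec_bound \<delta> (norm c * K) (\<lambda>w. c * f w)"
  unfolding dec_bound_def by (auto simp: norm_mult mult.assoc intro!: mult_left_mono)

lemma decaying_add: "decaying f \<Longrightarrow> decaying g \<Longrightarrow> decaying (\<lambda>w. f w + g w)"
  unfolding decaying_def using dec_bound_add by (blast intro: holomorphic_on_add)

lemma decaying_cmult: "decaying f \<Longrightarrow> decaying (\<lambda>w. c * f w)"
  unfolding decaying_def using dec_bound_cmult[of _ _ f c]
  by (fastforce intro!: holomorphic_on_mult)

lemma decaying_diff: "decaying f \<Longrightarrow> decaying g \<Longrightarrow> decaying (\<lambda>w. f w - g w)"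
  using decaying_add[OF _ decaying_cmult[of g "-1"]] by simp

lemma decaying_0: "decaying (\<lambda>w. 0)"
  unfolding decaying_def dec_bound_def by (auto intro!: exI[of _ 0])

lemma decaying_sum:
  "(\<And>i. i \<in> A \<Longrightarrow> decaying (f i)) \<Longrightarrow> decaying (\<lambda>w. \<Sum>i\<in>A. f i w)"
  by (induction A rule: infinite_finite_induct) (auto simp: decaying_0 intro: decaying_add)

section \<open>One-variable Hankel integrals\<close>

definition hankel_deriv :: "real \<Rightarrow> real \<Rightarrow> complex" where
  "hankel_deriv eps u = vector_derivative (hankel eps) (at u)"

definition hankel_kernel :: "real \<Rightarrow> complex \<Rightarrow> real \<Rightarrow> complex" where
  "hankel_kernel eps s u = exp ((s - 1) * hankel_log eps u) * hankel_deriv eps u"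

definition hankel_op :: "real \<Rightarrow> complex \<Rightarrow> (complex \<Rightarrow> complex) \<Rightarrow> complex \<Rightarrow> complex" where
  "hankel_op eps s f w =
     (LINT u|lborel. f (w - hankel eps u) * hankel_kernel eps s u)"

text \<open>The modulus of the contour point (\<open>norm_hankel\<close>), written with
  \<open>max\<close> instead of cases to make continuity across the corners evident.\<close>

definition hankel_rad :: "real \<Rightarrow> real \<Rightarrow> real" where
  "hankel_rad eps u = eps + max 0 (- u) + max 0 (u - 2 * pi)"

definition hankel_log_deriv :: "real \<Rightarrow> real \<Rightarrow> complex" where
  "hankel_log_deriv eps u =
     (if u < 0 then - complex_of_real (1 / (eps - u)) else if u \<le> 2 * pi then \<i>
      else complex_of_real (1 / (eps + u - 2 * pi)))"

lemma hankel_log_alt: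
  "hankel_log eps u = of_real (ln (hankel_rad eps u)) + \<i> * of_real (min (max u 0) (2 * pi))"
proof -
  consider "u < 0" | "0 \<le> u" "u \<le> 2 * pi" | "u > 2 * pi" by linarith
  thus ?thesis
  proof cases
    case 3
    moreover from this have "u > 0" using pi_gt_zero by linarith
    ultimately show ?thesis by (simp add: hankel_log_def hankel_rad_def max_def min_def algebra_simps)
  next
    case 1
    moreover from this have "u \<le> 2 * pi" using pi_gt_zero by linarith
    ultimately show ?thesis by (simp add: hankel_log_def hankel_rad_def max_def min_def)
  qed (auto simp: hankel_log_def hankel_rad_def max_def min_def)
qed

lemma hankel_rad_ge: "eps \<le> hankel_rad eps u"
  by (simp add: hankel_rad_def)

text \<open>Decaying functions supply exp (- x / 2) along the contour; half of this exponent is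
  spent on the power of x (\<open>hankel_growth\<close>), which leaves the rate 1/4. The two half
  lines are related by the reflection u -> -u.\<close>

lemma integrable_exp_abs: "integrable lborel (\<lambda>u::real. exp (- \<bar>u\<bar> / 4))"
proof -
  let ?g = "\<lambda>u::real. indicator {0..} u *\<^sub>R exp (- (1 / 4) * u)"
  have "(\<lambda>u::real. exp (- (1 / 4) * u)) absolutely_integrable_on {0..}"
    by (intro nonnegative_absolutely_integrable_1 integrable_on_exp_minus_to_infinity) auto
  hence "integrable lebesgue ?g" by (simp add: set_integrable_def)
  hence 1: "integrable lborel ?g"
    by (subst (asm) integrable_completion) (auto intro!: measurable_completion)
  have 2: "integrable lborel (\<lambda>u. ?g (0 + (-1) * u))"
    by (rule lborel_integrable_real_affine[OF 1]) auto
  show ?thesis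
    by (rule Bochner_Integration.integrable_bound[OF Bochner_Integration.integrable_add[OF 1 2]])
       (auto simp: indicator_def)
qed

lemma exp_half_diff: "exp (Re (w - z) / 2) = exp (Re w / 2) * exp (- Re z / 2)"
  by (simp add: diff_divide_distrib flip: exp_add)

section \<open>Geometry and calculus of the contour\<close>

context
  fixes eps :: real
  assumes eps: "eps > 0"
begin

lemma hankel_rad_pos: "hankel_rad eps u > 0"
  using hankel_rad_ge[of eps u] eps by linarith

lemma continuous_hankel_log: "continuous_on A (hankel_log eps)"
proof -
  have "continuous_on A (\<lambda>u. complex_of_real (ln (hankel_rad eps u)) + \<i> * of_real (min (max u 0) (2 * pi)))"
    using hankel_rad_pos unfolding hankel_rad_def
    by (intro continuous_intros) (auto simp: less_le)
  thus ?thesis by (simp add: hankel_log_alt cong: continuous_on_cong)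
qed

lemma continuous_hankel: "continuous_on A (hankel eps)"
  unfolding hankel_def[abs_def] by (intro continuous_intros continuous_hankel_log)

lemma hankel_explicit:
  "hankel eps u = (if u < 0 then of_real (eps - u) else if u \<le> 2 * pi then of_real eps * cis u
     else of_real (eps + u - 2 * pi))"
proof -
  have "exp (2 * of_real pi * \<i>) = 1" by simp
  thus ?thesis
    using eps unfolding hankel_def hankel_log_def
    by (auto simp: exp_add exp_of_real cis_conv_exp mult.commute)
qed

lemma hankel_Re_ge: "Re (hankel eps u) \<ge> - eps" and hankel_Im_le: "\<bar>Im (hankel eps u)\<bar> \<le> eps"
proof -
  have "-1 \<le> cos u" "\<bar>sin u\<bar> \<le> 1" by auto
  hence "-eps \<le> eps * cos u" "eps * \<bar>sin u\<bar> \<le> eps"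
    using eps mult_left_mono[of "-1" "cos u" eps] mult_left_mono[of "\<bar>sin u\<bar>" 1 eps] by auto
  thus "Re (hankel eps u) \<ge> - eps" "\<bar>Im (hankel eps u)\<bar> \<le> eps"
    using eps unfolding hankel_explicit by (auto simp: abs_mult)
qed

text \<open>The loss 2 eps comes from the circle, where the real part can be -eps while the modulus
  is eps; on the rays the two agree.\<close>

lemma hankel_Re_ge_rad: "Re (hankel eps u) \<ge> hankel_rad eps u - 2 * eps"
proof -
  consider "u < 0" "u \<le> 2 * pi" | "0 \<le> u" "u \<le> 2 * pi" | "u > 2 * pi" "u > 0"
    using pi_gt_zero by linarith
  thus ?thesis
    by cases (use eps hankel_Re_ge[of u] in \<open>auto simp: hankel_explicit hankel_rad_def max_def\<close>)
qed

lemma strip_diff_hankel: "w \<in> strip \<delta> \<Longrightarrow> w - hankel eps u \<in> strip (\<delta> + eps)"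
  using hankel_Re_ge[of u] hankel_Im_le[of u] by (auto simp: strip_def)

lemma hankel_log_gt:
  "u > 2 * pi \<Longrightarrow> hankel_log eps u = complex_of_real (ln (eps + u - 2 * pi)) + \<i> * of_real (2 * pi)"
  using pi_gt_zero unfolding hankel_log_def by (smt (verit))

lemma has_vector_derivative_hankel_log:
  assumes "u \<notin> {0, 2 * pi}"
  shows "(hankel_log eps has_vector_derivative hankel_log_deriv eps u) (at u)"
proof -
  consider "u < 0" | "0 < u" "u < 2 * pi" | "u > 2 * pi" using assms by fastforce
  thus ?thesis
  proof cases
    case 1
    have "((\<lambda>u. complex_of_real (ln (eps - u))) has_vector_derivative
        of_real (- (1 / (eps - u)))) (at u)"
      using 1 eps by (intro has_vector_derivative_of_real)
        (auto intro!: derivative_eq_intros simp: field_simps)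
    hence "(hankel_log eps has_vector_derivative of_real (- (1 / (eps - u)))) (at u)"
      by (rule has_vector_derivative_transform_within_open[of _ _ _ "{..<0}"])
         (use 1 in \<open>auto simp: hankel_log_def\<close>)
    thus ?thesis using 1 by (simp add: hankel_log_deriv_def)
  next
    case 2
    have "((\<lambda>u. complex_of_real (ln eps) + \<i> * complex_of_real u) has_vector_derivative \<i>) (at u)"
      by (auto intro!: derivative_eq_intros has_vector_derivative_of_real)
    hence "(hankel_log eps has_vector_derivative \<i>) (at u)"
      by (rule has_vector_derivative_transform_within_open[of _ _ _ "{0<..<2*pi}"])
         (use 2 in \<open>auto simp: hankel_log_def\<close>)
    thus ?thesis using 2 by (simp add: hankel_log_deriv_def)
  next
    case 3
    have u0: "u > 0" using 3 pi_gt_zero by linarith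
    have "((\<lambda>u. complex_of_real (ln (eps + u - 2 * pi))) has_vector_derivative
        of_real (1 / (eps + u - 2 * pi))) (at u)"
      using 3 eps by (intro has_vector_derivative_of_real)
        (auto intro!: derivative_eq_intros simp: field_simps)
    hence "((\<lambda>u. complex_of_real (ln (eps + u - 2 * pi)) + \<i> * of_real (2 * pi)) has_vector_derivative
        of_real (1 / (eps + u - 2 * pi)) + 0) (at u)"
      by (intro has_vector_derivative_add has_vector_derivative_const)
    hence "(hankel_log eps has_vector_derivative of_real (1 / (eps + u - 2 * pi)) + 0) (at u)"
      by (rule has_vector_derivative_transform_within_open[of _ _ _ "{2*pi<..}"])
         (use 3 pi_gt_zero hankel_log_gt in \<open>simp_all\<close>)
    thus ?thesis using 3 u0 by (simp add: hankel_log_deriv_def)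
  qed
qed

lemma has_vector_derivative_hankel:
  assumes "u \<notin> {0, 2 * pi}"
  shows "(hankel eps has_vector_derivative hankel eps u * hankel_log_deriv eps u) (at u)"
proof -
  have "((exp \<circ> hankel_log eps) has_vector_derivative hankel_log_deriv eps u * exp (hankel_log eps u)) (at u)"
    by (rule field_vector_diff_chain_at[OF has_vector_derivative_hankel_log[OF assms] DERIV_exp])
  thus ?thesis by (simp add: o_def hankel_def[abs_def] mult.commute)
qed

lemma hankel_deriv_eq:
  assumes "u \<notin> {0, 2 * pi}"
  shows "hankel_deriv eps u = hankel eps u * hankel_log_deriv eps u"
  unfolding hankel_deriv_def using has_vector_derivative_hankel[OF assms]
  by (rule vector_derivative_at)

lemma borel_measurable_hankel_log: "hankel_log eps \<in> borel_measurable borel"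
  using continuous_hankel_log by (rule borel_measurable_continuous_onI)

lemma borel_measurable_hankel: "hankel eps \<in> borel_measurable borel"
  using continuous_hankel by (rule borel_measurable_continuous_onI)

text \<open>At the corners 0 and 2 \<pi> the vector derivative is an arbitrary value, but changing a
  function at two points does not affect measurability.\<close>

lemma borel_measurable_hankel_deriv: "hankel_deriv eps \<in> borel_measurable borel"
proof (rule measurable_discrete_difference)
  have "hankel_log_deriv eps \<in> borel_measurable borel"
    unfolding hankel_log_deriv_def[abs_def] by measurable
  thus "(\<lambda>u. hankel eps u * hankel_log_deriv eps u) \<in> borel_measurable borel"
    using borel_measurable_hankel by measurable
  show "countable {0, 2 * pi}" by simp
qed (auto simp: hankel_deriv_eq)

lemma measurable_hankel_kernel: "hankel_kernel eps s \<in> borel_measurable borel"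
  unfolding hankel_kernel_def[abs_def]
  using borel_measurable_hankel_log borel_measurable_hankel_deriv by measurable

lemma norm_hankel: "norm (hankel eps u) = hankel_rad eps u"
  using hankel_rad_pos by (simp add: hankel_def hankel_log_alt)

lemma norm_hankel_deriv_le: "u \<notin> {0, 2 * pi} \<Longrightarrow> norm (hankel_deriv eps u) \<le> 1 + eps"
proof -
  assume u: "u \<notin> {0, 2 * pi}"
  have "u < 0 \<and> u < 2 * pi \<or> 0 < u \<and> u < 2 * pi \<or> u > 2 * pi \<and> u > 0"
    using u pi_gt_zero by (simp del: pi_gt_zero) linarith
  thus ?thesis
    by (elim disjE conjE) (use eps in \<open>simp_all add: hankel_deriv_eq hankel_rad_def hankel_log_deriv_def
      norm_mult norm_hankel norm_divide max_def algebra_simps flip: of_real_add of_real_diff of_real_mult of_real_divide\<close>)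
qed

text \<open>The factor \<open>norm (hankel_deriv eps u)\<close> is not replaced by its bound 1 +
  eps: it keeps the inequality in \<open>kernel_bound\<close> valid at every u, including the
  corners, where the derivative is arbitrary.\<close>

definition hankel_weight :: "real \<Rightarrow> real" where
  "hankel_weight u = exp (- \<bar>u\<bar> / 4) * norm (hankel_deriv eps u)"

lemma integrable_hankel_weight: "integrable lborel hankel_weight"
proof (rule Bochner_Integration.integrable_bound)
  show "integrable lborel (\<lambda>u::real. (1 + eps) * exp (- \<bar>u\<bar> / 4))"
    using integrable_exp_abs by simp
  show "hankel_weight \<in> borel_measurable lborel"
    unfolding hankel_weight_def[abs_def] using borel_measurable_hankel_deriv by measurable
  have "norm (hankel_weight u) \<le> norm ((1 + eps) * exp (- \<bar>u\<bar> / 4))" if "u \<notin> {0, 2 * pi}" for u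
    using eps norm_hankel_deriv_le[OF that] unfolding hankel_weight_def
    by (simp add: abs_mult mult.commute[of "exp _"] mult_right_mono)
  thus "AE u in lborel. norm (hankel_weight u) \<le> norm ((1 + eps) * exp (- \<bar>u\<bar> / 4))"
    by (intro AE_I'[of "{0, 2 * pi}"]) (auto intro!: finite_imp_null_set_lborel)
qed

text \<open>The logarithm grows more slowly than any linear function, so a power of x with bounded
  exponent uses up only part of the exponential decay.\<close>

lemma hankel_growth:
  assumes "0 \<le> R"
  obtains C where "0 \<le> C"
    "\<And>u. exp (- Re (hankel eps u) / 2) * exp (R * norm (hankel_log eps u)) \<le> C * exp (- \<bar>u\<bar> / 4)"
proof -
  \<comment> \<open>From ln (\<eta> y) \<le> \<eta> y - 1 follows ln y \<le> \<eta> y - ln \<eta>;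
    this \<eta> makes the slope R \<eta> at most 1/4, half of the available rate 1/2.\<close>
  define \<eta> where "\<eta> = 1 / (4 * (R + 1))"
  have \<eta>: "\<eta> > 0" "R * \<eta> \<le> 1 / 4" using assms by (auto simp: \<eta>_def field_simps)
  define c where "c = eps + R * (\<bar>ln \<eta>\<bar> + \<bar>ln eps\<bar> + 2 * pi) + pi / 2"
  show thesis
  proof (rule that[of "exp c"])
    fix u
    let ?y = "hankel_rad eps u"
    have y: "?y > 0" "?y \<ge> eps" using hankel_rad_pos hankel_rad_ge by auto
    have "ln ?y \<le> \<eta> * ?y - ln \<eta>"
      using ln_le_minus_one[of "\<eta> * ?y"] \<eta> y by (simp add: ln_mult)
    moreover have "ln ?y \<ge> ln eps" using y eps by simp
    ultimately have "\<bar>ln ?y\<bar> \<le> \<eta> * ?y + \<bar>ln \<eta>\<bar> + \<bar>ln eps\<bar>"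
      using mult_pos_pos[OF \<eta>(1) y(1)] by linarith
    moreover have "norm (hankel_log eps u) \<le> \<bar>ln ?y\<bar> + 2 * pi"
    proof -
      have "norm (hankel_log eps u) \<le> norm (complex_of_real (ln ?y)) + norm (\<i> * complex_of_real (min (max u 0) (2 * pi)))"
        unfolding hankel_log_alt by (rule norm_triangle_ineq)
      also have "\<dots> \<le> \<bar>ln ?y\<bar> + 2 * pi" by (simp add: norm_mult)
      finally show ?thesis .
    qed
    ultimately have "norm (hankel_log eps u) \<le> \<eta> * ?y + (\<bar>ln \<eta>\<bar> + \<bar>ln eps\<bar> + 2 * pi)" by linarith
    hence "R * norm (hankel_log eps u) \<le> R * (\<eta> * ?y + (\<bar>ln \<eta>\<bar> + \<bar>ln eps\<bar> + 2 * pi))"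
      using assms by (rule mult_left_mono)
    also have "\<dots> = (R * \<eta>) * ?y + R * (\<bar>ln \<eta>\<bar> + \<bar>ln eps\<bar> + 2 * pi)" by (simp add: algebra_simps)
    also have "\<dots> \<le> 1 / 4 * ?y + R * (\<bar>ln \<eta>\<bar> + \<bar>ln eps\<bar> + 2 * pi)"
      using mult_right_mono[OF \<eta>(2), of ?y] y by simp
    finally have 1: "R * norm (hankel_log eps u) \<le> ?y / 4 + R * (\<bar>ln \<eta>\<bar> + \<bar>ln eps\<bar> + 2 * pi)" by simp
    have 2: "- Re (hankel eps u) / 2 \<le> - ?y / 2 + eps" using hankel_Re_ge_rad[of u] by simp
    have "?y \<ge> \<bar>u\<bar> - 2 * pi" using eps pi_gt_zero unfolding hankel_rad_def by linarith
    with 1 2 have "- Re (hankel eps u) / 2 + R * norm (hankel_log eps u) \<le> c + - \<bar>u\<bar> / 4"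
      unfolding c_def by linarith
    thus "exp (- Re (hankel eps u) / 2) * exp (R * norm (hankel_log eps u)) \<le> exp c * exp (- \<bar>u\<bar> / 4)"
      by (simp flip: exp_add)
  qed auto
qed

text \<open>Uniform for exponents in a ball around 1, as the power is x^(s-1): differentiation in s
  under the integral takes one majorant in a whole neighbourhood.\<close>

definition kernel_bound :: "real \<Rightarrow> real \<Rightarrow> bool" where
  "kernel_bound R C \<longleftrightarrow> 0 \<le> C \<and> (\<forall>s u. norm (s - 1) \<le> R \<longrightarrow>
     exp (- Re (hankel eps u) / 2) * norm (hankel_kernel eps s u)
       \<le> C * hankel_weight u)"

lemma hankel_kernel_bound: "\<exists>C. kernel_bound R C"
proof -
  obtain C where C: "0 \<le> C"
    "\<And>u. exp (- Re (hankel eps u) / 2) * exp (max R 0 * norm (hankel_log eps u)) \<le> C * exp (- \<bar>u\<bar> / 4)"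
    using hankel_growth[of "max R 0"] by auto
  show ?thesis unfolding kernel_bound_def
  proof (intro exI[of _ C] conjI allI impI C(1))
    fix s :: complex and u assume s: "norm (s - 1) \<le> R"
    have "norm (exp ((s - 1) * hankel_log eps u)) \<le> exp (norm ((s - 1) * hankel_log eps u))"
      by (rule norm_exp)
    also have "\<dots> \<le> exp (max R 0 * norm (hankel_log eps u))"
      using s by (auto simp: norm_mult intro!: mult_right_mono)
    finally have "exp (- Re (hankel eps u) / 2) * norm (exp ((s - 1) * hankel_log eps u)) \<le> C * exp (- \<bar>u\<bar> / 4)"
      using C(2)[of u] by (meson exp_ge_zero mult_left_mono order_trans)
    from mult_right_mono[OF this, of "norm (hankel_deriv eps u)"]
    show "exp (- Re (hankel eps u) / 2) * norm (hankel_kernel eps s u)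
         \<le> C * hankel_weight u"
      by (simp add: hankel_kernel_def norm_mult hankel_weight_def mult_ac)
  qed
qed

section \<open>The one-variable Hankel operator\<close>

lemma continuous_along_hankel:
  assumes "f holomorphic_on strip 1" "w \<in> strip (1 - eps)"
  shows "continuous_on A (\<lambda>u. f (w - hankel eps u))"
proof -
  have "continuous_on (strip 1) f" by (rule holomorphic_on_imp_continuous_on[OF assms(1)])
  thus ?thesis
    by (rule continuous_on_compose2)
       (use strip_diff_hankel[OF assms(2)] in \<open>auto intro!: continuous_intros continuous_hankel\<close>)
qed

lemma measurable_hankel_integrand:
  assumes "f holomorphic_on strip 1" "w \<in> strip (1 - eps)"
  shows "(\<lambda>u. f (w - hankel eps u) * hankel_kernel eps s u) \<in> borel_measurable lborel"
proof -
  have [measurable]: "(\<lambda>u. f (w - hankel eps u)) \<in> borel_measurable borel"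
    using continuous_along_hankel[OF assms] by (rule borel_measurable_continuous_onI)
  show ?thesis using measurable_hankel_kernel by measurable
qed

lemma norm_hankel_integrand_le:
  assumes "dec_bound (\<delta> + eps) K f" "w \<in> strip \<delta>" "kernel_bound R C" "norm (s - 1) \<le> R"
  shows "norm (f (w - hankel eps u) * hankel_kernel eps s u)
    \<le> K * exp (Re w / 2) * (C * hankel_weight u)"
proof -
  have "norm (f (w - hankel eps u)) \<le> K * exp (Re (w - hankel eps u) / 2)"
    by (rule dec_boundD[OF assms(1) strip_diff_hankel[OF assms(2)]])
  also have "\<dots> = K * exp (Re w / 2) * exp (- Re (hankel eps u) / 2)"
    by (simp only: exp_half_diff mult.assoc)
  finally have "norm (f (w - hankel eps u)) * norm (hankel_kernel eps s u)
      \<le> K * exp (Re w / 2) * exp (- Re (hankel eps u) / 2) * norm (hankel_kernel eps s u)"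
    by (rule mult_right_mono) simp
  also have "\<dots> = K * exp (Re w / 2) * (exp (- Re (hankel eps u) / 2) * norm (hankel_kernel eps s u))" by simp
  also have "\<dots> \<le> K * exp (Re w / 2) * (C * hankel_weight u)"
    using dec_bound_nonneg[OF assms(1)] assms(3,4) unfolding kernel_bound_def by (intro mult_left_mono) auto
  finally show ?thesis by (simp add: norm_mult)
qed

lemma integrable_hankel_integrand:
  assumes "decaying f" "w \<in> strip (1 - eps)"
  shows "integrable lborel (\<lambda>u. f (w - hankel eps u) * hankel_kernel eps s u)"
proof -
  obtain \<delta> where \<delta>: "\<delta> < 1 - eps" "w \<in> strip \<delta>" using strip_shrink[OF assms(2)] by blast
  obtain K where K: "dec_bound (\<delta> + eps) K f" using decaying_bound[OF assms(1), of "\<delta> + eps"] \<delta> by auto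
  obtain C where C: "kernel_bound (norm (s - 1)) C" using hankel_kernel_bound by blast
  show ?thesis
  proof (rule Bochner_Integration.integrable_bound)
    show "integrable lborel (\<lambda>u. K * exp (Re w / 2) * (C * hankel_weight u))"
      using integrable_hankel_weight by simp
    show "AE u in lborel. norm (f (w - hankel eps u) * hankel_kernel eps s u)
        \<le> norm (K * exp (Re w / 2) * (C * hankel_weight u))"
      using norm_hankel_integrand_le[OF K \<delta>(2) C order_refl]
      by (intro AE_I2) (force intro: order_trans[OF _ abs_ge_self])
  qed (rule measurable_hankel_integrand[OF decaying_holomorphic[OF assms(1)] assms(2)])
qed

text \<open>\<open>C\<close> is chosen before f, K, \<delta> and w: the Hankel operator is bounded
  from a half strip to a smaller one. The rate 1/2 is preserved because exp (Re (w - x) / 2) splits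
  off exp (Re w / 2).\<close>

lemma norm_hankel_op_le:
  obtains C where "0 \<le> C" "\<And>f K (s::complex) \<delta> w. decaying f \<Longrightarrow> \<delta> + eps < 1 \<Longrightarrow> dec_bound (\<delta> + eps) K f \<Longrightarrow>
    norm (s - 1) \<le> R \<Longrightarrow> w \<in> strip \<delta> \<Longrightarrow> norm (hankel_op eps s f w) \<le> C * K * exp (Re w / 2)"
proof -
  obtain C where C: "kernel_bound (R) C" using hankel_kernel_bound by blast
  show thesis
  proof (rule that[of "C * (LINT u|lborel. hankel_weight u)"])
    show "0 \<le> C * (LINT u|lborel. hankel_weight u)"
      using C by (intro mult_nonneg_nonneg integral_nonneg_AE) (auto simp: hankel_weight_def kernel_bound_def)
    fix f K and s :: complex and \<delta> w
    assume *: "decaying f" "\<delta> + eps < 1" "dec_bound (\<delta> + eps) K f" "norm (s - 1) \<le> R" "w \<in> strip \<delta>"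
    have "w \<in> strip (1 - eps)" using strip_mono[of \<delta> "1 - eps"] * by auto
    hence "norm (hankel_op eps s f w) \<le> (LINT u|lborel. norm (f (w - hankel eps u) * hankel_kernel eps s u))"
      unfolding hankel_op_def by (intro integral_norm_bound)
    also have "\<dots> \<le> (LINT u|lborel. K * exp (Re w / 2) * (C * hankel_weight u))"
      using norm_hankel_integrand_le[OF *(3) *(5) C *(4)] \<open>w \<in> strip (1 - eps)\<close>
      by (intro integral_mono integrable_norm integrable_hankel_integrand[OF *(1)])
         (auto simp: integrable_hankel_weight)
    finally show "norm (hankel_op eps s f w) \<le> C * (LINT u|lborel. hankel_weight u) * K * exp (Re w / 2)"
      by (simp add: mult_ac)
  qed
qed

lemma has_field_derivative_hankel_op:
  assumes "decaying f" "w \<in> strip (1 - eps)"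
    "\<And>w. w \<in> strip 1 \<Longrightarrow> (f has_field_derivative f' w) (at w)"
  shows "(hankel_op eps s f has_field_derivative hankel_op eps s f' w) (at w)"
proof -
  obtain \<delta> where \<delta>: "\<delta> < 1 - eps" "w \<in> strip \<delta>" using strip_shrink[OF assms(2)] by blast
  obtain K where K: "dec_bound (\<delta> + eps) K f" using decaying_bound[OF assms(1), of "\<delta> + eps"] \<delta> by auto
  obtain C where C: "kernel_bound (norm (s - 1)) C" using hankel_kernel_bound by blast
  let ?k = "hankel_kernel eps s"
  have in1: "z - hankel eps u \<in> strip 1" if "z \<in> strip \<delta>" for z u
    using strip_diff_hankel[OF that] strip_mono[of "\<delta> + eps" 1] \<delta> by auto
  have der: "((\<lambda>z. f (z - hankel eps u) * ?k u) has_field_derivative f' (z - hankel eps u) * ?k u) (at z)"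
    if "z \<in> strip \<delta>" for z u
  proof -
    have "((\<lambda>z. z - hankel eps u) has_field_derivative 1) (at z)"
      by (auto intro!: derivative_eq_intros)
    from DERIV_chain2[where g = "\<lambda>z. z - hankel eps u", OF assms(3)[OF in1[OF that]] this]
    show ?thesis by (simp add: DERIV_cmult_right)
  qed
  have "((\<lambda>z. LINT u|lborel. f (z - hankel eps u) * ?k u) has_field_derivative
      (LINT u|lborel. deriv (\<lambda>z. f (z - hankel eps u) * ?k u) w)) (at w)"
  proof (rule has_field_derivative_lint(1)[OF open_strip \<delta>(2)])
    show "(\<lambda>z. f (z - hankel eps u) * ?k u) holomorphic_on strip \<delta>" for u
      using der by (meson field_differentiable_at_within field_differentiable_def holomorphic_onI)
    show "(\<lambda>u. f (z - hankel eps u) * ?k u) \<in> borel_measurable lborel" if "z \<in> strip \<delta>" for z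
      using that strip_mono[of \<delta> "1 - eps"] \<delta> decaying_holomorphic[OF assms(1)]
      by (intro measurable_hankel_integrand) auto
    show "integrable lborel (\<lambda>u. K * exp (\<delta> / 2) * (C * hankel_weight u))"
      using integrable_hankel_weight by simp
    show "norm (f (z - hankel eps u) * ?k u) \<le> K * exp (\<delta> / 2) * (C * hankel_weight u)"
      if z: "z \<in> strip \<delta>" for z u
    proof -
      have "norm (f (z - hankel eps u) * ?k u) \<le> K * exp (Re z / 2) * (C * hankel_weight u)"
        by (rule norm_hankel_integrand_le[OF K z C order_refl])
      also have "\<dots> \<le> K * exp (\<delta> / 2) * (C * hankel_weight u)"
        using z dec_bound_nonneg[OF K] C
        by (intro mult_right_mono mult_left_mono) (auto simp: strip_def hankel_weight_def kernel_bound_def)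
      finally show ?thesis .
    qed
  qed
  also have "(LINT u|lborel. deriv (\<lambda>z. f (z - hankel eps u) * ?k u) w) = hankel_op eps s f' w"
    unfolding hankel_op_def by (simp only: DERIV_imp_deriv[OF der[OF \<delta>(2)]])
  finally show ?thesis unfolding hankel_op_def[abs_def] .
qed

lemma holomorphic_hankel_op_exponent:
  assumes "decaying f" "w \<in> strip (1 - eps)"
  shows "(\<lambda>s. hankel_op eps s f w) holomorphic_on A"
proof -
  have "(\<lambda>s. hankel_op eps s f w) field_differentiable (at s0)" for s0
  proof -
    obtain \<delta> where \<delta>: "\<delta> < 1 - eps" "w \<in> strip \<delta>" using strip_shrink[OF assms(2)] by blast
    obtain K where K: "dec_bound (\<delta> + eps) K f" using decaying_bound[OF assms(1), of "\<delta> + eps"] \<delta> by auto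
    obtain C where C: "kernel_bound (norm (s0 - 1) + 1) C" using hankel_kernel_bound by blast
    show ?thesis unfolding hankel_op_def field_differentiable_def
    proof (rule exI, rule has_field_derivative_lint(1)[where U = "ball s0 1"])
      show "(\<lambda>u. f (w - hankel eps u) * hankel_kernel eps z u) \<in> borel_measurable lborel" for z
        using assms decaying_holomorphic by (intro measurable_hankel_integrand) auto
      show "integrable lborel (\<lambda>u. K * exp (Re w / 2) * (C * hankel_weight u))"
        using integrable_hankel_weight by simp
      fix z u assume "z \<in> ball s0 1"
      hence "norm (z - 1) \<le> norm (s0 - 1) + 1"
        using norm_triangle_ineq[of "s0 - 1" "z - s0"] by (simp add: dist_norm norm_minus_commute)
      thus "norm (f (w - hankel eps u) * hankel_kernel eps z u)
          \<le> K * exp (Re w / 2) * (C * hankel_weight u)"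
        by (intro norm_hankel_integrand_le[OF K \<delta>(2) C])
    qed (auto simp: hankel_kernel_def intro!: holomorphic_intros)
  qed
  thus ?thesis by (meson field_differentiable_at_within holomorphic_onI)
qed

lemma hankel_op_add:
  assumes "decaying f" "decaying g" "w \<in> strip (1 - eps)"
  shows "hankel_op eps s (\<lambda>w. f w + g w) w = hankel_op eps s f w + hankel_op eps s g w"
  unfolding hankel_op_def
  using integrable_hankel_integrand[OF assms(1,3), of s] integrable_hankel_integrand[OF assms(2,3), of s]
  by (simp add: distrib_right)

text \<open>The x-derivative of f(w - x) x^(s-1) is (s - 1) f(w - x) x^(s-2) - f'(w - x) x^(s-1),
  and the boundary terms vanish at both infinite ends. Trading a primitive for a lower exponent is
  what continues J^s past the poles of its coefficient.\<close>

lemma hankel_op_by_parts: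
  assumes f: "decaying f" and f': "decaying f'" and w: "w \<in> strip (1 - eps)"
    and der: "\<And>w. w \<in> strip 1 \<Longrightarrow> (f has_field_derivative f' w) (at w)"
  shows "hankel_op eps s f' w = (s - 1) * hankel_op eps (s - 1) f w"
proof -
  let ?A = "\<lambda>u. f' (w - hankel eps u) * hankel_kernel eps s u"
  let ?B = "\<lambda>u. f (w - hankel eps u) * hankel_kernel eps (s - 1) u"
  define F where "F = (\<lambda>u. f (w - hankel eps u) * exp ((s - 1) * hankel_log eps u))"
  have iA: "integrable lborel ?A" and iB: "integrable lborel ?B"
    using integrable_hankel_integrand[OF f' w] integrable_hankel_integrand[OF f w] by blast+
  have in1: "w - hankel eps u \<in> strip 1" for u using strip_diff_hankel[OF w] by simp
  \<comment> \<open>Stated for any filter along which exp (- |u| / 4) tends to 0, so that one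
    estimate serves both ends of the contour.\<close>
  have Flim: "(F \<longlongrightarrow> 0) G" if G: "((\<lambda>u::real. exp (- \<bar>u\<bar> / 4)) \<longlongrightarrow> 0) G" for G
  proof -
    obtain \<delta> where \<delta>: "\<delta> < 1 - eps" "w \<in> strip \<delta>" using strip_shrink[OF w] by blast
    obtain K where K: "dec_bound (\<delta> + eps) K f" using decaying_bound[OF f, of "\<delta> + eps"] \<delta> by auto
    obtain C where C: "0 \<le> C"
      "\<And>u. exp (- Re (hankel eps u) / 2) * exp (norm (s - 1) * norm (hankel_log eps u)) \<le> C * exp (- \<bar>u\<bar> / 4)"
      using hankel_growth[of "norm (s - 1)"] by auto
    have "norm (F u) \<le> K * exp (Re w / 2) * C * exp (- \<bar>u\<bar> / 4)" for u
    proof -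
      have "norm (f (w - hankel eps u)) \<le> K * exp (Re (w - hankel eps u) / 2)"
        by (rule dec_boundD[OF K strip_diff_hankel[OF \<delta>(2)]])
      also have "\<dots> = K * exp (Re w / 2) * exp (- Re (hankel eps u) / 2)"
        by (simp only: exp_half_diff mult.assoc)
      finally have "norm (F u) \<le> K * exp (Re w / 2) * exp (- Re (hankel eps u) / 2) *
          exp (norm ((s - 1) * hankel_log eps u))"
        unfolding F_def norm_mult[of "f _"] using dec_bound_nonneg[OF K]
        by (intro mult_mono norm_exp) simp_all
      also have "\<dots> = K * exp (Re w / 2) * (exp (- Re (hankel eps u) / 2) * exp (norm (s - 1) * norm (hankel_log eps u)))"
        by (simp add: norm_mult)
      also have "\<dots> \<le> K * exp (Re w / 2) * (C * exp (- \<bar>u\<bar> / 4))"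
        using C dec_bound_nonneg[OF K] by (intro mult_left_mono) auto
      finally show ?thesis by simp
    qed
    moreover have "((\<lambda>u. K * exp (Re w / 2) * C * exp (- \<bar>u\<bar> / 4)) \<longlongrightarrow> 0) G"
      using tendsto_mult[OF tendsto_const G, of "K * exp (Re w / 2) * C"] by simp
    ultimately show ?thesis by (intro Lim_null_comparison[of F]) auto
  qed
  have l1: "(\<lambda>n. F (real n)) \<longlonglongrightarrow> 0"
  proof -
    have "(F \<longlongrightarrow> 0) at_top" by (rule Flim) real_asymp
    thus ?thesis by (rule filterlim_compose) (rule filterlim_real_sequentially)
  qed
  have l2: "(\<lambda>n. F (- real n)) \<longlonglongrightarrow> 0"
  proof -
    have "(F \<longlongrightarrow> 0) at_bot" by (rule Flim) real_asymp
    thus ?thesis by (rule filterlim_compose) real_asymp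
  qed
  have "(LINT u|lborel. indicator UNIV u *\<^sub>R ((s - 1) * ?B u - ?A u)) = 0"
  proof (rule lint_FTC_exhaust[where a = "\<lambda>n. - real n" and b = real and F = F and S = "{0, 2 * pi}"])
    show "integrable lborel (\<lambda>u. indicator UNIV u *\<^sub>R ((s - 1) * ?B u - ?A u))"
      using iA iB by simp
    show "\<forall>\<^sub>F n in sequentially. u \<in> {- real n..real n}" for u
    proof -
      have "\<forall>\<^sub>F n in sequentially. \<bar>u\<bar> \<le> real n"
        using eventually_ge_at_top[of "nat \<lceil>\<bar>u\<bar>\<rceil>"] by eventually_elim linarith
      thus ?thesis by eventually_elim auto
    qed
    show "continuous_on {- real n..real n} F" for n unfolding F_def
      using continuous_along_hankel[OF decaying_holomorphic[OF f] w]
      by (intro continuous_intros continuous_hankel_log)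
    show "(F has_vector_derivative ((s - 1) * ?B u - ?A u)) (at u)"
      if "u \<in> {- real n<..<real n} - {0, 2 * pi}" for n u
    proof -
      have u: "u \<notin> {0, 2 * pi}" using that by auto
      have "((\<lambda>u. w - hankel eps u) has_vector_derivative - hankel_deriv eps u) (at u)"
        using has_vector_derivative_diff[OF has_vector_derivative_const has_vector_derivative_hankel[OF u]] hankel_deriv_eq[OF u]
        by simp
      from field_vector_diff_chain_at[OF this der[OF in1]]
      have 1: "((\<lambda>u. f (w - hankel eps u)) has_vector_derivative - hankel_deriv eps u * f' (w - hankel eps u)) (at u)"
        by (simp add: o_def)
      have "((\<lambda>u. (s - 1) * hankel_log eps u) has_vector_derivative (s - 1) * hankel_log_deriv eps u) (at u)"
        by (rule has_vector_derivative_mult_right[OF has_vector_derivative_hankel_log[OF u]])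
      from field_vector_diff_chain_at[OF this DERIV_exp]
      have 2: "((\<lambda>u. exp ((s - 1) * hankel_log eps u)) has_vector_derivative
          (s - 1) * hankel_log_deriv eps u * exp ((s - 1) * hankel_log eps u)) (at u)"
        by (simp add: o_def)
      have 3: "exp ((s - 1 - 1) * hankel_log eps u) * hankel eps u = exp ((s - 1) * hankel_log eps u)"
        by (simp add: hankel_def algebra_simps flip: exp_add)
      have "(F has_vector_derivative
          f (w - hankel eps u) * ((s - 1) * hankel_log_deriv eps u * exp ((s - 1) * hankel_log eps u)) +
          (- hankel_deriv eps u * f' (w - hankel eps u)) * exp ((s - 1) * hankel_log eps u)) (at u)"
        unfolding F_def by (rule has_vector_derivative_mult[OF 1 2])
      also have "f (w - hankel eps u) * ((s - 1) * hankel_log_deriv eps u * exp ((s - 1) * hankel_log eps u)) +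
          (- hankel_deriv eps u * f' (w - hankel eps u)) * exp ((s - 1) * hankel_log eps u) = (s - 1) * ?B u - ?A u"
        unfolding hankel_kernel_def 3[symmetric] hankel_deriv_eq[OF u] by (simp add: algebra_simps)
      finally show ?thesis .
    qed
    show "(\<lambda>n. F (real n) - F (- real n)) \<longlonglongrightarrow> 0" using tendsto_diff[OF l1 l2] by simp
  qed auto
  thus ?thesis using iA iB unfolding hankel_op_def by simp
qed

end

lemma hankel_op_cmult: "hankel_op eps s (\<lambda>w. c * f w) w = c * hankel_op eps s f w"
  unfolding hankel_op_def by (simp add: mult.assoc)

section \<open>Rays, circle and independence of the radius\<close>

definition ray_integral :: "real \<Rightarrow> complex \<Rightarrow> (complex \<Rightarrow> complex) \<Rightarrow> complex \<Rightarrow> complex" where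
  "ray_integral eps s f w =
     (LINT x|lborel. indicator {eps<..} x *\<^sub>R (f (w - of_real x) * exp ((s - 1) * of_real (ln x))))"

text \<open>Written in the coordinate z = log x, where x^(s-1) dx becomes e^(s z) dz; hence the
  exponent s in place of s - 1.\<close>

definition circle_integral :: "real \<Rightarrow> complex \<Rightarrow> (complex \<Rightarrow> complex) \<Rightarrow> complex \<Rightarrow> complex" where
  "circle_integral eps s f w =
     (LINT u|lborel. indicator {0..2 * pi} u *\<^sub>R
        (f (w - exp (of_real (ln eps) + \<i> * of_real u)) * exp (s * (of_real (ln eps) + \<i> * of_real u)) * \<i>))"

context
  fixes eps :: real
  assumes eps: "eps > 0"
begin

text \<open>Both rays carry the same integral: the incoming one with the sign -1 of its orientation,
  the outgoing one with the factor e^(2 \<pi> i s) of the branch of the logarithm; the factor e^(-2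
  \<pi> i) that belongs to x^(-1) is 1.\<close>

lemma hankel_op_decompose:
  assumes f: "decaying f" and w: "w \<in> strip (1 - eps)"
  shows "hankel_op eps s f w =
      (exp (2 * of_real pi * \<i> * s) - 1) * ray_integral eps s f w + circle_integral eps s f w"
    and "integrable lborel (\<lambda>x. indicator {eps<..} x *\<^sub>R (f (w - of_real x) * exp ((s - 1) * of_real (ln x))))"
proof -
  define \<phi> where "\<phi> = (\<lambda>u. f (w - hankel eps u) * hankel_kernel eps s u)"
  have int: "integrable lborel \<phi>" unfolding \<phi>_def by (rule integrable_hankel_integrand[OF eps f w])
  have i: "integrable lborel (\<lambda>u. indicator A u *\<^sub>R \<phi> u)" if "A \<in> sets lborel" for A
    by (rule integrable_mult_indicator[OF that int])
  let ?r = "\<lambda>x. indicator {eps<..} x *\<^sub>R (f (w - of_real x) * exp ((s - 1) * of_real (ln x)))"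
  have in_ray: "indicator {..<0} (eps + (-1) * x) *\<^sub>R \<phi> (eps + (-1) * x) = - ?r x" for x
  proof (cases "x > eps")
    case True
    hence u: "eps - x < 0" by simp
    have "eps - x \<noteq> 2 * pi" using u pi_gt_zero by linarith
    hence "eps - x \<notin> {0, 2 * pi}" using u by auto
    hence d: "hankel_deriv eps (eps - x) = -1"
      using hankel_deriv_eq[OF eps] hankel_explicit[OF eps, of "eps - x"] u True eps
      by (simp add: hankel_log_deriv_def)
    show ?thesis using u True d hankel_explicit[OF eps, of "eps - x"]
      by (simp add: \<phi>_def hankel_kernel_def hankel_log_def)
  qed auto
  have out_ray: "indicator {2*pi<..} ((2 * pi - eps) + 1 * x) *\<^sub>R \<phi> ((2 * pi - eps) + 1 * x) =
      exp (2 * of_real pi * \<i> * s) * ?r x" for x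
  proof (cases "x > eps")
    case True
    define u where "u = 2 * pi - eps + x"
    have u: "u > 2 * pi" "u > 0" using True pi_gt_zero by (auto simp: u_def intro: less_trans[OF _ True] simp del: pi_gt_zero)
    have d: "hankel_deriv eps u = 1"
      using hankel_deriv_eq[OF eps, of u] hankel_explicit[OF eps, of u] u True eps
      by (simp add: hankel_log_deriv_def u_def)
    have "exp ((s - 1) * (of_real (ln x) + \<i> * of_real (2 * pi)))
        = exp ((s - 1) * of_real (ln x)) * exp (2 * of_real pi * \<i> * s) * exp (- (2 * of_real pi * \<i>))"
      by (simp add: algebra_simps flip: exp_add)
    moreover have "hankel_log eps u = of_real (ln x) + \<i> * of_real (2 * pi)"
      using hankel_log_gt[OF eps, of u] u by (simp add: u_def)
    moreover have "exp (- (2 * of_real pi * \<i>)) = 1" by (simp add: exp_minus)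
    moreover have "hankel eps u = of_real x" using hankel_explicit[OF eps, of u] u by (simp add: u_def)
    ultimately have "\<phi> u = exp (2 * of_real pi * \<i> * s) * (f (w - of_real x) * exp ((s - 1) * of_real (ln x)))"
      using d by (simp add: \<phi>_def hankel_kernel_def)
    thus ?thesis using True u by (simp add: u_def)
  next
    case False
    thus ?thesis by (simp add: indicator_def)
  qed
  have "integrable lborel (\<lambda>x. indicator {..<0} (eps + (-1) * x) *\<^sub>R \<phi> (eps + (-1) * x))"
    by (rule lborel_integrable_real_affine[OF i]) auto
  thus ir: "integrable lborel ?r" unfolding in_ray by simp
  have 1: "(LINT u|lborel. indicator {..<0} u *\<^sub>R \<phi> u) = - ray_integral eps s f w"
    by (subst lborel_integral_real_affine[of "-1" _ eps]) (simp_all add: in_ray[simplified] ray_integral_def)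
  have 2: "(LINT u|lborel. indicator {2*pi<..} u *\<^sub>R \<phi> u) = exp (2 * of_real pi * \<i> * s) * ray_integral eps s f w"
    by (subst lborel_integral_real_affine[of 1 _ "2 * pi - eps"])
       (simp_all only: out_ray integral_mult_right_zero ray_integral_def, simp_all)
  have 3: "(LINT u|lborel. indicator {0..2*pi} u *\<^sub>R \<phi> u) = circle_integral eps s f w"
    unfolding circle_integral_def
  proof (rule integral_cong_AE)
    show "(\<lambda>u. indicator {0..2*pi} u *\<^sub>R \<phi> u) \<in> borel_measurable lborel"
      using i by (rule borel_measurable_integrable) simp
    have c: "continuous_on {0..2*pi} (\<lambda>u. f (w - exp (of_real (ln eps) + \<i> * of_real u)))"
    proof (rule continuous_on_eq[OF continuous_along_hankel[OF eps decaying_holomorphic[OF f] w]])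
      fix u assume "u \<in> {0..2*pi}"
      thus "f (w - hankel eps u) = f (w - exp (of_real (ln eps) + \<i> * of_real u))"
        by (auto simp: hankel_def hankel_log_def)
    qed
    show "(\<lambda>u. indicator {0..2*pi} u *\<^sub>R (f (w - exp (of_real (ln eps) + \<i> * of_real u)) *
        exp (s * (of_real (ln eps) + \<i> * of_real u)) * \<i>)) \<in> borel_measurable lborel"
      unfolding measurable_lborel2
      by (intro borel_measurable_continuous_on_indicator continuous_intros c) simp
    have eq: "indicator {0..2*pi} u *\<^sub>R \<phi> u = indicator {0..2*pi} u *\<^sub>R (f (w - exp (of_real (ln eps) + \<i> * of_real u)) *
        exp (s * (of_real (ln eps) + \<i> * of_real u)) * \<i>)" if "u \<notin> {0, 2 * pi}" for u
    proof (cases "u \<in> {0..2*pi}")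
      case True
      let ?z = "of_real (ln eps) + \<i> * of_real u"
      have h: "hankel_log eps u = ?z" "hankel eps u = exp ?z" "hankel_log_deriv eps u = \<i>"
        using True by (auto simp: hankel_def hankel_log_def hankel_log_deriv_def)
      have "exp ((s - 1) * ?z) * exp ?z = exp (s * ?z)" by (simp add: algebra_simps flip: exp_add)
      thus ?thesis unfolding \<phi>_def hankel_kernel_def hankel_deriv_eq[OF eps that] h by (simp add: mult.assoc)
    qed simp
    show "AE u in lborel. indicator {0..2*pi} u *\<^sub>R \<phi> u = indicator {0..2*pi} u *\<^sub>R (f (w - exp (of_real (ln eps) + \<i> * of_real u)) *
        exp (s * (of_real (ln eps) + \<i> * of_real u)) * \<i>)"
      using eq by (intro AE_I'[of "{0, 2 * pi}"]) (auto intro!: finite_imp_null_set_lborel)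
  qed
  have split: "\<phi> u = indicator {..<0} u *\<^sub>R \<phi> u + indicator {0..2*pi} u *\<^sub>R \<phi> u + indicator {2*pi<..} u *\<^sub>R \<phi> u" for u
  proof -
    consider "u < 0" "u \<le> 2 * pi" | "0 \<le> u" "u \<le> 2 * pi" | "u > 2 * pi" "\<not> u < 0"
      using pi_gt_zero by linarith
    thus ?thesis by cases auto
  qed
  have "(LINT u|lborel. \<phi> u) = (LINT u|lborel. indicator {..<0} u *\<^sub>R \<phi> u + indicator {0..2*pi} u *\<^sub>R \<phi> u + indicator {2*pi<..} u *\<^sub>R \<phi> u)"
    by (rule Bochner_Integration.integral_cong[OF refl split])
  also have "\<dots> = (LINT u|lborel. indicator {..<0} u *\<^sub>R \<phi> u) + (LINT u|lborel. indicator {0..2*pi} u *\<^sub>R \<phi> u) +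
     (LINT u|lborel. indicator {2*pi<..} u *\<^sub>R \<phi> u)"
    using i[of "{..<0}"] i[of "{0..2*pi}"] i[of "{2*pi<..}"] by simp
  finally have "(LINT u|lborel. \<phi> u) = - ray_integral eps s f w + circle_integral eps s f w + exp (2 * of_real pi * \<i> * s) * ray_integral eps s f w"
    unfolding 1 2 3 .
  thus "hankel_op eps s f w = (exp (2 * of_real pi * \<i> * s) - 1) * ray_integral eps s f w + circle_integral eps s f w"
    unfolding hankel_op_def \<phi>_def by (simp add: algebra_simps)
qed

text \<open>At s = 0 the rays cancel, and Cauchy's formula for f(w - x) / x on the circle picks out
  f(w). This is the source of J^0 = id, from which all integer powers are reached.\<close>

lemma hankel_op_zero:
  assumes f: "decaying f" and w: "w \<in> strip (1 - eps)"
  shows "hankel_op eps 0 f w = 2 * of_real pi * \<i> * f w"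
proof -
  have in1: "w - y \<in> strip 1" if "norm y \<le> eps" for y
    using w that abs_Re_le_cmod[of y] abs_Im_le_cmod[of y] by (auto simp: strip_def)
  have hol: "(\<lambda>y. f (w - y)) holomorphic_on cball 0 eps"
    using in1 by (intro holomorphic_on_compose_gen[OF _ decaying_holomorphic[OF f], unfolded o_def])
      (auto intro!: holomorphic_intros)
  have "((\<lambda>y. f (w - y) / (y - 0)) has_contour_integral 2 * of_real pi * \<i> * f (w - 0)) (circlepath 0 eps)"
    by (rule Cauchy_integral_circlepath_simple[OF hol]) (use eps in auto)
  hence "((\<lambda>t. f (w - (0 + eps * cis t)) / (0 + eps * cis t - 0) * eps * \<i> * cis t) has_integral 2 * of_real pi * \<i> * f w) {0..2*pi}"
    unfolding circlepath_def by (subst (asm) has_contour_integral_part_circlepath_iff) auto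
  hence 1: "((\<lambda>t. f (w - eps * cis t) * \<i>) has_integral 2 * of_real pi * \<i> * f w) {0..2*pi}"
    using eps by (simp add: cis_neq_zero)
  have e: "exp (of_real (ln eps) + \<i> * of_real u) = eps * cis u" for u
    using eps by (simp add: exp_add exp_of_real cis_conv_exp)
  have "continuous_on {0..2*pi} (\<lambda>t. f (w - eps * cis t) * \<i>)"
  proof (intro continuous_on_mult continuous_on_const
      continuous_on_compose2[OF holomorphic_on_imp_continuous_on[OF decaying_holomorphic[OF f]]])
    show "(\<lambda>t. w - eps * cis t) ` {0..2*pi} \<subseteq> strip 1"
      using in1 eps by (intro image_subsetI) (simp add: norm_mult)
  qed (auto intro!: continuous_intros)
  hence "integrable lborel (\<lambda>t. indicator {0..2*pi} t *\<^sub>R (f (w - eps * cis t) * \<i>))"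
    unfolding set_integrable_def[symmetric] by (rule borel_integrable_atLeastAtMost')
  from has_integral_integral_lborel[OF this]
  have "((\<lambda>t. indicator {0..2*pi} t *\<^sub>R (f (w - eps * cis t) * \<i>)) has_integral circle_integral eps 0 f w) UNIV"
    unfolding circle_integral_def e by simp
  moreover have "(\<lambda>t. indicator {0..2*pi} t *\<^sub>R (f (w - eps * cis t) * \<i>)) =
      (\<lambda>t. if t \<in> {0..2*pi} then f (w - eps * cis t) * \<i> else 0)"
    by (auto simp: indicator_def)
  ultimately have "((\<lambda>t. f (w - eps * cis t) * \<i>) has_integral circle_integral eps 0 f w) {0..2*pi}"
    by (simp only: has_integral_restrict_UNIV)
  with 1 have "circle_integral eps 0 f w = 2 * of_real pi * \<i> * f w" by (rule has_integral_unique[rotated])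
  thus ?thesis unfolding hankel_op_decompose(1)[OF f w] by simp
qed

end

text \<open>In the coordinate \<open>z = log x\<close> the contour is a path in the plane whose part near the origin lies
  in a half plane, where the integrand has a primitive.\<close>

lemma hankel_op_radius_less:
  assumes f: "decaying f" and e: "0 < e1" "e1 < e2" and w2: "w \<in> strip (1 - e2)"
  shows "hankel_op e1 s f w = hankel_op e2 s f w"
proof -
  have e2: "0 < e2" using e by simp
  have w1: "w \<in> strip (1 - e1)" using w2 strip_mono[of "1 - e2" "1 - e1"] e by auto
  obtain \<delta> where \<delta>: "\<delta> < 1 - e2" "w \<in> strip \<delta>" using strip_shrink[OF w2] by blast
  \<comment> \<open>For |x| < \<rho> the point w - x stays in \<open>strip 1\<close>, so the half
    plane \<open>H\<close> in the coordinate log x contains both circles and the segments between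
    them.\<close>
  define \<rho> where "\<rho> = 1 - \<delta>"
  have \<rho>: "\<rho> > e2" using \<delta> by (simp add: \<rho>_def)
  define H where "H = {z. Re z < ln \<rho>}"
  define h where "h = (\<lambda>z. f (w - exp z) * exp (s * z))"
  have H: "open H" "convex H" unfolding H_def by (auto simp: open_halfspace_Re_lt convex_halfspace_Re_lt)
  have in1: "w - exp z \<in> strip 1" if "z \<in> H" for z
  proof -
    have "norm (exp z) < \<rho>" using that \<rho> e
      by (metis H_def exp_less_mono exp_ln mem_Collect_eq norm_exp_eq_Re order.strict_trans)
    thus ?thesis using \<delta> abs_Re_le_cmod[of "exp z"] abs_Im_le_cmod[of "exp z"]
      by (auto simp: strip_def \<rho>_def)
  qed
  have "h holomorphic_on H" unfolding h_def
    using in1 by (intro holomorphic_intros holomorphic_on_compose_gen[OF _ decaying_holomorphic[OF f], unfolded o_def])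
      auto
  then obtain P where P0: "\<And>z. z \<in> H \<Longrightarrow> (P has_field_derivative h z) (at z within H)"
    using holomorphic_convex_primitive'[OF H(2,1)] by blast
  have P: "(P has_field_derivative h z) (at z)" if "z \<in> H" for z
    using P0[OF that] at_within_open[OF that H(1)] by simp
  have contP: "continuous_on H h" using \<open>h holomorphic_on H\<close> holomorphic_on_imp_continuous_on by blast
  have circle: "circle_integral e s f w = P (of_real (ln e) + \<i> * of_real (2 * pi)) - P (of_real (ln e))"
    if "0 < e" "e < \<rho>" for e
  proof -
    have inH: "of_real (ln e) + \<i> * of_real u \<in> H" for u using that by (simp add: H_def)
    have "(LINT u|lborel. indicator {0..2*pi} u *\<^sub>R (h (of_real (ln e) + \<i> * of_real u) * \<i>)) =
        P (of_real (ln e) + \<i> * of_real (2 * pi)) - P (of_real (ln e) + \<i> * of_real 0)"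
    proof (rule integral_FTC_atLeastAtMost)
      show "continuous_on {0..2 * pi} (\<lambda>u. h (of_real (ln e) + \<i> * of_real u) * \<i>)"
        using inH by (intro continuous_intros continuous_on_compose2[OF contP]) auto
      fix u :: real
      have "((\<lambda>u. of_real (ln e) + \<i> * of_real u) has_vector_derivative \<i>) (at u within {0..2 * pi})"
        by (auto intro!: derivative_eq_intros has_vector_derivative_of_real)
      from field_vector_diff_chain_within[OF this has_field_derivative_at_within[OF P[OF inH]]]
      show "((\<lambda>u. P (of_real (ln e) + \<i> * of_real u)) has_vector_derivative
          h (of_real (ln e) + \<i> * of_real u) * \<i>) (at u within {0..2 * pi})"
        by (simp add: o_def mult.commute)
    qed simp
    thus ?thesis unfolding circle_integral_def h_def by simp
  qed
  let ?g = "\<lambda>x. f (w - of_real x) * exp ((s - 1) * of_real (ln x))"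
  define M where "M = (LINT x|lborel. indicator {e1..e2} x *\<^sub>R ?g x)"
  \<comment> \<open>n = 0 and n = 1 are the two sheets over the segment from \<open>e1\<close> to
    \<open>e2\<close>: its positions on the incoming and on the outgoing ray.\<close>
  have segment: "(LINT x|lborel. indicator {e1..e2} x *\<^sub>R (exp (s * (\<i> * of_real (2 * pi * real n))) * ?g x)) =
      P (of_real (ln e2) + \<i> * of_real (2 * pi * real n)) - P (of_real (ln e1) + \<i> * of_real (2 * pi * real n))" for n
  proof (rule integral_FTC_atLeastAtMost)
    have inH: "of_real (ln x) + \<i> * of_real (2 * pi * real n) \<in> H" if "x \<in> {e1..e2}" for x
      using that \<rho> e by (simp add: H_def)
    have hx: "h (of_real (ln x) + \<i> * of_real (2 * pi * real n)) * of_real (1 / x) =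
        exp (s * (\<i> * of_real (2 * pi * real n))) * ?g x" if "x \<in> {e1..e2}" for x
    proof -
      have x: "x > 0" using that e by simp
      have "exp (\<i> * of_real (2 * pi * real n)) = 1"
        using exp_integer_2pi[of "of_nat n"] by (simp add: mult_ac)
      hence 1: "exp (of_real (ln x) + \<i> * of_real (2 * pi * real n)) = of_real x"
        using x by (simp add: exp_add exp_of_real)
      have 2: "exp ((s - 1) * of_real (ln x)) = exp (s * of_real (ln x)) * of_real (1 / x)"
        using x by (simp add: left_diff_distrib exp_diff exp_of_real)
      show ?thesis unfolding h_def 1 2 by (simp add: distrib_left exp_add mult_ac)
    qed
    show "e1 \<le> e2" using e by simp
    show "continuous_on {e1..e2} (\<lambda>x. exp (s * (\<i> * of_real (2 * pi * real n))) * ?g x)"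
    proof (rule continuous_on_eq[OF _ hx])
      show "continuous_on {e1..e2} (\<lambda>x. h (of_real (ln x) + \<i> * of_real (2 * pi * real n)) * of_real (1 / x))"
        using inH e by (intro continuous_intros continuous_on_compose2[OF contP]) auto
    qed
    fix x assume x: "e1 \<le> x" "x \<le> e2"
    hence xi: "x \<in> {e1..e2}" "x > 0" using e by auto
    have "((\<lambda>x. complex_of_real (ln x)) has_vector_derivative of_real (1 / x)) (at x within {e1..e2})"
      using xi by (intro has_vector_derivative_of_real) (auto intro!: derivative_eq_intros)
    from has_vector_derivative_add[OF this has_vector_derivative_const[of "\<i> * of_real (2 * pi * real n)"]]
    have "((\<lambda>x. of_real (ln x) + \<i> * of_real (2 * pi * real n)) has_vector_derivative of_real (1 / x)) (at x within {e1..e2})"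
      by simp
    from field_vector_diff_chain_within[OF this has_field_derivative_at_within[OF P[OF inH[OF xi(1)]]]]
    show "((\<lambda>x. P (of_real (ln x) + \<i> * of_real (2 * pi * real n))) has_vector_derivative
        exp (s * (\<i> * of_real (2 * pi * real n))) * ?g x) (at x within {e1..e2})"
      unfolding hx[OF xi(1), symmetric] by (simp add: o_def mult.commute)
  qed
  have s0: "M = P (of_real (ln e2)) - P (of_real (ln e1))"
    using segment[of 0] unfolding M_def by simp
  have s1: "exp (2 * of_real pi * \<i> * s) * M = P (of_real (ln e2) + \<i> * of_real (2 * pi)) - P (of_real (ln e1) + \<i> * of_real (2 * pi))"
  proof -
    have "(LINT x|lborel. indicator {e1..e2} x *\<^sub>R (c * ?g x)) = c * M" for c
      unfolding M_def by (simp flip: integral_mult_right_zero)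
    moreover have "exp (2 * of_real pi * \<i> * s) = exp (s * (\<i> * of_real (2 * pi * real 1)))"
      by (simp add: mult_ac)
    ultimately have "exp (2 * of_real pi * \<i> * s) * M =
        P (of_real (ln e2) + \<i> * of_real (2 * pi * real 1)) - P (of_real (ln e1) + \<i> * of_real (2 * pi * real 1))"
      using segment[of 1] by simp
    thus ?thesis by simp
  qed
  have ray: "ray_integral e1 s f w = M + ray_integral e2 s f w"
  proof -
    note i1 = hankel_op_decompose(2)[OF e(1) f w1, of s] and i2 = hankel_op_decompose(2)[OF e2 f w2, of s]
    have im: "integrable lborel (\<lambda>x. indicator {e1<..e2} x *\<^sub>R ?g x)"
    proof -
      have "indicator {e1<..e2} x *\<^sub>R (indicator {e1<..} x *\<^sub>R ?g x) = indicator {e1<..e2} x *\<^sub>R ?g x" for x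
        by (auto simp: indicator_def)
      moreover have "integrable lborel (\<lambda>x. indicator {e1<..e2} x *\<^sub>R (indicator {e1<..} x *\<^sub>R ?g x))"
        by (rule integrable_mult_indicator[OF _ i1]) simp
      ultimately show ?thesis by (simp only:)
    qed
    have "ray_integral e1 s f w = (LINT x|lborel. indicator {e1<..e2} x *\<^sub>R ?g x + indicator {e2<..} x *\<^sub>R ?g x)"
      unfolding ray_integral_def
      by (rule Bochner_Integration.integral_cong) (use e in \<open>auto simp: indicator_def\<close>)
    also have "\<dots> = (LINT x|lborel. indicator {e1<..e2} x *\<^sub>R ?g x) + ray_integral e2 s f w"
      unfolding ray_integral_def using im i2 by (rule Bochner_Integration.integral_add)
    also have "(LINT x|lborel. indicator {e1<..e2} x *\<^sub>R ?g x) = M"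
      unfolding M_def
    proof (rule integral_cong_AE)
      have "(\<lambda>x. indicator {e1..e2} x *\<^sub>R ?g x) \<in> borel_measurable lborel"
      proof (rule measurable_discrete_difference[where X = "{e1}"])
        show "(\<lambda>x. indicator {e1<..e2} x *\<^sub>R ?g x) \<in> borel_measurable lborel"
          using im by (rule borel_measurable_integrable)
      qed (auto simp: indicator_def)
      thus "(\<lambda>x. indicator {e1..e2} x *\<^sub>R ?g x) \<in> borel_measurable lborel" .
      show "(\<lambda>x. indicator {e1<..e2} x *\<^sub>R ?g x) \<in> borel_measurable lborel"
        using im by (rule borel_measurable_integrable)
      show "AE x in lborel. indicator {e1<..e2} x *\<^sub>R ?g x = indicator {e1..e2} x *\<^sub>R ?g x"
        by (intro AE_I'[of "{e1}"]) (auto intro!: finite_imp_null_set_lborel simp: indicator_def)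
    qed
    finally show ?thesis .
  qed
  have "e1 < \<rho>" using e \<rho> by simp
  have "(a - 1) * (M + R) = a * M - M + (a - 1) * R" for a R :: complex by (simp add: algebra_simps)
  with \<open>e1 < \<rho>\<close> show ?thesis
    unfolding hankel_op_decompose(1)[OF e(1) f w1] hankel_op_decompose(1)[OF e2 f w2] ray
      circle[OF e2 \<rho>] circle[OF e(1) \<open>e1 < \<rho>\<close>]
    by (simp only: s1) (simp add: s0)
qed

lemma hankel_op_radius_indep:
  assumes "decaying f" "0 < e1" "0 < e2" "w \<in> strip (1 - e1)" "w \<in> strip (1 - e2)"
  shows "hankel_op e1 s f w = hankel_op e2 s f w"
proof (cases e1 e2 rule: linorder_cases)
  case less
  thus ?thesis by (rule hankel_op_radius_less[OF assms(1,2) _ assms(5)])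
next
  case greater
  thus ?thesis by (rule hankel_op_radius_less[OF assms(1,3) _ assms(4), symmetric])
qed simp

section \<open>Complex powers of the integration operator\<close>

text \<open>J in the variable w: with z = e^(w - x) the integral of f dz / z from 0 to e^w runs
  along the horizontal ray to the left of w.\<close>

definition primitive :: "(complex \<Rightarrow> complex) \<Rightarrow> complex \<Rightarrow> complex" where
  "primitive f w = (LINT x|lborel. indicator {0..} x *\<^sub>R f (w - of_real x))"

definition exp_mass :: real where
  "exp_mass = (LINT u|lborel. exp (- \<bar>u\<bar> / 4))"

lemma exp_mass_nonneg: "0 \<le> exp_mass"
  unfolding exp_mass_def by (rule integral_nonneg_AE) auto

lemma strip_diff_nonneg: "w \<in> strip \<delta> \<Longrightarrow> 0 \<le> x \<Longrightarrow> w - of_real x \<in> strip \<delta>"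
  by (auto simp: strip_def)

lemma primitive_integrand_bound:
  assumes "dec_bound \<delta> K f" "w \<in> strip \<delta>"
  shows "norm (indicator {0..} x *\<^sub>R f (w - of_real x)) \<le> K * exp (Re w / 2) * exp (- \<bar>x\<bar> / 4)"
proof (cases "0 \<le> x")
  case True
  have "norm (f (w - of_real x)) \<le> K * exp (Re (w - of_real x) / 2)"
    by (rule dec_boundD[OF assms(1) strip_diff_nonneg[OF assms(2) True]])
  also have "exp (Re (w - of_real x) / 2) = exp (Re w / 2) * exp (- x / 2)"
    by (simp add: diff_divide_distrib flip: exp_add)
  also have "K * (exp (Re w / 2) * exp (- x / 2)) \<le> K * (exp (Re w / 2) * exp (- \<bar>x\<bar> / 4))"
    using True dec_bound_nonneg[OF assms(1)] by (intro mult_left_mono) auto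
  finally show ?thesis using True by (simp add: mult.assoc)
qed (use dec_bound_nonneg[OF assms(1)] in auto)

lemma measurable_primitive_integrand:
  assumes "f holomorphic_on strip 1" "w \<in> strip 1"
  shows "(\<lambda>x. indicator {0..} x *\<^sub>R f (w - of_real x)) \<in> borel_measurable lborel"
proof -
  have "continuous_on {0..} (\<lambda>x::real. f (w - of_real x))"
    by (rule continuous_on_compose2[OF holomorphic_on_imp_continuous_on[OF assms(1)]])
       (use strip_diff_nonneg[OF assms(2)] in \<open>auto intro!: continuous_intros\<close>)
  thus ?thesis unfolding measurable_lborel2
    by (intro borel_measurable_continuous_on_indicator) auto
qed

lemma integrable_primitive_integrand:
  assumes "decaying f" "w \<in> strip 1"
  shows "integrable lborel (\<lambda>x. indicator {0..} x *\<^sub>R f (w - of_real x))"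
proof -
  obtain \<delta> where \<delta>: "\<delta> < 1" "w \<in> strip \<delta>" using strip_shrink[OF assms(2)] by blast
  obtain K where K: "dec_bound \<delta> K f" using decaying_bound[OF assms(1) \<delta>(1)] by blast
  show ?thesis
  proof (rule Bochner_Integration.integrable_bound)
    show "integrable lborel (\<lambda>x. K * exp (Re w / 2) * exp (- \<bar>x\<bar> / 4))"
      using integrable_exp_abs by simp
    show "AE x in lborel. norm (indicator {0..} x *\<^sub>R f (w - of_real x)) \<le> norm (K * exp (Re w / 2) * exp (- \<bar>x\<bar> / 4))"
      by (rule AE_I2, rule order_trans[OF primitive_integrand_bound[OF K \<delta>(2)]])
        (simp only: real_norm_def abs_ge_self)
  qed (rule measurable_primitive_integrand[OF decaying_holomorphic[OF assms(1)] assms(2)])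
qed

lemma dec_bound_primitive:
  assumes "decaying f" "\<delta> < 1" "dec_bound \<delta> K f"
  shows "dec_bound \<delta> (exp_mass * K) (primitive f)"
  unfolding dec_bound_def
proof (intro conjI ballI)
  show "0 \<le> exp_mass * K" using exp_mass_nonneg dec_bound_nonneg[OF assms(3)] by simp
  fix w assume w: "w \<in> strip \<delta>"
  have w1: "w \<in> strip 1" using w strip_mono[of \<delta> 1] assms by auto
  have "norm (primitive f w) \<le> (LINT x|lborel. norm (indicator {0..} x *\<^sub>R f (w - of_real x)))"
    unfolding primitive_def by (rule integral_norm_bound)
  also have "\<dots> \<le> (LINT x|lborel. K * exp (Re w / 2) * exp (- \<bar>x\<bar> / 4))"
    by (rule integral_mono[OF integrable_norm[OF integrable_primitive_integrand[OF assms(1) w1]]])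
       (use integrable_exp_abs primitive_integrand_bound[OF assms(3) w] in auto)
  finally show "norm (primitive f w) \<le> exp_mass * K * exp (Re w / 2)"
    by (simp add: exp_mass_def mult_ac)
qed

text \<open>Under the integral the w-derivative of f(w - x) is minus its x-derivative, so the
  integral telescopes to f(w) minus a limit that vanishes by decay.\<close>

lemma has_field_derivative_primitive:
  assumes f: "decaying f" and w: "w \<in> strip 1"
  shows "(primitive f has_field_derivative f w) (at w)"
proof -
  obtain \<delta> where \<delta>: "\<delta> < 1" "w \<in> strip \<delta>" using strip_shrink[OF w] by blast
  obtain K where K: "dec_bound \<delta> K f" using decaying_bound[OF f \<delta>(1)] by blast
  have hol: "f holomorphic_on strip 1" by (rule decaying_holomorphic[OF f])
  have sub: "z \<in> strip 1" if "z \<in> strip \<delta>" for z using that strip_mono[of \<delta> 1] \<delta> by auto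
  have der: "((\<lambda>z. f (z - of_real x)) has_field_derivative deriv f (z - of_real x)) (at z)"
    if "z \<in> strip 1" "0 \<le> x" for z x
  proof -
    have "((\<lambda>z. z - of_real x) has_field_derivative 1) (at z)"
      by (auto intro!: derivative_eq_intros)
    from DERIV_chain2[where g = "\<lambda>z. z - of_real x",
        OF holomorphic_derivI[OF hol open_strip strip_diff_nonneg[OF that]] this]
    show ?thesis by simp
  qed
  have der': "((\<lambda>z. indicator {0..} x *\<^sub>R f (z - of_real x)) has_field_derivative
      indicator {0..} x *\<^sub>R deriv f (z - of_real x)) (at z)" if "z \<in> strip 1" for z x
    using der[OF that, of x] by (cases "0 \<le> x") auto
  have bound: "norm (indicator {0..} x *\<^sub>R f (z - of_real x)) \<le> K * exp (\<delta> / 2) * exp (- \<bar>x\<bar> / 4)"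
    if "z \<in> strip \<delta>" for z x
  proof -
    note primitive_integrand_bound[OF K that, of x]
    also have "K * exp (Re z / 2) * exp (- \<bar>x\<bar> / 4) \<le> K * exp (\<delta> / 2) * exp (- \<bar>x\<bar> / 4)"
      using that dec_bound_nonneg[OF K] by (intro mult_right_mono mult_left_mono) (auto simp: strip_def)
    finally show ?thesis .
  qed
  have holo: "(\<lambda>z. indicator {0..} x *\<^sub>R f (z - of_real x)) holomorphic_on strip \<delta>" for x
    using der'[OF sub] unfolding holomorphic_on_def field_differentiable_def
    by (blast intro: has_field_derivative_at_within)
  have meas: "(\<lambda>x. indicator {0..} x *\<^sub>R f (z - of_real x)) \<in> borel_measurable lborel" if "z \<in> strip \<delta>" for z
    by (rule measurable_primitive_integrand[OF hol sub[OF that]])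
  have gi: "integrable lborel (\<lambda>x. K * exp (\<delta> / 2) * exp (- \<bar>x\<bar> / 4))"
    using integrable_exp_abs by simp
  note D = has_field_derivative_lint[OF open_strip \<delta>(2) holo meas gi bound,
      unfolded DERIV_imp_deriv[OF der'[OF w]]]
  have "(LINT x|lborel. indicator {0..} x *\<^sub>R deriv f (w - of_real x)) = f w"
  proof (rule lint_FTC_exhaust[where S = "{}" and a = "\<lambda>_. 0" and b = real and F = "\<lambda>x. - f (w - of_real x)"])
    show "integrable lborel (\<lambda>x. indicator {0..} x *\<^sub>R deriv f (w - of_real x))"
      by (rule D(2))
    show "\<forall>\<^sub>F n in sequentially. u \<in> {0..real n}" if "u \<in> {0..}" for u
      using eventually_ge_at_top[of "nat \<lceil>u\<rceil>"] by eventually_elim (use that in \<open>auto intro: order_trans[OF real_nat_ceiling_ge]\<close>)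
    show "continuous_on {0..real n} (\<lambda>x. - f (w - of_real x))" for n
      by (intro continuous_on_minus continuous_on_compose2[OF holomorphic_on_imp_continuous_on[OF hol]])
         (use strip_diff_nonneg[OF w] in \<open>auto intro!: continuous_intros\<close>)
    show "((\<lambda>x. - f (w - of_real x)) has_vector_derivative deriv f (w - of_real u)) (at u)"
      if "u \<in> {0<..<real n} - {}" for n u
    proof -
      have "((\<lambda>x. w - of_real x) has_vector_derivative - 1) (at u)"
        using has_vector_derivative_diff[OF has_vector_derivative_const[of w]
            has_vector_derivative_of_real[OF DERIV_ident]] by simp
      moreover have "w - of_real u \<in> strip 1" using strip_diff_nonneg[OF w] that by auto
      ultimately have "((f \<circ> (\<lambda>x. w - of_real x)) has_vector_derivative - 1 * deriv f (w - of_real u)) (at u)"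
        using holomorphic_derivI[OF hol open_strip] by (intro field_vector_diff_chain_at)
      from has_vector_derivative_minus[OF this] show ?thesis by (simp add: o_def)
    qed
    have "(\<lambda>n. f (w - of_real (real n))) \<longlonglongrightarrow> 0"
    proof (rule Lim_null_comparison)
      show "\<forall>\<^sub>F n in sequentially. norm (f (w - of_real (real n))) \<le> K * exp (Re w / 2) * exp (- real n / 4)"
        using primitive_integrand_bound[OF K \<delta>(2), of "real _"] by (intro always_eventually) simp
      have "(\<lambda>n. exp (- real n / 4)) \<longlonglongrightarrow> 0" by real_asymp
      from tendsto_mult[OF tendsto_const this, of "K * exp (Re w / 2)"]
      show "(\<lambda>n. K * exp (Re w / 2) * exp (- real n / 4)) \<longlonglongrightarrow> 0" by simp
    qed
    from tendsto_diff[OF tendsto_const[of "f w"] this]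
    show "(\<lambda>n. - f (w - of_real (real n)) - - f (w - of_real 0)) \<longlonglongrightarrow> f w" by simp
  qed auto
  thus ?thesis using D(1) unfolding primitive_def[abs_def] by simp
qed

lemma decaying_primitive:
  assumes "decaying f" shows "decaying (primitive f)"
  unfolding decaying_def
proof
  show "primitive f holomorphic_on strip 1"
    by (rule holomorphic_onI)
       (meson assms has_field_derivative_primitive field_differentiable_at_within field_differentiable_def)
  show "\<forall>\<delta><1. \<exists>K. dec_bound \<delta> K (primitive f)"
    using dec_bound_primitive decaying_bound assms by blast
qed

lemma decaying_primitive_pow: "decaying f \<Longrightarrow> decaying ((primitive ^^ n) f)"
  by (induction n) (auto intro: decaying_primitive)

lemma dec_bound_primitive_pow:
  "decaying f \<Longrightarrow> \<delta> < 1 \<Longrightarrow> dec_bound \<delta> K f \<Longrightarrow> dec_bound \<delta> (exp_mass ^ n * K) ((primitive ^^ n) f)"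
proof (induction n)
  case (Suc n)
  have "dec_bound \<delta> (exp_mass * (exp_mass ^ n * K)) (primitive ((primitive ^^ n) f))"
    by (rule dec_bound_primitive[OF decaying_primitive_pow]) (use Suc in auto)
  thus ?case by (simp add: mult.assoc)
qed simp

lemma hankel_op_cong:
  assumes "0 < eps" "w \<in> strip (1 - eps)" "\<And>z. z \<in> strip 1 \<Longrightarrow> f z = g z"
  shows "hankel_op eps s f w = hankel_op eps s g w"
  unfolding hankel_op_def using strip_diff_hankel[OF assms(1,2)] assms(3) by simp

lemma primitive_add:
  assumes "decaying f" "decaying g" "w \<in> strip 1"
    and h: "\<And>z. z \<in> strip 1 \<Longrightarrow> h z = f z + g z"
  shows "primitive h w = primitive f w + primitive g w"
proof -
  have "indicator {0..} x *\<^sub>R h (w - of_real x) = indicator {0..} x *\<^sub>R f (w - of_real x) +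
      indicator {0..} x *\<^sub>R g (w - of_real x)" for x
    using h[OF strip_diff_nonneg[OF assms(3)], of x] by (cases "0 \<le> x") (auto simp: scaleR_add_right)
  thus ?thesis
    using integrable_primitive_integrand[OF assms(1,3)] integrable_primitive_integrand[OF assms(2,3)]
    by (simp add: primitive_def)
qed

lemma primitive_pow_add:
  assumes "decaying f" "decaying g" "w \<in> strip 1"
  shows "(primitive ^^ n) (\<lambda>w. f w + g w) w = (primitive ^^ n) f w + (primitive ^^ n) g w"
  using assms(3)
proof (induction n arbitrary: w)
  case (Suc n)
  thus ?case
    using primitive_add[OF decaying_primitive_pow[OF assms(1)] decaying_primitive_pow[OF assms(2)], of w] by simp
qed simp

lemma primitive_cmult: "primitive (\<lambda>w. c * f w) = (\<lambda>w. c * primitive f w)"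
  by (simp add: primitive_def fun_eq_iff flip: integral_mult_right_zero)

lemma primitive_pow_cmult: "(primitive ^^ n) (\<lambda>w. c * f w) = (\<lambda>w. c * (primitive ^^ n) f w)"
  by (induction n) (simp_all add: primitive_cmult)

text \<open>By the reflection formula this is 1 / ((e^(2 \<pi> i s) - 1) \<Gamma>(s)) at
  non-integers, in a form whose only poles are visibly s = 1, 2, 3, ... and whose value at 0 is 1 /
  (2 \<pi> i).\<close>

definition hankel_coeff :: "complex \<Rightarrow> complex" where
  "hankel_coeff s = exp (- \<i> * of_real pi * s) * Gamma (1 - s) / (2 * of_real pi * \<i>)"

definition J_hankel :: "real \<Rightarrow> nat \<Rightarrow> complex \<Rightarrow> (complex \<Rightarrow> complex) \<Rightarrow> complex \<Rightarrow> complex" where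
  "J_hankel eps n s f w =
     hankel_coeff (s - of_nat n) * hankel_op eps (s - of_nat n) ((primitive ^^ n) f) w"

text \<open>The operator \<open>J\<^sup>s\<close> in the variable \<open>w = log t\<close>: integrating \<open>n > Re s - 1\<close> times first keeps
  the exponent \<open>s - n\<close> away from the poles \<open>1, 2, \<dots>\<close> of the coefficient.\<close>

definition J_cpow :: "complex \<Rightarrow> (complex \<Rightarrow> complex) \<Rightarrow> complex \<Rightarrow> complex" where
  "J_cpow s f w = J_hankel ((1 - max (Re w) \<bar>Im w\<bar>) / 2) (nat \<lceil>Re s\<rceil>) s f w"

section \<open>Powers of J: independence of choices, derivatives and bounds\<close>

lemma hankel_coeff_minus_one:
  assumes "1 - s \<notin> \<int>\<^sub>\<le>\<^sub>0"
  shows "hankel_coeff (s - 1) = (s - 1) * hankel_coeff s"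
proof -
  have 1: "Gamma (1 - (s - 1)) = (1 - s) * Gamma (1 - s)"
    using Gamma_plus1[OF assms] by (simp add: algebra_simps)
  have 2: "exp (- \<i> * of_real pi * (s - 1)) = - exp (- \<i> * of_real pi * s)"
  proof -
    have e: "- \<i> * of_real pi * (s - 1) = - \<i> * of_real pi * s + of_real pi * \<i>"
      by (simp add: algebra_simps)
    show ?thesis unfolding e exp_add by simp
  qed
  show ?thesis unfolding hankel_coeff_def 1 2 by (simp add: algebra_simps diff_divide_distrib)
qed

text \<open>The factor s - n - 1 produced by integration by parts is exactly the one by which the
  coefficient changes, owing to \<Gamma>(z + 1) = z \<Gamma>(z). The hypothesis on s keeps away from
  the poles, where this recursion breaks down.\<close>

lemma J_hankel_Suc:
  assumes f: "decaying f" and eps: "0 < eps" "w \<in> strip (1 - eps)"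
    and s: "1 - (s - of_nat n) \<notin> \<int>\<^sub>\<le>\<^sub>0"
  shows "J_hankel eps (Suc n) s f w = J_hankel eps n s f w"
proof -
  let ?g = "(primitive ^^ n) f"
  have g: "decaying ?g" by (rule decaying_primitive_pow[OF f])
  have "hankel_op eps (s - of_nat n) ?g w =
      (s - of_nat n - 1) * hankel_op eps (s - of_nat n - 1) (primitive ?g) w"
    by (rule hankel_op_by_parts[OF eps(1) decaying_primitive[OF g] g eps(2) has_field_derivative_primitive[OF g]])
  moreover have e: "s - of_nat (Suc n) = s - of_nat n - 1" by simp
  ultimately show ?thesis
    unfolding J_hankel_def funpow.simps o_apply e using hankel_coeff_minus_one[OF s] by simp
qed

lemma J_hankel_indep:
  assumes f: "decaying f" and eps: "0 < eps" "w \<in> strip (1 - eps)"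
    and s: "1 - (s - of_nat m) \<notin> \<int>\<^sub>\<le>\<^sub>0" and mn: "m \<le> n"
  shows "J_hankel eps n s f w = J_hankel eps m s f w"
  using mn
proof (induction n rule: dec_induct)
  case (step n)
  have "1 - (s - of_nat (m + k)) \<notin> \<int>\<^sub>\<le>\<^sub>0" for k
  proof (induction k)
    case (Suc k)
    thus ?case using plus_one_in_nonpos_Ints_imp[of "1 - (s - of_nat (m + k))"]
      by (auto simp: algebra_simps)
  qed (use s in simp)
  from this[of "n - m"] show ?case using step J_hankel_Suc[OF f eps, of s n] by simp
qed simp

lemma not_nonpos_Ints_Re: "Re z > 0 \<Longrightarrow> z \<notin> \<int>\<^sub>\<le>\<^sub>0"
  by (auto elim!: nonpos_Ints_cases)

text \<open>\<open>J_cpow\<close> uses a radius that depends on w and a number of integrations that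
  depends on s. Differentiating in w or s requires both to be frozen in a neighbourhood, which this
  permits.\<close>

lemma J_cpow_eq:
  assumes f: "decaying f" and eps: "0 < eps" "w \<in> strip (1 - eps)"
    and s: "1 - (s - of_nat n) \<notin> \<int>\<^sub>\<le>\<^sub>0"
  shows "J_cpow s f w = J_hankel eps n s f w"
proof -
  define e where "e = (1 - max (Re w) \<bar>Im w\<bar>) / 2"
  define N where "N = nat \<lceil>Re s\<rceil>"
  have e: "0 < e" "w \<in> strip (1 - e)" using eps by (auto simp: e_def strip_def max_def field_simps)
  have "Re (1 - (s - of_nat N)) > 0" unfolding N_def by (simp, linarith)
  hence N: "1 - (s - of_nat N) \<notin> \<int>\<^sub>\<le>\<^sub>0" by (rule not_nonpos_Ints_Re)
  have "J_cpow s f w = J_hankel e N s f w" by (simp add: J_cpow_def e_def N_def)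
  also have "\<dots> = J_hankel eps N s f w"
    unfolding J_hankel_def using hankel_op_radius_indep[OF decaying_primitive_pow[OF f] e(1) eps(1) e(2) eps(2)]
    by simp
  also have "\<dots> = J_hankel eps (max n N) s f w" by (rule J_hankel_indep[OF f eps N, symmetric]) simp
  also have "\<dots> = J_hankel eps n s f w" by (rule J_hankel_indep[OF f eps s]) simp
  finally show ?thesis .
qed

text \<open>With one integration to spare, d/dw removes a primitive and leaves the exponent s - (N +
  1) = (s - 1) - N and its coefficient alone; the result is the same formula for the power s -
  1.\<close>

lemma has_field_derivative_J_cpow:
  assumes f: "decaying f" and w: "w \<in> strip 1"
  shows "(J_cpow s f has_field_derivative J_cpow (s - 1) f w) (at w)"
proof -
  obtain e where e: "0 < e" "w \<in> strip (1 - e)" using strip_radius[OF w] by blast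
  define N where "N = nat \<lceil>Re s\<rceil>"
  have "Re (1 - (s - of_nat (Suc N))) > 0" unfolding N_def by (simp, linarith)
  hence N: "1 - (s - of_nat (Suc N)) \<notin> \<int>\<^sub>\<le>\<^sub>0" by (rule not_nonpos_Ints_Re)
  have g: "decaying ((primitive ^^ N) f)" by (rule decaying_primitive_pow[OF f])
  have "(J_hankel e (Suc N) s f has_field_derivative J_hankel e N (s - 1) f w) (at w)"
  proof -
    have "(hankel_op e (s - of_nat (Suc N)) (primitive ((primitive ^^ N) f)) has_field_derivative
        hankel_op e (s - of_nat (Suc N)) ((primitive ^^ N) f) w) (at w)"
      by (rule has_field_derivative_hankel_op[OF e(1) decaying_primitive[OF g] e(2) has_field_derivative_primitive[OF g]])
    from DERIV_cmult[OF this, of "hankel_coeff (s - of_nat (Suc N))"]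
    show ?thesis unfolding J_hankel_def[abs_def] by (simp add: diff_diff_add)
  qed
  moreover have "J_hankel e N (s - 1) f w = J_cpow (s - 1) f w"
    by (rule J_cpow_eq[OF f e, symmetric]) (use N in \<open>simp add: algebra_simps\<close>)
  ultimately have "(J_hankel e (Suc N) s f has_field_derivative J_cpow (s - 1) f w) (at w)" by simp
  thus ?thesis
    by (rule has_field_derivative_transform_within_open[OF _ open_strip e(2)])
       (rule J_cpow_eq[OF f e(1) _ N, symmetric])
qed

lemma J_cpow_0: "decaying f \<Longrightarrow> w \<in> strip 1 \<Longrightarrow> J_cpow 0 f w = f w"
proof -
  assume f: "decaying f" and w: "w \<in> strip 1"
  obtain e where e: "0 < e" "w \<in> strip (1 - e)" using strip_radius[OF w] by blast
  have "J_cpow 0 f w = J_hankel e 0 0 f w" by (rule J_cpow_eq[OF f e]) auto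
  also have "\<dots> = f w" unfolding J_hankel_def using hankel_op_zero[OF e(1) f e(2)]
    by (simp add: hankel_coeff_def)
  finally show ?thesis .
qed

lemma J_cpow_add:
  assumes f: "decaying f" and g: "decaying g" and w: "w \<in> strip 1"
  shows "J_cpow s (\<lambda>w. f w + g w) w = J_cpow s f w + J_cpow s g w"
proof -
  obtain e where e: "0 < e" "w \<in> strip (1 - e)" using strip_radius[OF w] by blast
  define N where "N = nat \<lceil>Re s\<rceil>"
  have "Re (1 - (s - of_nat N)) > 0" unfolding N_def by (simp, linarith)
  hence N: "1 - (s - of_nat N) \<notin> \<int>\<^sub>\<le>\<^sub>0" by (rule not_nonpos_Ints_Re)
  have "hankel_op e (s - of_nat N) ((primitive ^^ N) (\<lambda>w. f w + g w)) w =
      hankel_op e (s - of_nat N) (\<lambda>w. (primitive ^^ N) f w + (primitive ^^ N) g w) w"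
    by (rule hankel_op_cong[OF e primitive_pow_add[OF f g]])
  also have "\<dots> = hankel_op e (s - of_nat N) ((primitive ^^ N) f) w +
      hankel_op e (s - of_nat N) ((primitive ^^ N) g) w"
    by (rule hankel_op_add[OF e(1) decaying_primitive_pow[OF f] decaying_primitive_pow[OF g] e(2)])
  finally show ?thesis
    unfolding J_cpow_eq[OF f e N] J_cpow_eq[OF g e N] J_cpow_eq[OF decaying_add[OF f g] e N]
    by (simp add: J_hankel_def distrib_left)
qed

lemma J_cpow_cmult: "J_cpow s (\<lambda>w. c * f w) w = c * J_cpow s f w"
  unfolding J_cpow_def J_hankel_def primitive_pow_cmult
  by (simp add: hankel_op_cmult)

lemma J_cpow_nonint:
  assumes f: "decaying f" and eps: "0 < eps" "w \<in> strip (1 - eps)" and s: "s \<notin> \<int>"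
  shows "hankel_op eps s f w = (exp (2 * of_real pi * \<i> * s) - 1) * Gamma s * J_cpow s f w"
proof -
  have "1 - (s - of_nat 0) \<notin> \<int>\<^sub>\<le>\<^sub>0"
    using s by (metis Ints_1 Ints_diff diff_zero nonpos_Ints_Int of_nat_0 diff_diff_eq2 add_diff_cancel_left' Ints_minus minus_diff_eq)
  hence J: "J_cpow s f w = hankel_coeff s * hankel_op eps s f w"
    using J_cpow_eq[OF f eps, of s 0] by (simp add: J_hankel_def)
  have sin: "sin (of_real pi * s) \<noteq> 0"
    using s by (auto simp: sin_eq_0)
  have e: "exp (2 * of_real pi * \<i> * s) - 1 = 2 * \<i> * exp (\<i> * of_real pi * s) * sin (of_real pi * s)"
    by (simp add: sin_exp_eq field_simps flip: exp_add)
  have "(exp (2 * of_real pi * \<i> * s) - 1) * Gamma s * hankel_coeff s =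
      2 * \<i> * sin (of_real pi * s) * (exp (\<i> * of_real pi * s) * exp (- \<i> * of_real pi * s)) *
      (Gamma s * Gamma (1 - s)) / (2 * of_real pi * \<i>)"
    unfolding e hankel_coeff_def by simp
  also have "\<dots> = 1" using sin unfolding Gamma_reflection_complex
    by (simp flip: exp_add)
  finally show ?thesis by (simp add: J mult.assoc[symmetric])
qed

text \<open>\<open>C\<close> is uniform over f as well as s, since in \<open>iter_J_frechet\<close>
  the operator acts on a remainder that itself depends on the exponents. The gap between \<delta>
  and \<delta>' provides a fixed contour radius.\<close>

lemma J_cpow_bound:
  assumes "\<delta> < \<delta>'" "\<delta>' < 1"
  shows "\<exists>C\<ge>0. \<forall>f K s. decaying f \<longrightarrow> dec_bound \<delta>' K f \<longrightarrow> norm s \<le> R \<longrightarrow> dec_bound \<delta> (C * K) (J_cpow s f)"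
proof -
  define e where "e = \<delta>' - \<delta>"
  have e: "0 < e" "\<delta> + e = \<delta>'" using assms by (auto simp: e_def)
  \<comment> \<open>One number of integrations for all |s| \<le> R: it gives Re (s - N) \<le> 0,
    away from the poles at 1, 2, ..., so the coefficient is bounded on the closed ball by
    compactness.\<close>
  define N where "N = nat \<lceil>R\<rceil>"
  obtain C where C: "0 \<le> C" "\<And>f K (s::complex) \<delta> w. decaying f \<Longrightarrow> \<delta> + e < 1 \<Longrightarrow> dec_bound (\<delta> + e) K f \<Longrightarrow>
    norm (s - 1) \<le> \<bar>R\<bar> + real N + 1 \<Longrightarrow> w \<in> strip \<delta> \<Longrightarrow> norm (hankel_op e s f w) \<le> C * K * exp (Re w / 2)"
    using norm_hankel_op_le[OF e(1), of "\<bar>R\<bar> + real N + 1"] by metis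
  have pos: "Re (1 - (s - of_nat N)) > 0" if "norm s \<le> R" for s :: complex
    using that complex_Re_le_cmod[of s] unfolding N_def by (simp, linarith)
  have "(\<lambda>s. hankel_coeff (s - of_nat N)) holomorphic_on cball 0 R"
    unfolding hankel_coeff_def using not_nonpos_Ints_Re[OF pos]
    by (intro holomorphic_intros) auto
  hence "continuous_on (cball 0 R) (\<lambda>s. hankel_coeff (s - of_nat N))"
    by (rule holomorphic_on_imp_continuous_on)
  hence "bounded ((\<lambda>s. hankel_coeff (s - of_nat N)) ` cball 0 R)"
    by (intro compact_imp_bounded compact_continuous_image) auto
  then obtain B where "\<forall>s\<in>cball 0 R. norm (hankel_coeff (s - of_nat N)) \<le> B"
    unfolding bounded_iff by auto
  hence B: "norm (hankel_coeff (s - of_nat N)) \<le> B" if "norm s \<le> R" for s :: complex using that by simp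
  show ?thesis
  proof (intro exI[of _ "\<bar>B\<bar> * (C * exp_mass ^ N)"] conjI allI impI)
    show "0 \<le> \<bar>B\<bar> * (C * exp_mass ^ N)" using C(1) exp_mass_nonneg by simp
    fix f K and s :: complex assume *: "decaying f" "dec_bound \<delta>' K f" "norm s \<le> R"
    show "dec_bound \<delta> (\<bar>B\<bar> * (C * exp_mass ^ N) * K) (J_cpow s f)" unfolding dec_bound_def
    proof (intro conjI ballI)
      show "0 \<le> \<bar>B\<bar> * (C * exp_mass ^ N) * K" using C(1) exp_mass_nonneg dec_bound_nonneg[OF *(2)] by simp
      fix w assume w\<delta>: "w \<in> strip \<delta>"
      have w: "w \<in> strip (1 - e)" using w\<delta> strip_mono[of \<delta> "1 - e"] assms by (auto simp: e_def)
      have "norm (s - of_nat N - 1) \<le> norm s + norm (of_nat N :: complex) + 1"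
        using norm_triangle_ineq4[of "s - of_nat N" 1] norm_triangle_ineq4[of s "of_nat N"] by simp
      hence "norm (hankel_op e (s - of_nat N) ((primitive ^^ N) f) w) \<le> C * (exp_mass ^ N * K) * exp (Re w / 2)"
        using * w\<delta> e assms by (intro C(2)[of _ \<delta>] decaying_primitive_pow dec_bound_primitive_pow) auto
      moreover have "norm (hankel_coeff (s - of_nat N)) \<le> \<bar>B\<bar>" using B[OF *(3)] by simp
      ultimately have "norm (J_hankel e N s f w) \<le> \<bar>B\<bar> * (C * (exp_mass ^ N * K) * exp (Re w / 2))"
        unfolding J_hankel_def norm_mult by (intro mult_mono) auto
      thus "norm (J_cpow s f w) \<le> \<bar>B\<bar> * (C * exp_mass ^ N) * K * exp (Re w / 2)"
        using J_cpow_eq[OF *(1) e(1) w not_nonpos_Ints_Re[OF pos[OF *(3)]]] by (simp add: mult_ac)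
    qed
  qed
qed

lemma holomorphic_J_cpow:
  assumes "decaying f" shows "J_cpow s f holomorphic_on strip 1"
  by (rule holomorphic_onI)
     (meson assms has_field_derivative_J_cpow field_differentiable_at_within field_differentiable_def)

lemma decaying_J_cpow:
  assumes "decaying f" shows "decaying (J_cpow s f)"
  unfolding decaying_def
proof (intro conjI allI impI holomorphic_J_cpow[OF assms])
  fix \<delta> :: real assume \<delta>: "\<delta> < 1"
  define \<delta>' where "\<delta>' = (\<delta> + 1) / 2"
  have \<delta>': "\<delta> < \<delta>'" "\<delta>' < 1" using \<delta> by (auto simp: \<delta>'_def)
  obtain K where K: "dec_bound \<delta>' K f" using decaying_bound[OF assms \<delta>'(2)] by blast
  from J_cpow_bound[OF \<delta>', of "norm s"] assms K
  show "\<exists>K. dec_bound \<delta> K (J_cpow s f)" by blast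
qed

lemma holomorphic_J_cpow_exponent:
  assumes f: "decaying f" and w: "w \<in> strip 1"
  shows "(\<lambda>s. J_cpow s f w) holomorphic_on A"
proof -
  obtain e where e: "0 < e" "w \<in> strip (1 - e)" using strip_radius[OF w] by blast
  have "(\<lambda>s. J_cpow s f w) field_differentiable (at s0)" for s0
  proof -
    \<comment> \<open>The extra 1 makes a single formula valid on the whole unit ball around
      \<open>s0\<close>.\<close>
    define N where "N = nat \<lceil>Re s0 + 1\<rceil>"
    have pos: "1 - (s - of_nat N) \<notin> \<int>\<^sub>\<le>\<^sub>0" if "s \<in> ball s0 1" for s
    proof (rule not_nonpos_Ints_Re)
      have "norm (s0 - s) < 1" using that by (simp add: dist_norm)
      thus "Re (1 - (s - of_nat N)) > 0"
        using abs_Re_le_cmod[of "s0 - s"] unfolding N_def by (simp, linarith)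
    qed
    have "(\<lambda>s. J_hankel e N s f w) holomorphic_on ball s0 1"
    proof -
      have "(\<lambda>s. hankel_coeff (s - of_nat N)) holomorphic_on ball s0 1"
        unfolding hankel_coeff_def using pos by (intro holomorphic_intros) auto
      moreover have "(\<lambda>s. hankel_op e (s - of_nat N) ((primitive ^^ N) f) w) holomorphic_on ball s0 1"
        by (rule holomorphic_on_compose[where g = "\<lambda>s. hankel_op e s ((primitive ^^ N) f) w"
              and f = "\<lambda>s. s - of_nat N", unfolded o_def])
           (auto intro!: holomorphic_intros holomorphic_hankel_op_exponent[OF e(1) decaying_primitive_pow[OF f] e(2)])
      ultimately show ?thesis unfolding J_hankel_def by (rule holomorphic_on_mult)
    qed
    hence "(\<lambda>s. J_cpow s f w) holomorphic_on ball s0 1"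
      by (rule holomorphic_transform) (rule J_cpow_eq[OF f e pos, symmetric])
    thus ?thesis by (rule holomorphic_on_imp_differentiable_at) auto
  qed
  thus ?thesis by (meson field_differentiable_at_within holomorphic_onI)
qed

text \<open>Cauchy's estimates in \<open>s\<close> turn the locally uniform bounds into a Taylor expansion that is uniform
  in \<open>w\<close>.\<close>

lemma J_cpow_expansion:
  assumes f: "decaying f"
  obtains L where "decaying L"
    "\<And>\<delta>. \<delta> < 1 \<Longrightarrow> \<exists>C\<ge>0. \<forall>\<eta> w. norm \<eta> < 1 \<longrightarrow> w \<in> strip \<delta> \<longrightarrow>
       norm (J_cpow (a + \<eta>) f w - J_cpow a f w - \<eta> * L w) \<le> C * (norm \<eta>)\<^sup>2 * exp (Re w / 2)"
proof -
  define L where "L = (\<lambda>w. deriv (\<lambda>s. J_cpow s f w) a)"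
  have both: "\<exists>C\<ge>0. \<forall>w\<in>strip \<delta>. norm (L w) \<le> C * exp (Re w / 2) \<and> (\<forall>\<eta>. norm \<eta> < 1 \<longrightarrow>
       norm (J_cpow (a + \<eta>) f w - J_cpow a f w - \<eta> * L w) \<le> 2 * C * (norm \<eta>)\<^sup>2 * exp (Re w / 2))"
    if \<delta>: "\<delta> < 1" for \<delta>
  proof -
    define \<delta>' where "\<delta>' = (\<delta> + 1) / 2"
    have \<delta>': "\<delta> < \<delta>'" "\<delta>' < 1" using \<delta> by (auto simp: \<delta>'_def)
    obtain K where K: "dec_bound \<delta>' K f" using decaying_bound[OF f \<delta>'(2)] by blast
    obtain C where C: "0 \<le> C" "\<And>f K s. decaying f \<Longrightarrow> dec_bound \<delta>' K f \<Longrightarrow> norm s \<le> norm a + 2 \<Longrightarrow> dec_bound \<delta> (C * K) (J_cpow s f)"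
      using J_cpow_bound[OF \<delta>'] by blast
    have CK: "0 \<le> C * K" using C(1) dec_bound_nonneg[OF K] by simp
    show ?thesis
    proof (intro exI[of _ "C * K"] conjI ballI CK)
      fix w assume w: "w \<in> strip \<delta>"
      have w1: "w \<in> strip 1" using w \<delta> strip_mono[of \<delta> 1] by auto
      define \<phi> where "\<phi> = (\<lambda>s. J_cpow s f w)"
      define B where "B = C * K * exp (Re w / 2)"
      have hol: "\<phi> holomorphic_on A" for A unfolding \<phi>_def by (rule holomorphic_J_cpow_exponent[OF f w1])
      have est: "norm ((deriv ^^ n) \<phi> z) \<le> fact n * B / 1 ^ n" if z: "z \<in> ball a 1" for n z
      proof (rule Cauchy_inequality)
        show "continuous_on (cball z 1) \<phi>" using hol holomorphic_on_imp_continuous_on by blast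
        fix x assume "norm (z - x) = 1"
        hence "norm x \<le> norm a + 2"
          using z norm_triangle_ineq4[of z "z - x"] norm_triangle_ineq4[of a "a - z"]
          by (simp add: dist_norm)
        thus "norm (\<phi> x) \<le> B" unfolding \<phi>_def B_def using C(2)[OF f K] dec_boundD[OF _ w] by blast
      qed (use hol in auto)
      show "norm (L w) \<le> C * K * exp (Re w / 2)"
        using est[of a 1] by (simp add: L_def \<phi>_def B_def)
      show "\<forall>\<eta>. norm \<eta> < 1 \<longrightarrow>
         norm (J_cpow (a + \<eta>) f w - J_cpow a f w - \<eta> * L w) \<le> 2 * (C * K) * (norm \<eta>)\<^sup>2 * exp (Re w / 2)"
      proof (intro allI impI)
        fix \<eta> :: complex assume \<eta>: "norm \<eta> < 1"
        have "norm ((deriv ^^ 0) \<phi> (a + \<eta>) - (\<Sum>i\<le>1. (deriv ^^ i) \<phi> a * ((a + \<eta>) - a) ^ i / fact i)) \<le>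
            (fact 2 * B) * norm ((a + \<eta>) - a) ^ Suc 1 / fact 1"
        proof (rule complex_Taylor[of "ball a 1"])
          show "((deriv ^^ i) \<phi> has_field_derivative (deriv ^^ Suc i) \<phi> x) (at x within ball a 1)" for i x
          proof -
            have "(deriv ^^ i) \<phi> holomorphic_on UNIV" by (rule holomorphic_higher_deriv[OF hol]) auto
            from holomorphic_derivI[OF this open_UNIV UNIV_I] show ?thesis
              by (simp add: has_field_derivative_at_within)
          qed
          show "norm ((deriv ^^ Suc 1) \<phi> x) \<le> fact 2 * B" if "x \<in> ball a 1" for x
            using est[OF that, of 2] by (simp add: numeral_2_eq_2)
        qed (use \<eta> in \<open>auto simp: dist_norm\<close>)
        also have "(deriv ^^ 0) \<phi> (a + \<eta>) - (\<Sum>i\<le>1. (deriv ^^ i) \<phi> a * ((a + \<eta>) - a) ^ i / fact i) =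
            J_cpow (a + \<eta>) f w - J_cpow a f w - \<eta> * L w"
          by (simp add: \<phi>_def L_def)
        also have "(fact 2 * B) * norm ((a + \<eta>) - a) ^ Suc 1 / fact 1 =
            2 * (C * K) * (norm \<eta>)\<^sup>2 * exp (Re w / 2)"
          by (simp add: B_def power2_eq_square)
        finally show "norm (J_cpow (a + \<eta>) f w - J_cpow a f w - \<eta> * L w) \<le>
            2 * (C * K) * (norm \<eta>)\<^sup>2 * exp (Re w / 2)" .
      qed
    qed
  qed
  have bnd: "\<exists>C. dec_bound \<delta> C L" if d: "\<delta> < 1" for \<delta>
  proof -
    obtain C where "0 \<le> C" "\<forall>w\<in>strip \<delta>. norm (L w) \<le> C * exp (Re w / 2)"
      using both[OF d] by blast
    thus ?thesis unfolding dec_bound_def by blast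
  qed
  \<comment> \<open>\<open>L\<close> is a derivative in s; its holomorphy in w is obtained from that
    of the difference quotients, of which it is a locally uniform limit.\<close>
  have "L field_differentiable (at w)" if w: "w \<in> strip 1" for w
  proof -
    obtain \<delta> where \<delta>: "\<delta> < 1" "w \<in> strip \<delta>" using strip_shrink[OF w] by blast
    obtain r where r: "r > 0" "cball w r \<subseteq> strip \<delta>" using open_contains_cball open_strip \<delta>(2) by blast
    obtain C where C: "0 \<le> C" "\<And>w \<eta>. w \<in> strip \<delta> \<Longrightarrow> norm \<eta> < 1 \<Longrightarrow>
       norm (J_cpow (a + \<eta>) f w - J_cpow a f w - \<eta> * L w) \<le> 2 * C * (norm \<eta>)\<^sup>2 * exp (Re w / 2)"
      using both[OF \<delta>(1)] by blast
    \<comment> \<open>n + 2 keeps the increments strictly below 1, the range in which the expansion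
      holds.\<close>
    define y where "y = (\<lambda>n::nat. 1 / real (n + 2))"
    have y: "y \<longlonglongrightarrow> 0" "0 < y n" "y n < 1" for n
      using LIMSEQ_ignore_initial_segment[OF lim_const_over_n[of 1], of 2] by (auto simp: y_def)
    define g where "g = (\<lambda>n z. (J_cpow (a + of_real (y n)) f z - J_cpow a f z) / of_real (y n))"
    have "uniform_limit (cball w r) g L sequentially"
    proof (rule uniform_limitI)
      fix e :: real assume "e > 0"
      have "(\<lambda>n. 2 * C * exp (\<delta> / 2) * y n) \<longlonglongrightarrow> 0"
        using tendsto_mult[OF tendsto_const y(1), of "2 * C * exp (\<delta> / 2)"] by simp
      hence "\<forall>\<^sub>F n in sequentially. 2 * C * exp (\<delta> / 2) * y n < e"
        using \<open>e > 0\<close> by (rule order_tendstoD)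
      thus "\<forall>\<^sub>F n in sequentially. \<forall>x\<in>cball w r. dist (g n x) (L x) < e"
      proof eventually_elim
        case (elim n)
        show ?case
        proof
          fix x assume "x \<in> cball w r"
          hence x: "x \<in> strip \<delta>" using r by blast
          have "g n x - L x = (J_cpow (a + of_real (y n)) f x - J_cpow a f x - of_real (y n) * L x) / of_real (y n)"
            using y(2)[of n] by (simp add: g_def field_simps)
          hence "norm (g n x - L x) = norm (J_cpow (a + of_real (y n)) f x - J_cpow a f x - of_real (y n) * L x) / y n"
            using y(2)[of n] by (simp add: norm_divide)
          also have "\<dots> \<le> 2 * C * (y n)\<^sup>2 * exp (Re x / 2) / y n"
            using C(2)[OF x, of "of_real (y n)"] y(2,3)[of n] by (intro divide_right_mono) auto
          also have "\<dots> = 2 * C * exp (Re x / 2) * y n"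
            using y(2)[of n] by (simp add: power2_eq_square)
          also have "\<dots> \<le> 2 * C * exp (\<delta> / 2) * y n"
            using x C(1) y(2)[of n] by (intro mult_right_mono mult_left_mono) (auto simp: strip_def)
          also have "\<dots> < e" by (rule elim)
          finally show "dist (g n x) (L x) < e" by (simp add: dist_norm)
        qed
      qed
    qed
    moreover have "g n holomorphic_on strip 1" for n
      unfolding g_def using y(2)[of n] by (intro holomorphic_intros holomorphic_J_cpow[OF f]) auto
    hence "g n holomorphic_on cball w r" for n
      by (rule holomorphic_on_subset) (use r strip_mono[of \<delta> 1] \<delta> in auto)
    hence "\<forall>\<^sub>F n in sequentially. continuous_on (cball w r) (g n) \<and> g n holomorphic_on ball w r"
      by (intro always_eventually allI conjI holomorphic_on_imp_continuous_on)
         (auto intro: holomorphic_on_subset[OF _ ball_subset_cball])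
    ultimately have "L holomorphic_on ball w r"
      using holomorphic_uniform_limit[of w r g sequentially L] by auto
    thus ?thesis using r(1) by (intro holomorphic_on_imp_differentiable_at[of L "ball w r"]) auto
  qed
  hence "L holomorphic_on strip 1" 
    unfolding holomorphic_on_def by (blast intro: field_differentiable_at_within)
  hence "decaying L" using bnd by (simp add: decaying_def)
  moreover have "\<exists>C\<ge>0. \<forall>\<eta> w. norm \<eta> < 1 \<longrightarrow> w \<in> strip \<delta> \<longrightarrow>
       norm (J_cpow (a + \<eta>) f w - J_cpow a f w - \<eta> * L w) \<le> C * (norm \<eta>)\<^sup>2 * exp (Re w / 2)"
    if d: "\<delta> < 1" for \<delta>
  proof -
    obtain C where C: "0 \<le> C" "\<And>w \<eta>. w \<in> strip \<delta> \<Longrightarrow> norm \<eta> < 1 \<Longrightarrow>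
       norm (J_cpow (a + \<eta>) f w - J_cpow a f w - \<eta> * L w) \<le> 2 * C * (norm \<eta>)\<^sup>2 * exp (Re w / 2)"
      using both[OF d] by blast
    thus ?thesis by (intro exI[of _ "2 * C"]) auto
  qed
  ultimately show thesis by (rule that)
qed

section \<open>Iterated operators and holomorphy in the exponents\<close>

primrec iter_J :: "(complex \<Rightarrow> complex) \<Rightarrow> nat \<Rightarrow> (nat \<Rightarrow> complex) \<Rightarrow> complex \<Rightarrow> complex" where
  "iter_J q 0 s = (\<lambda>w. 1)"
| "iter_J q (Suc r) s = J_cpow (s (Suc r)) (\<lambda>w. q w * iter_J q r s w)"

text \<open>The innermost function of the iteration is the constant 1, which does not decay.
  Boundedness is what all levels share, and multiplication by the decaying q restores decay.\<close>

definition strip_bounded :: "(complex \<Rightarrow> complex) \<Rightarrow> bool" where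
  "strip_bounded f \<longleftrightarrow> f holomorphic_on strip 1 \<and> (\<forall>\<delta><1. \<exists>K. \<forall>w\<in>strip \<delta>. norm (f w) \<le> K)"

lemma exp_half_le_2:
  assumes "x < (1::real)" shows "exp (x / 2) \<le> 2"
proof -
  have "exp (1 / 2 :: real) ^ 2 = exp 1" by (simp add: power2_eq_square flip: exp_add)
  also have "\<dots> \<le> 2 ^ 2" using exp_le by simp
  finally have "exp (1 / 2 :: real) \<le> 2" by (rule power2_le_imp_le) simp
  moreover have "exp (x / 2) \<le> exp (1 / 2)" using assms by simp
  ultimately show ?thesis by linarith
qed

lemma exp_half_le_2_strip: "w \<in> strip \<delta> \<Longrightarrow> \<delta> \<le> 1 \<Longrightarrow> exp (Re w / 2) \<le> 2"
  by (rule exp_half_le_2) (auto simp: strip_def)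

lemma decaying_imp_strip_bounded:
  assumes "decaying f" shows "strip_bounded f"
  unfolding strip_bounded_def
proof (intro conjI allI impI decaying_holomorphic[OF assms])
  fix \<delta> :: real assume \<delta>: "\<delta> < 1"
  obtain K where K: "dec_bound \<delta> K f" using decaying_bound[OF assms \<delta>] by blast
  have "norm (f w) \<le> K * 2" if "w \<in> strip \<delta>" for w
    using dec_boundD[OF K that] exp_half_le_2_strip[OF that] \<delta> dec_bound_nonneg[OF K]
    by (meson less_imp_le mult_left_mono order_trans)
  thus "\<exists>K. \<forall>w\<in>strip \<delta>. norm (f w) \<le> K" by blast
qed

lemma dec_bound_mult:
  assumes "dec_bound \<delta> K q" "\<And>w. w \<in> strip \<delta> \<Longrightarrow> norm (f w) \<le> B" "0 \<le> B"
  shows "dec_bound \<delta> (K * B) (\<lambda>w. q w * f w)"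
  unfolding dec_bound_def
proof (intro conjI ballI)
  show "0 \<le> K * B" using assms dec_bound_nonneg by simp
  fix w assume w: "w \<in> strip \<delta>"
  have "norm (q w * f w) \<le> (K * exp (Re w / 2)) * B"
    unfolding norm_mult using dec_boundD[OF assms(1) w] assms(2)[OF w] dec_bound_nonneg[OF assms(1)]
    by (intro mult_mono) auto
  thus "norm (q w * f w) \<le> K * B * exp (Re w / 2)" by (simp add: mult_ac)
qed

lemma decaying_mult_strip_bounded:
  assumes q: "decaying q" and f: "strip_bounded f"
  shows "decaying (\<lambda>w. q w * f w)"
  unfolding decaying_def
proof (intro conjI allI impI holomorphic_on_mult decaying_holomorphic[OF q])
  show "f holomorphic_on strip 1" using f by (simp add: strip_bounded_def)
  fix \<delta> :: real assume \<delta>: "\<delta> < 1"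
  obtain K where K: "dec_bound \<delta> K q" using decaying_bound[OF q \<delta>] by blast
  obtain B where "\<forall>w\<in>strip \<delta>. norm (f w) \<le> B" using f \<delta> unfolding strip_bounded_def by blast
  hence "dec_bound \<delta> (K * \<bar>B\<bar>) (\<lambda>w. q w * f w)" by (intro dec_bound_mult[OF K]) auto
  thus "\<exists>K. dec_bound \<delta> K (\<lambda>w. q w * f w)" by blast
qed

lemma strip_bounded_iter_J: "decaying q \<Longrightarrow> strip_bounded (iter_J q r s)"
proof (induction r)
  case 0
  show ?case by (auto simp: strip_bounded_def)
next
  case (Suc r)
  thus ?case
    by (auto intro!: decaying_imp_strip_bounded decaying_J_cpow decaying_mult_strip_bounded)
qed

lemma decaying_mult_iter_J: "decaying q \<Longrightarrow> decaying (\<lambda>w. q w * iter_J q r s w)"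
  by (intro decaying_mult_strip_bounded strip_bounded_iter_J)

lemma J_cpow_sum:
  assumes "\<And>k. k \<in> A \<Longrightarrow> decaying (f k)" "w \<in> strip 1"
  shows "J_cpow s (\<lambda>w. \<Sum>k\<in>A. c k * f k w) w = (\<Sum>k\<in>A. c k * J_cpow s (f k) w)"
  using assms(1)
proof (induction A rule: infinite_finite_induct)
  case (insert k A)
  have "J_cpow s (\<lambda>w. c k * f k w + (\<Sum>k\<in>A. c k * f k w)) w =
      J_cpow s (\<lambda>w. c k * f k w) w + J_cpow s (\<lambda>w. \<Sum>k\<in>A. c k * f k w) w"
    using insert by (intro J_cpow_add decaying_cmult decaying_sum assms(2)) auto
  thus ?case using insert by (simp add: J_cpow_cmult)
next
  case empty
  show ?case using J_cpow_cmult[of s 0 "\<lambda>w. 0" w] by simp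
next
  case (infinite A)
  show ?case using J_cpow_cmult[of s 0 "\<lambda>w. 0" w] infinite by simp
qed

lemma J_cpow_lipschitz:
  assumes f: "decaying f" and \<delta>: "\<delta> < 1"
  shows "\<exists>C\<ge>0. \<forall>\<eta> w. norm \<eta> < 1 \<longrightarrow> w \<in> strip \<delta> \<longrightarrow>
    norm (J_cpow (a + \<eta>) f w - J_cpow a f w) \<le> C * norm \<eta>"
proof -
  obtain L where L: "decaying L"
    "\<And>\<delta>. \<delta> < 1 \<Longrightarrow> \<exists>C\<ge>0. \<forall>\<eta> w. norm \<eta> < 1 \<longrightarrow> w \<in> strip \<delta> \<longrightarrow>
       norm (J_cpow (a + \<eta>) f w - J_cpow a f w - \<eta> * L w) \<le> C * (norm \<eta>)\<^sup>2 * exp (Re w / 2)"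
    using J_cpow_expansion[OF f, of a] by metis
  obtain C where C: "C \<ge> 0" "\<And>\<eta> w. norm \<eta> < 1 \<Longrightarrow> w \<in> strip \<delta> \<Longrightarrow>
       norm (J_cpow (a + \<eta>) f w - J_cpow a f w - \<eta> * L w) \<le> C * (norm \<eta>)\<^sup>2 * exp (Re w / 2)"
    using L(2)[OF \<delta>] by blast
  obtain B where B: "\<forall>w\<in>strip \<delta>. norm (L w) \<le> B"
    using decaying_imp_strip_bounded[OF L(1)] \<delta> unfolding strip_bounded_def by blast
  show ?thesis
  proof (intro exI[of _ "C * 2 + \<bar>B\<bar>"] conjI allI impI)
    show "0 \<le> C * 2 + \<bar>B\<bar>" using C by simp
    fix \<eta> w :: complex assume \<eta>: "norm \<eta> < 1" and w: "w \<in> strip \<delta>"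
    have "norm (J_cpow (a + \<eta>) f w - J_cpow a f w) \<le>
        norm (J_cpow (a + \<eta>) f w - J_cpow a f w - \<eta> * L w) + norm (\<eta> * L w)"
      using norm_triangle_ineq[of "J_cpow (a + \<eta>) f w - J_cpow a f w - \<eta> * L w" "\<eta> * L w"] by simp
    also have "norm (\<eta> * L w) \<le> norm \<eta> * \<bar>B\<bar>"
      using B w by (auto simp: norm_mult intro!: mult_left_mono order_trans[OF _ abs_ge_self])
    also have "norm (J_cpow (a + \<eta>) f w - J_cpow a f w - \<eta> * L w) \<le> C * (norm \<eta> * 1) * 2"
    proof (rule order_trans[OF C(2)[OF \<eta> w]], rule mult_mono)
      show "C * (norm \<eta>)\<^sup>2 \<le> C * (norm \<eta> * 1)"
        unfolding power2_eq_square using \<eta> C by (intro mult_left_mono) auto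
      show "exp (Re w / 2) \<le> 2" using exp_half_le_2_strip[OF w] \<delta> by simp
    qed (use C in auto)
    finally show "norm (J_cpow (a + \<eta>) f w - J_cpow a f w) \<le> (C * 2 + \<bar>B\<bar>) * norm \<eta>"
      by (simp add: algebra_simps)
  qed
qed

text \<open>Uniformity in w makes the induction possible: the outer \<open>J_cpow\<close> acts on
  the whole inner function, so the inner error must be small on the wider
  \<open>strip \<delta>'\<close>. The coefficients \<open>L k\<close> are functions of w because the
  outer operators are applied to them too.\<close>

lemma iter_J_frechet:
  assumes q: "decaying q"
  shows "\<exists>L. (\<forall>k\<in>{1..r}. strip_bounded (L k)) \<and>
    (\<forall>\<delta><1. \<forall>e>0. \<exists>d>0. \<forall>z. (\<forall>k\<in>{1..r}. norm (z k - a k) < d) \<longrightarrow> (\<forall>w\<in>strip \<delta>.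
      norm (iter_J q r z w - iter_J q r a w - (\<Sum>k=1..r. L k w * (z k - a k)))
        \<le> e * (\<Sum>k=1..r. norm (z k - a k))))"
proof (induction r)
  case 0
  show ?case by (auto intro!: exI[of _ 1])
next
  case (Suc r)
  then obtain L where L: "\<And>k. k \<in> {1..r} \<Longrightarrow> strip_bounded (L k)"
    and Lest: "\<And>\<delta> e. \<delta> < 1 \<Longrightarrow> e > 0 \<Longrightarrow> \<exists>d>0. \<forall>z. (\<forall>k\<in>{1..r}. norm (z k - a k) < d) \<longrightarrow> (\<forall>w\<in>strip \<delta>.
      norm (iter_J q r z w - iter_J q r a w - (\<Sum>k=1..r. L k w * (z k - a k)))
        \<le> e * (\<Sum>k=1..r. norm (z k - a k)))" by blast
  define b where "b = a (Suc r)"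
  define G where "G = (\<lambda>w. q w * iter_J q r a w)"
  define M where "M = (\<lambda>k w. q w * L k w)"
  have G: "decaying G" unfolding G_def by (rule decaying_mult_iter_J[OF q])
  have M: "decaying (M k)" if "k \<in> {1..r}" for k
    unfolding M_def by (rule decaying_mult_strip_bounded[OF q L[OF that]])
  obtain L0 where L0: "decaying L0"
    and L0est: "\<And>\<delta>. \<delta> < 1 \<Longrightarrow> \<exists>C\<ge>0. \<forall>\<eta> w. norm \<eta> < 1 \<longrightarrow> w \<in> strip \<delta> \<longrightarrow>
       norm (J_cpow (b + \<eta>) G w - J_cpow b G w - \<eta> * L0 w) \<le> C * (norm \<eta>)\<^sup>2 * exp (Re w / 2)"
    using J_cpow_expansion[OF G, of b] by metis
  \<comment> \<open>Product rule: the inner derivatives pass through the outer operator at its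
    unperturbed exponent b, and the new one is the derivative in the exponent at the unperturbed
    inner function.\<close>
  define L' where "L' = (\<lambda>k. if k = Suc r then L0 else J_cpow b (M k))"
  show ?case
  proof (intro exI[of _ L'] conjI allI impI ballI)
    fix k assume "k \<in> {1..Suc r}"
    thus "strip_bounded (L' k)"
      using M L0 by (auto simp: L'_def intro!: decaying_imp_strip_bounded decaying_J_cpow)
  next
    fix \<delta> e :: real assume \<delta>: "\<delta> < 1" and e: "e > 0"
    define \<delta>' where "\<delta>' = (\<delta> + 1) / 2"
    have \<delta>': "\<delta> < \<delta>'" "\<delta>' < 1" using \<delta> by (auto simp: \<delta>'_def)
    obtain K where K: "dec_bound \<delta>' K q" using decaying_bound[OF q \<delta>'(2)] by blast
    have K0: "0 \<le> K" by (rule dec_bound_nonneg[OF K])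
    obtain C1 where C1: "0 \<le> C1" "\<And>f K s. decaying f \<Longrightarrow> dec_bound \<delta>' K f \<Longrightarrow> norm s \<le> norm b + 1 \<Longrightarrow> dec_bound \<delta> (C1 * K) (J_cpow s f)"
      using J_cpow_bound[OF \<delta>'] by blast
    have "\<forall>k\<in>{1..r}. \<exists>C\<ge>0. \<forall>\<eta> w. norm \<eta> < 1 \<longrightarrow> w \<in> strip \<delta> \<longrightarrow>
        norm (J_cpow (b + \<eta>) (M k) w - J_cpow b (M k) w) \<le> C * norm \<eta>"
      using J_cpow_lipschitz[OF M \<delta>] by blast
    then obtain c2 where c2: "\<And>k. k \<in> {1..r} \<Longrightarrow> 0 \<le> c2 k" "\<And>k \<eta> w. k \<in> {1..r} \<Longrightarrow> norm \<eta> < 1 \<Longrightarrow> w \<in> strip \<delta> \<Longrightarrow>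
        norm (J_cpow (b + \<eta>) (M k) w - J_cpow b (M k) w) \<le> c2 k * norm \<eta>"
      by (metis (no_types, lifting))
    define C2 where "C2 = (\<Sum>k=1..r. c2 k)"
    have C2: "0 \<le> C2" "\<And>k. k \<in> {1..r} \<Longrightarrow> c2 k \<le> C2"
      unfolding C2_def using c2(1) by (auto intro!: sum_nonneg member_le_sum)
    obtain C3 where C3: "0 \<le> C3" "\<And>\<eta> w. norm \<eta> < 1 \<Longrightarrow> w \<in> strip \<delta> \<Longrightarrow>
       norm (J_cpow (b + \<eta>) G w - J_cpow b G w - \<eta> * L0 w) \<le> C3 * (norm \<eta>)\<^sup>2 * exp (Re w / 2)"
      using L0est[OF \<delta>] by blast
    \<comment> \<open>The inner remainder reaches the outside multiplied by \<open>C1 * K\<close>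
      and by exp (Re w / 2) \<le> 2; this choice keeps it within e / 2. The summand 1 avoids a
      division by zero.\<close>
    define e1 where "e1 = e / (2 * (2 * C1 * K + 1))"
    have e1: "e1 > 0" using e C1(1) K0 by (auto simp: e1_def intro!: divide_pos_pos add_nonneg_pos)
    have e1': "C1 * (K * e1) * 2 \<le> e / 2"
    proof -
      define p where "p = 2 * C1 * K"
      have p: "0 \<le> p" using C1(1) K0 by (simp add: p_def)
      have "C1 * (K * e1) * 2 = p * (e / (2 * (p + 1)))" by (simp add: e1_def p_def)
      also have "\<dots> = (e / 2) * (p / (p + 1))" using p by (simp add: divide_simps)
      also have "\<dots> \<le> (e / 2) * 1" using p e by (intro mult_left_mono) auto
      finally show ?thesis by simp
    qed
    obtain d1 where d1: "d1 > 0" "\<And>z w. (\<forall>k\<in>{1..r}. norm (z k - a k) < d1) \<Longrightarrow> w \<in> strip \<delta>' \<Longrightarrow>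
      norm (iter_J q r z w - iter_J q r a w - (\<Sum>k=1..r. L k w * (z k - a k)))
        \<le> e1 * (\<Sum>k=1..r. norm (z k - a k))" using Lest[OF \<delta>'(2) e1] by blast
    \<comment> \<open>The other e / 2 for the old coordinates pays for moving the exponent in the
      derivative terms (\<open>C2\<close>). The quadratic remainder in the new coordinate
      (\<open>C3\<close>) has a full e, being compared with norm \<eta> alone.\<close>
    define d where "d = min (min d1 1) (min (e / (2 * (C2 + 1))) (e / (2 * (C3 + 1))))"
    have d: "d > 0" "d \<le> d1" "d \<le> 1" "d * C2 \<le> e / 2" "d * C3 * 2 \<le> e"
    proof -
      have p: "e / (2 * (C2 + 1)) > 0" "e / (2 * (C3 + 1)) > 0" using e C2(1) C3(1) by auto
      show "d > 0" "d \<le> d1" "d \<le> 1" using p d1(1) by (auto simp: d_def)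
      have "d \<le> e / (2 * (C2 + 1))" "d \<le> e / (2 * (C3 + 1))" by (auto simp: d_def)
      hence "d * (2 * (C2 + 1)) \<le> e" "d * (2 * (C3 + 1)) \<le> e"
        using C2(1) C3(1) by (auto simp: pos_le_divide_eq)
      thus "d * C2 \<le> e / 2" "d * C3 * 2 \<le> e" using \<open>d > 0\<close> by (auto simp: algebra_simps)
    qed
    show "\<exists>d>0. \<forall>z. (\<forall>k\<in>{1..Suc r}. norm (z k - a k) < d) \<longrightarrow> (\<forall>w\<in>strip \<delta>.
      norm (iter_J q (Suc r) z w - iter_J q (Suc r) a w - (\<Sum>k=1..Suc r. L' k w * (z k - a k)))
        \<le> e * (\<Sum>k=1..Suc r. norm (z k - a k)))"
    proof (intro exI[of _ d] conjI allI impI ballI d(1))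
      fix z w assume z: "\<forall>k\<in>{1..Suc r}. norm (z k - a k) < d" and w: "w \<in> strip \<delta>"
      define \<eta> where "\<eta> = z (Suc r) - b"
      define h where "h = (\<lambda>k. z k - a k)"
      define S where "S = (\<Sum>k=1..r. norm (h k))"
      define D where "D = (\<lambda>w. q w * (iter_J q r z w - iter_J q r a w - (\<Sum>k=1..r. L k w * h k)))"
      have w1: "w \<in> strip 1" using w \<delta> strip_mono[of \<delta> 1] by auto
      have S0: "0 \<le> S" unfolding S_def by (intro sum_nonneg) auto
      have \<eta>: "norm \<eta> < d" "norm \<eta> < 1" using bspec[OF z, of "Suc r"] d(3) by (auto simp: \<eta>_def b_def)
      have zS: "z (Suc r) = b + \<eta>" by (simp add: \<eta>_def)
      have zd: "\<forall>k\<in>{1..r}. norm (z k - a k) < d1"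
      proof
        fix k assume "k \<in> {1..r}"
        thus "norm (z k - a k) < d1" using bspec[OF z, of k] d(2) by auto
      qed
      have Dd: "decaying D"
        unfolding D_def right_diff_distrib sum_distrib_left
        using decaying_cmult[OF M]
        by (intro decaying_diff decaying_mult_iter_J[OF q] decaying_sum) (simp add: M_def mult_ac)
      have "dec_bound \<delta>' (K * (e1 * S)) D"
        unfolding D_def S_def h_def
        using zd e1 by (intro dec_bound_mult[OF K] d1(2)) (auto intro!: mult_nonneg_nonneg sum_nonneg)
      moreover have "norm (z (Suc r)) \<le> norm b + 1"
        unfolding zS using norm_triangle_ineq[of b \<eta>] \<eta> by simp
      ultimately have T1: "norm (J_cpow (z (Suc r)) D w) \<le> C1 * (K * (e1 * S)) * exp (Re w / 2)"
        using C1(2)[OF Dd] dec_boundD[OF _ w] by blast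
      also have "\<dots> \<le> C1 * (K * (e1 * S)) * 2"
        using exp_half_le_2_strip[OF w] \<delta> C1(1) K0 e1 S0 by (intro mult_left_mono) auto
      also have "\<dots> = (C1 * (K * e1) * 2) * S" by simp
      also have "\<dots> \<le> e / 2 * S" using e1' S0 by (rule mult_right_mono)
      finally have T1: "norm (J_cpow (z (Suc r)) D w) \<le> e / 2 * S" .
      have "norm (\<Sum>k=1..r. h k * (J_cpow (b + \<eta>) (M k) w - J_cpow b (M k) w)) \<le>
          (\<Sum>k=1..r. norm (h k) * (C2 * norm \<eta>))"
      proof (rule sum_norm_le)
        fix k assume k: "k \<in> {1..r}"
        have "norm (J_cpow (b + \<eta>) (M k) w - J_cpow b (M k) w) \<le> C2 * norm \<eta>"
          using c2(2)[OF k \<eta>(2) w] mult_right_mono[OF C2(2)[OF k], of "norm \<eta>"] by simp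
        thus "norm (h k * (J_cpow (b + \<eta>) (M k) w - J_cpow b (M k) w)) \<le> norm (h k) * (C2 * norm \<eta>)"
          unfolding norm_mult by (rule mult_left_mono) simp
      qed
      also have "\<dots> = S * (C2 * norm \<eta>)" by (simp add: S_def sum_distrib_right)
      also have "\<dots> \<le> S * (C2 * d)" using \<eta> C2(1) S0 by (intro mult_left_mono) auto
      also have "\<dots> \<le> S * (e / 2)" using d(4) S0 by (intro mult_left_mono) (simp_all add: mult.commute)
      finally have T2: "norm (\<Sum>k=1..r. h k * (J_cpow (b + \<eta>) (M k) w - J_cpow b (M k) w)) \<le> e / 2 * S"
        by (simp add: mult.commute)
      have "norm (J_cpow (b + \<eta>) G w - J_cpow b G w - \<eta> * L0 w) \<le> C3 * (norm \<eta>)\<^sup>2 * exp (Re w / 2)"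
        by (rule C3(2)[OF \<eta>(2) w])
      also have "\<dots> \<le> C3 * (d * norm \<eta>) * 2"
        using \<eta> C3(1) exp_half_le_2_strip[OF w] \<delta> d(1)
        by (intro mult_mono mult_left_mono) (auto simp: power2_eq_square intro!: mult_right_mono)
      also have "\<dots> = (d * C3 * 2) * norm \<eta>" by simp
      also have "\<dots> \<le> e * norm \<eta>" using d(5) by (rule mult_right_mono) simp
      finally have T3: "norm (J_cpow (b + \<eta>) G w - J_cpow b G w - \<eta> * L0 w) \<le> e * norm \<eta>" .
      \<comment> \<open>The perturbed inner function is remainder plus unperturbed part plus linear
        part; linearity of \<open>J_cpow\<close> separates the errors \<open>T1\<close>,
        \<open>T3\<close> and \<open>T2\<close> respectively.\<close>
      have split: "(\<lambda>w. q w * iter_J q r z w) = (\<lambda>w. D w + (G w + (\<Sum>k=1..r. h k * M k w)))"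
        by (simp add: fun_eq_iff D_def G_def M_def sum_distrib_left algebra_simps)
      have dM: "decaying (\<lambda>w. \<Sum>k=1..r. h k * M k w)"
        using M by (intro decaying_sum decaying_cmult) auto
      have "iter_J q (Suc r) z w = J_cpow (z (Suc r)) (\<lambda>w. D w + (G w + (\<Sum>k=1..r. h k * M k w))) w"
        unfolding iter_J.simps split ..
      also have "\<dots> = J_cpow (z (Suc r)) D w + (J_cpow (z (Suc r)) G w + J_cpow (z (Suc r)) (\<lambda>w. \<Sum>k=1..r. h k * M k w) w)"
        unfolding J_cpow_add[OF Dd decaying_add[OF G dM] w1] J_cpow_add[OF G dM w1] ..
      also have "J_cpow (z (Suc r)) (\<lambda>w. \<Sum>k=1..r. h k * M k w) w = (\<Sum>k=1..r. h k * J_cpow (z (Suc r)) (M k) w)"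
        by (rule J_cpow_sum[OF M w1])
      finally have Fz: "iter_J q (Suc r) z w = J_cpow (z (Suc r)) D w + (J_cpow (b + \<eta>) G w +
          (\<Sum>k=1..r. h k * J_cpow (b + \<eta>) (M k) w))" unfolding zS .
      have Fa: "iter_J q (Suc r) a w = J_cpow b G w" by (simp add: b_def G_def)
      have sumL: "(\<Sum>k=1..Suc r. L' k w * (z k - a k)) = (\<Sum>k=1..r. h k * J_cpow b (M k) w) + \<eta> * L0 w"
        by (simp add: L'_def h_def \<eta>_def b_def mult.commute)
      have "iter_J q (Suc r) z w - iter_J q (Suc r) a w - (\<Sum>k=1..Suc r. L' k w * (z k - a k)) =
          J_cpow (z (Suc r)) D w + (\<Sum>k=1..r. h k * (J_cpow (b + \<eta>) (M k) w - J_cpow b (M k) w)) +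
          (J_cpow (b + \<eta>) G w - J_cpow b G w - \<eta> * L0 w)"
        unfolding Fz Fa sumL by (simp add: right_diff_distrib sum_subtractf)
      also have "norm \<dots> \<le> e / 2 * S + e / 2 * S + e * norm \<eta>"
        using T1 T2 T3 by (intro norm_triangle_mono add_mono) auto
      also have "\<dots> = e * (\<Sum>k=1..Suc r. norm (z k - a k))"
        by (simp add: S_def h_def \<eta>_def b_def distrib_left)
      finally show "norm (iter_J q (Suc r) z w - iter_J q (Suc r) a w - (\<Sum>k=1..Suc r. L' k w * (z k - a k)))
        \<le> e * (\<Sum>k=1..Suc r. norm (z k - a k))" .
    qed
  qed
qed

lemma entire_fun_iter_J:
  assumes q: "decaying q" and w: "w \<in> strip 1"
  shows "entire_fun r (\<lambda>s. iter_J q r s w)"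
  unfolding entire_fun_def
proof
  fix a :: "nat \<Rightarrow> complex"
  obtain \<delta> where \<delta>: "\<delta> < 1" "w \<in> strip \<delta>" using strip_shrink[OF w] by blast
  obtain L where L: "\<And>\<delta> e. \<delta> < 1 \<Longrightarrow> e > 0 \<Longrightarrow> \<exists>d>0. \<forall>z. (\<forall>k\<in>{1..r}. norm (z k - a k) < d) \<longrightarrow> (\<forall>w\<in>strip \<delta>.
      norm (iter_J q r z w - iter_J q r a w - (\<Sum>k=1..r. L k w * (z k - a k)))
        \<le> e * (\<Sum>k=1..r. norm (z k - a k)))" using iter_J_frechet[OF q, of r a] by blast
  show "\<exists>L. \<forall>e>0. \<exists>d>0. \<forall>z. (\<forall>k\<in>{1..r}. norm (z k - a k) < d) \<longrightarrow>
      norm (iter_J q r z w - iter_J q r a w - (\<Sum>k = 1..r. L k * (z k - a k))) \<le> e * (\<Sum>k = 1..r. norm (z k - a k))"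
  proof (intro exI[of _ "\<lambda>k. L k w"] allI impI)
    fix e :: real assume "e > 0"
    from L[OF \<delta>(1) this] obtain d where "d > 0" and d: "\<And>z. (\<forall>k\<in>{1..r}. norm (z k - a k) < d) \<Longrightarrow>
      (\<forall>w\<in>strip \<delta>. norm (iter_J q r z w - iter_J q r a w - (\<Sum>k=1..r. L k w * (z k - a k)))
        \<le> e * (\<Sum>k=1..r. norm (z k - a k)))" by blast
    show "\<exists>d>0. \<forall>z. (\<forall>k\<in>{1..r}. norm (z k - a k) < d) \<longrightarrow>
      norm (iter_J q r z w - iter_J q r a w - (\<Sum>k=1..r. L k w * (z k - a k))) \<le> e * (\<Sum>k=1..r. norm (z k - a k))"
      using \<open>d > 0\<close> bspec[OF d \<delta>(2)] by (intro exI[of _ d]) simp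
  qed
qed

text \<open>Near any point there are points with no integer coordinate: shift all coordinates by the same
  small imaginary number.\<close>

lemma entire_fun_eqI:
  assumes F: "entire_fun r F" and G: "entire_fun r G"
    and eq: "\<And>s. (\<forall>k\<in>{1..r}. s k \<notin> \<int>) \<Longrightarrow> F s = G s"
  shows "F = G"
proof
  fix a :: "nat \<Rightarrow> complex"
  have lim: "((\<lambda>y. H (\<lambda>k. a k + \<i> * of_real y)) \<longlongrightarrow> H a) (at_right 0)" if H: "entire_fun r H" for H
  proof -
    obtain L where L: "\<forall>e>0. \<exists>d>0. \<forall>z. (\<forall>k\<in>{1..r}. norm (z k - a k) < d) \<longrightarrow>
        norm (H z - H a - (\<Sum>k=1..r. L k * (z k - a k))) \<le> e * (\<Sum>k=1..r. norm (z k - a k))"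
      using H unfolding entire_fun_def by blast
    from L[rule_format, OF zero_less_one] obtain d where d: "d > 0"
      "\<And>z. (\<forall>k\<in>{1..r}. norm (z k - a k) < d) \<Longrightarrow>
        norm (H z - H a - (\<Sum>k=1..r. L k * (z k - a k))) \<le> 1 * (\<Sum>k=1..r. norm (z k - a k))"
      by auto
    define B where "B = (\<Sum>k=1..r. norm (L k)) + real r"
    have est: "norm (H (\<lambda>k. a k + \<i> * of_real y) - H a) \<le> B * y" if y: "0 < y" "y < d" for y
    proof -
      let ?z = "\<lambda>k. a k + \<i> * complex_of_real y"
      have n: "norm (?z k - a k) = y" for k using y by (simp add: norm_mult)
      have "norm (H ?z - H a) \<le> norm (H ?z - H a - (\<Sum>k=1..r. L k * (?z k - a k))) + norm (\<Sum>k=1..r. L k * (?z k - a k))"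
        using norm_triangle_ineq[of "H ?z - H a - (\<Sum>k=1..r. L k * (?z k - a k))" "\<Sum>k=1..r. L k * (?z k - a k)"]
        by simp
      also have "\<dots> \<le> 1 * (\<Sum>k=1..r. norm (?z k - a k)) + (\<Sum>k=1..r. norm (L k * (?z k - a k)))"
        using y n by (intro add_mono d(2) norm_sum) simp_all
      also have "\<dots> = B * y"
        unfolding norm_mult n by (simp add: B_def distrib_right sum_distrib_right)
      finally show ?thesis .
    qed
    have "((\<lambda>y. B * y) \<longlongrightarrow> B * 0) (at_right 0)" by (intro tendsto_intros)
    hence B0: "((\<lambda>y. B * y) \<longlongrightarrow> 0) (at_right 0)" by simp
    have "\<forall>\<^sub>F y in at_right 0. norm (H (\<lambda>k. a k + \<i> * of_real y) - H a) \<le> B * y"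
      unfolding eventually_at_right_field using d(1) est by blast
    hence "((\<lambda>y. H (\<lambda>k. a k + \<i> * of_real y) - H a) \<longlongrightarrow> 0) (at_right 0)"
      by (rule Lim_null_comparison[OF _ B0])
    thus ?thesis by (rule Lim_null[THEN iffD2])
  qed
  have "\<forall>\<^sub>F y in at_right (0::real). \<forall>k\<in>{1..r}. a k + \<i> * of_real y \<notin> \<int>"
  proof (rule eventually_ball_finite)
    show "\<forall>k\<in>{1..r}. \<forall>\<^sub>F y in at_right (0::real). a k + \<i> * of_real y \<notin> \<int>"
    proof
      fix k
      have "\<forall>\<^sub>F y in at_right (0::real). y \<noteq> - Im (a k)"
      proof (cases "- Im (a k) > 0")
        case True
        thus ?thesis unfolding eventually_at_right_field by blast
      next
        case False
        thus ?thesis unfolding eventually_at_right_field by (intro exI[of _ 1]) auto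
      qed
      thus "\<forall>\<^sub>F y in at_right (0::real). a k + \<i> * of_real y \<notin> \<int>"
        by eventually_elim (auto elim!: Ints_cases simp: complex_eq_iff)
    qed
  qed simp
  hence "\<forall>\<^sub>F y in at_right (0::real). F (\<lambda>k. a k + \<i> * of_real y) = G (\<lambda>k. a k + \<i> * of_real y)"
    by eventually_elim (rule eq)
  from tendsto_cong[OF this] lim[OF F] have "((\<lambda>y. G (\<lambda>k. a k + \<i> * of_real y)) \<longlongrightarrow> F a) (at_right 0)" by simp
  from tendsto_unique[OF _ this lim[OF G]] show "F a = G a" by simp
qed

lemma entire_extension_eqI:
  assumes "entire_fun r F" "\<And>s. (\<forall>k\<in>{1..r}. s k \<notin> \<int>) \<Longrightarrow> F s = f s"
  shows "entire_extension r f = F"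
  unfolding entire_extension_def
proof (rule the_equality)
  fix G assume G: "entire_fun r G \<and> (\<forall>s. (\<forall>k\<in>{1..r}. s k \<notin> \<int>) \<longrightarrow> G s = f s)"
  show "G = F"
  proof (rule entire_fun_eqI[OF conjunct1[OF G] assms(1)])
    fix s :: "nat \<Rightarrow> complex" assume s: "\<forall>k\<in>{1..r}. s k \<notin> \<int>"
    show "G s = F s" using conjunct2[OF G] s assms(2)[OF s] by metis
  qed
qed (simp add: assms)

section \<open>Iterated Hankel integrals\<close>

abbreviation lborel_pow :: "nat \<Rightarrow> (nat \<Rightarrow> real) measure" where
  "lborel_pow r \<equiv> Pi\<^sub>M {1..r} (\<lambda>_. lborel)"

definition multi_integrand ::
    "real \<Rightarrow> (complex \<Rightarrow> complex) \<Rightarrow> nat \<Rightarrow> (nat \<Rightarrow> complex) \<Rightarrow> complex \<Rightarrow> (nat \<Rightarrow> real) \<Rightarrow> complex" where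
  "multi_integrand eps q r s w u =
     (\<Prod>j=1..r. q (w - (\<Sum>k=j..r. hankel eps (u k)))) * (\<Prod>k=1..r. hankel_kernel eps (s k) (u k))"

definition multi_hankel ::
    "real \<Rightarrow> (complex \<Rightarrow> complex) \<Rightarrow> nat \<Rightarrow> (nat \<Rightarrow> complex) \<Rightarrow> complex \<Rightarrow> complex" where
  "multi_hankel eps q r s w = (LINT u|lborel_pow r. multi_integrand eps q r s w u)"

lemma hankel_integral_radius_eq:
  "hankel_integral_radius eps r g s = (LINT u|lborel_pow r.
     g (\<lambda>k. hankel eps (u k)) * (\<Prod>k=1..r. hankel_kernel eps (s k) (u k)))"
  by (simp add: hankel_integral_radius_def hankel_kernel_def hankel_deriv_def)

lemma measurable_coordinate:
  fixes k :: nat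
  assumes "f \<in> borel_measurable borel" "k \<in> {1..r}"
  shows "(\<lambda>u. f (u k)) \<in> borel_measurable (lborel_pow r)"
  by (rule measurable_compose[OF measurable_component_singleton[OF assms(2)]]) (use assms(1) in simp)

context
  fixes eps :: real
  assumes eps: "eps > 0"
begin

lemma integrable_hankel_kernel:
  "integrable lborel (\<lambda>u. exp (- Re (hankel eps u) / 2) * norm (hankel_kernel eps s u))"
proof -
  obtain C where C: "kernel_bound eps (norm (s - 1)) C" using hankel_kernel_bound[OF eps] by blast
  show ?thesis
  proof (rule Bochner_Integration.integrable_bound)
    show "integrable lborel (\<lambda>u. C * hankel_weight eps u)" using integrable_hankel_weight[OF eps] by simp
    show "(\<lambda>u. exp (- Re (hankel eps u) / 2) * norm (hankel_kernel eps s u)) \<in> borel_measurable lborel"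
      using measurable_hankel_kernel[OF eps] borel_measurable_hankel[OF eps] by measurable
    have "exp (- Re (hankel eps u) / 2) * norm (hankel_kernel eps s u) \<le> C * hankel_weight eps u" for u
      using C unfolding kernel_bound_def[OF eps] by blast
    thus "AE u in lborel. norm (exp (- Re (hankel eps u) / 2) * norm (hankel_kernel eps s u)) \<le> norm (C * hankel_weight eps u)"
      by (intro AE_I2) (simp add: order_trans[OF _ abs_ge_self])
  qed
qed

lemma strip_diff_sum_hankel:
  assumes "finite A" "w \<in> strip \<delta>"
  shows "w - (\<Sum>k\<in>A. hankel eps (u k)) \<in> strip (\<delta> + real (card A) * eps)"
  using assms(1)
proof (induction A rule: finite_induct)
  case (insert k A)
  have "(w - (\<Sum>k\<in>A. hankel eps (u k))) - hankel eps (u k) \<in> strip (\<delta> + real (card A) * eps + eps)"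
    by (rule strip_diff_hankel[OF eps insert.IH])
  moreover have "(w - (\<Sum>k\<in>A. hankel eps (u k))) - hankel eps (u k) = w - (\<Sum>k\<in>insert k A. hankel eps (u k))"
    using insert by simp
  moreover have "\<delta> + real (card A) * eps + eps = \<delta> + real (card (insert k A)) * eps"
    using insert by (simp add: algebra_simps)
  ultimately show ?case by simp
qed (use assms in simp)

lemma strip_diff_sum_hankel':
  assumes "w \<in> strip \<delta>" "\<delta> + real r * eps \<le> \<delta>'" "1 \<le> j"
  shows "w - (\<Sum>k=j..r. hankel eps (u k)) \<in> strip \<delta>'"
proof -
  have "real (card {j..r}) * eps \<le> real r * eps" using assms(3) eps by (intro mult_right_mono) auto
  hence "strip (\<delta> + real (card {j..r}) * eps) \<subseteq> strip \<delta>'" using assms(2) by (intro strip_mono) linarith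
  moreover have "w - (\<Sum>k=j..r. hankel eps (u k)) \<in> strip (\<delta> + real (card {j..r}) * eps)"
    by (rule strip_diff_sum_hankel[OF finite_atLeastAtMost assms(1)])
  ultimately show ?thesis by blast
qed

text \<open>The factor j = 1 alone contains every variable and supplies the decay in all of them;
  the other factors are merely bounded by 2 K.\<close>

lemma norm_multi_product_le:
  assumes K: "dec_bound \<delta>' K q" and w: "w \<in> strip \<delta>" and \<delta>: "\<delta> + real r * eps \<le> \<delta>'" "\<delta>' < 1"
  shows "norm (\<Prod>j=1..r. q (w - (\<Sum>k=j..r. hankel eps (u k)))) \<le>
    (2 * K) ^ r * (\<Prod>k=1..r. exp (- Re (hankel eps (u k)) / 2))"
proof (cases r)
  case (Suc n)
  let ?X = "\<lambda>j. \<Sum>k=j..r. hankel eps (u k)"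
  have K0: "0 \<le> K" by (rule dec_bound_nonneg[OF K])
  have b: "norm (q (w - ?X j)) \<le> K * exp (Re (w - ?X j) / 2)" if "1 \<le> j" for j
    by (rule dec_boundD[OF K strip_diff_sum_hankel'[OF w \<delta>(1) that]])
  have b2: "norm (q (w - ?X j)) \<le> 2 * K" if j: "1 \<le> j" for j
  proof -
    have "exp (Re (w - ?X j) / 2) \<le> 2"
      using exp_half_le_2_strip[OF strip_diff_sum_hankel'[OF w \<delta>(1) j]] \<delta>(2) by simp
    hence "K * exp (Re (w - ?X j) / 2) \<le> K * 2" using K0 by (rule mult_left_mono)
    thus ?thesis using b[OF j] by simp
  qed
  have \<delta>1: "\<delta> \<le> 1"
  proof -
    have "0 \<le> real r * eps" using eps by simp
    thus ?thesis using \<delta> by linarith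
  qed
  have "norm (q (w - ?X 1)) \<le> K * exp (Re (w - ?X 1) / 2)" by (rule b) simp
  also have "\<dots> = K * exp (Re w / 2) * exp (- Re (?X 1) / 2)" by (simp only: exp_half_diff mult.assoc)
  also have "exp (- Re (?X 1) / 2) = (\<Prod>k=1..r. exp (- Re (hankel eps (u k)) / 2))"
    by (simp add: sum_negf sum_divide_distrib flip: exp_sum)
  also have "K * exp (Re w / 2) * (\<Prod>k=1..r. exp (- Re (hankel eps (u k)) / 2)) \<le>
      K * 2 * (\<Prod>k=1..r. exp (- Re (hankel eps (u k)) / 2))"
    using exp_half_le_2_strip[OF w \<delta>1] K0 by (intro mult_right_mono mult_left_mono prod_nonneg) auto
  finally have first: "norm (q (w - ?X 1)) \<le> 2 * K * (\<Prod>k=1..r. exp (- Re (hankel eps (u k)) / 2))"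
    by (simp add: mult_ac)
  have "(\<Prod>j=Suc 1..r. norm (q (w - ?X j))) \<le> (\<Prod>j=Suc 1..r. 2 * K)"
    using b2 by (intro prod_mono) auto
  also have "\<dots> = (2 * K) ^ n" using Suc by simp
  finally have rest: "(\<Prod>j=Suc 1..r. norm (q (w - ?X j))) \<le> (2 * K) ^ n" .
  have "norm (\<Prod>j=1..r. q (w - ?X j)) = norm (q (w - ?X 1)) * (\<Prod>j=Suc 1..r. norm (q (w - ?X j)))"
    unfolding prod_norm[symmetric] by (rule prod.atLeast_Suc_atMost) (use Suc in simp)
  also have "\<dots> \<le> (2 * K * (\<Prod>k=1..r. exp (- Re (hankel eps (u k)) / 2))) * (2 * K) ^ n"
    using first rest K0 by (intro mult_mono) (auto intro!: prod_nonneg mult_nonneg_nonneg)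
  finally show ?thesis using Suc by (simp add: mult_ac)
qed simp

lemma measurable_sum_hankel:
  "1 \<le> (j::nat) \<Longrightarrow> (\<lambda>u. \<Sum>k=j..r. hankel eps (u k)) \<in> borel_measurable (lborel_pow r)"
  by (intro borel_measurable_sum measurable_coordinate borel_measurable_hankel[OF eps])
     (meson atLeastAtMost_iff order_trans)

lemma measurable_multi_integrand:
  assumes [measurable]: "q \<in> borel_measurable borel"
  shows "multi_integrand eps q r s w \<in> borel_measurable (lborel_pow r)"
proof -
  have "(\<lambda>u. q (w - (\<Sum>k=j..r. hankel eps (u k)))) \<in> borel_measurable (lborel_pow r)" if "1 \<le> j" for j
    using measurable_sum_hankel[OF that] by measurable
  thus ?thesis unfolding multi_integrand_def[abs_def]
    by (intro borel_measurable_times borel_measurable_prod measurable_coordinate measurable_hankel_kernel[OF eps]) auto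
qed

text \<open>Depends on neither q nor w, so that one majorant serves a whole family of kernels as c
  -> 1.\<close>

definition multi_weight :: "nat \<Rightarrow> (nat \<Rightarrow> complex) \<Rightarrow> (nat \<Rightarrow> real) \<Rightarrow> real" where
  "multi_weight r s u = (\<Prod>k=1..r. exp (- Re (hankel eps (u k)) / 2) * norm (hankel_kernel eps (s k) (u k)))"

lemma integrable_multi_weight:
  "integrable (lborel_pow r) (multi_weight r s)"
proof -
  interpret product_sigma_finite "\<lambda>_::nat. lborel :: real measure" by standard
  show ?thesis unfolding multi_weight_def[abs_def]
    by (rule product_integrable_prod[OF finite_atLeastAtMost integrable_hankel_kernel])
qed

lemma norm_multi_integrand_le:
  assumes "dec_bound \<delta>' K q" "w \<in> strip \<delta>" "\<delta> + real r * eps \<le> \<delta>'" "\<delta>' < 1"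
  shows "norm (multi_integrand eps q r s w u) \<le> (2 * K) ^ r * multi_weight r s u"
proof -
  have "norm (multi_integrand eps q r s w u) =
      norm (\<Prod>j=1..r. q (w - (\<Sum>k=j..r. hankel eps (u k)))) * (\<Prod>k=1..r. norm (hankel_kernel eps (s k) (u k)))"
    by (simp add: multi_integrand_def norm_mult prod_norm)
  also have "\<dots> \<le> ((2 * K) ^ r * (\<Prod>k=1..r. exp (- Re (hankel eps (u k)) / 2))) * (\<Prod>k=1..r. norm (hankel_kernel eps (s k) (u k)))"
    by (rule mult_right_mono[OF norm_multi_product_le[OF assms]]) (auto intro: prod_nonneg)
  also have "\<dots> = (2 * K) ^ r * multi_weight r s u"
    by (simp add: multi_weight_def prod.distrib)
  finally show ?thesis .
qed

lemma integrable_multi_integrand: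
  assumes "decaying q" "q \<in> borel_measurable borel" "w \<in> strip \<delta>" "\<delta> + real r * eps < 1"
  shows "integrable (lborel_pow r) (multi_integrand eps q r s w)"
proof -
  obtain K where K: "dec_bound (\<delta> + real r * eps) K q" using decaying_bound[OF assms(1,4)] by blast
  show ?thesis
  proof (rule Bochner_Integration.integrable_bound)
    show "integrable (lborel_pow r) (\<lambda>u. (2 * K) ^ r * multi_weight r s u)"
      using integrable_multi_weight by simp
    show "AE u in lborel_pow r. norm (multi_integrand eps q r s w u) \<le> norm ((2 * K) ^ r * multi_weight r s u)"
      by (rule AE_I2, rule order_trans[OF norm_multi_integrand_le[OF K assms(3) order_refl assms(4)]])
         (simp only: real_norm_def abs_ge_self)
  qed (rule measurable_multi_integrand[OF assms(2)])
qed

text \<open>Integrating over \<open>x\<^sub>r\<close> last replaces \<open>w\<close> by \<open>w - x\<^sub>r\<close> in the remaining integral.\<close>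

lemma multi_integrand_merge:
  "multi_integrand eps q (Suc r) s w (merge {Suc r} {1..r} (x, y)) =
     hankel_kernel eps (s (Suc r)) (x (Suc r)) * q (w - hankel eps (x (Suc r))) *
     multi_integrand eps q r s (w - hankel eps (x (Suc r))) y"
proof -
  let ?u = "merge {Suc r} {1..r} (x, y)"
  have u: "?u (Suc r) = x (Suc r)" "\<And>k. k \<in> {1..r} \<Longrightarrow> ?u k = y k" by (auto simp: merge_def)
  have "(\<Prod>j=1..Suc r. q (w - (\<Sum>k=j..Suc r. hankel eps (?u k)))) =
      (\<Prod>j=1..r. q (w - (\<Sum>k=j..Suc r. hankel eps (?u k)))) * q (w - hankel eps (x (Suc r)))"
    using u(1) by (simp add: prod.nat_ivl_Suc')
  also have "(\<Prod>j=1..r. q (w - (\<Sum>k=j..Suc r. hankel eps (?u k)))) =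
      (\<Prod>j=1..r. q (w - hankel eps (x (Suc r)) - (\<Sum>k=j..r. hankel eps (y k))))"
  proof (rule prod.cong[OF refl])
    fix j assume j: "j \<in> {1..r}"
    have "(\<Sum>k=j..Suc r. hankel eps (?u k)) = (\<Sum>k=j..r. hankel eps (?u k)) + hankel eps (x (Suc r))"
      using j u(1) by (simp add: sum.nat_ivl_Suc')
    also have "(\<Sum>k=j..r. hankel eps (?u k)) = (\<Sum>k=j..r. hankel eps (y k))"
      using j u(2) by (intro sum.cong) auto
    finally show "q (w - (\<Sum>k=j..Suc r. hankel eps (?u k))) =
        q (w - hankel eps (x (Suc r)) - (\<Sum>k=j..r. hankel eps (y k)))" by (simp add: algebra_simps)
  qed
  moreover have "(\<Prod>k=1..Suc r. hankel_kernel eps (s k) (?u k)) =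
      (\<Prod>k=1..r. hankel_kernel eps (s k) (y k)) * hankel_kernel eps (s (Suc r)) (x (Suc r))"
  proof -
    have "(\<Prod>k=1..r. hankel_kernel eps (s k) (?u k)) = (\<Prod>k=1..r. hankel_kernel eps (s k) (y k))"
      using u(2) by (intro prod.cong) auto
    thus ?thesis using u(1) by (simp add: prod.nat_ivl_Suc')
  qed
  ultimately show ?thesis unfolding multi_integrand_def by (simp only: mult_ac)
qed

text \<open>The induction hypothesis is used at w minus a contour point, hence w and \<delta> vary:
  each contour point can move w to the right by eps, and \<delta> + r eps < 1 is the budget for all
  of them.\<close>

lemma multi_hankel_eq_iter_J:
  assumes q: "decaying q" "q \<in> borel_measurable borel"
  shows "w \<in> strip \<delta> \<Longrightarrow> \<delta> + real r * eps < 1 \<Longrightarrow> \<forall>k\<in>{1..r}. s k \<notin> \<int> \<Longrightarrow>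
    multi_hankel eps q r s w =
      (\<Prod>k=1..r. (exp (2 * of_real pi * \<i> * s k) - 1) * Gamma (s k)) * iter_J q r s w"
proof (induction r arbitrary: w \<delta>)
  case 0
  interpret product_sigma_finite "\<lambda>_::nat. lborel :: real measure" by standard
  show ?case using product_integral_prod[of "{}" "\<lambda>_ _. 1 :: complex"]
    by (simp add: multi_hankel_def multi_integrand_def)
next
  case (Suc r)
  interpret product_sigma_finite "\<lambda>_::nat. lborel :: real measure" by standard
  define c where "c = (\<Prod>k=1..r. (exp (2 * of_real pi * \<i> * s k) - 1) * Gamma (s k))"
  define G where "G = (\<lambda>w. q w * iter_J q r s w)"
  have G: "decaying G" unfolding G_def by (rule decaying_mult_iter_J[OF q(1)])
  have set: "{1..Suc r} = {Suc r} \<union> {1..r}" by auto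
  have \<delta>r: "(\<delta> + eps) + real r * eps < 1" using Suc.prems(2) by (simp add: algebra_simps)
  have "0 \<le> real r * eps" using eps by simp
  hence w: "w \<in> strip (1 - eps)" using Suc.prems(1) \<delta>r strip_mono[of \<delta> "1 - eps"] by auto
  have IH: "multi_hankel eps q r s (w - hankel eps v) = c * iter_J q r s (w - hankel eps v)" for v
    unfolding c_def using Suc.prems(3)
    by (intro Suc.IH[OF strip_diff_hankel[OF eps Suc.prems(1)] \<delta>r]) auto
  have "multi_hankel eps q (Suc r) s w =
      (LINT u|Pi\<^sub>M ({Suc r} \<union> {1..r}) (\<lambda>_. lborel). multi_integrand eps q (Suc r) s w u)"
    unfolding multi_hankel_def set ..
  also have "\<dots> = (LINT x|Pi\<^sub>M {Suc r} (\<lambda>_. lborel). LINT y|lborel_pow r.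
      multi_integrand eps q (Suc r) s w (merge {Suc r} {1..r} (x, y)))"
    by (rule product_integral_fold[OF _ _ _ integrable_multi_integrand[OF q Suc.prems(1,2), of s, unfolded set]]) auto
  also have "\<dots> = (LINT x|Pi\<^sub>M {Suc r} (\<lambda>_. lborel). c * (G (w - hankel eps (x (Suc r))) * hankel_kernel eps (s (Suc r)) (x (Suc r))))"
    unfolding multi_integrand_merge integral_mult_right_zero multi_hankel_def[symmetric] IH G_def
    by (simp add: mult_ac)
  also have "\<dots> = (LINT v|lborel. c * (G (w - hankel eps v) * hankel_kernel eps (s (Suc r)) v))"
    by (rule product_integral_singleton)
       (use measurable_hankel_integrand[OF eps decaying_holomorphic[OF G] w] in simp)
  also have "\<dots> = c * hankel_op eps (s (Suc r)) G w" by (simp add: hankel_op_def)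
  also have "hankel_op eps (s (Suc r)) G w =
      (exp (2 * of_real pi * \<i> * s (Suc r)) - 1) * Gamma (s (Suc r)) * J_cpow (s (Suc r)) G w"
    using Suc.prems(3) by (intro J_cpow_nonint[OF G eps w]) auto
  finally show ?case by (simp add: c_def G_def prod.nat_ivl_Suc' mult_ac)
qed

section \<open>Null sets on which a kernel meets its singularity\<close>

lemma countable_hankel_fiber: "countable {u. hankel eps u = c}"
proof (cases "\<exists>y. cis y = c / of_real eps")
  case False
  have "{u. hankel eps u = c} \<subseteq> {eps - Re c, Re c - eps + 2 * pi}"
    using False eps by (auto simp: hankel_explicit[OF eps] split: if_splits)
  thus ?thesis by (rule countable_subset) simp
next
  case True
  then obtain y where y: "cis y = c / of_real eps" by blast
  have "{u. hankel eps u = c} \<subseteq> {eps - Re c, Re c - eps + 2 * pi} \<union> range (\<lambda>n::int. y + 2 * pi * of_int n)"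
  proof
    fix u assume u: "u \<in> {u. hankel eps u = c}"
    show "u \<in> {eps - Re c, Re c - eps + 2 * pi} \<union> range (\<lambda>n::int. y + 2 * pi * of_int n)"
    proof (cases "u < 0 \<or> u > 2 * pi")
      case True
      thus ?thesis using u by (auto simp: hankel_explicit[OF eps] split: if_splits)
    next
      case False
      hence "cis u = cis y" using u eps y by (auto simp: hankel_explicit[OF eps] field_simps)
      hence "exp (\<i> * of_real u) = exp (\<i> * of_real y)" by (simp add: cis_conv_exp)
      then obtain n :: int where "\<i> * of_real u = \<i> * of_real y + of_real (real_of_int (2 * n) * pi) * \<i>"
        unfolding exp_eq by blast
      hence "u = y + 2 * pi * of_int n"
        by (simp add: complex_eq_iff)
      thus ?thesis by blast
    qed
  qed
  thus ?thesis by (rule countable_subset) auto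
qed

text \<open>With all coordinates but the j-th fixed, the exceptional set lies in a fibre of the
  contour, which is countable; Fubini makes the whole set null. At its points the given kernels take
  the default value of a division by zero instead of the removable one.\<close>

lemma AE_sum_hankel_neq:
  fixes r :: nat
  assumes j: "j \<in> {1..r}"
  shows "AE u in lborel_pow r. (\<Sum>k=j..r. hankel eps (u k)) \<noteq> a"
proof -
  interpret product_sigma_finite "\<lambda>_::nat. lborel :: real measure" by standard
  let ?I = "{1..r} - {j}"
  define N where "N = {u \<in> space (lborel_pow r). (\<Sum>k=j..r. hankel eps (u k)) = a}"
  have meas: "(\<lambda>u. \<Sum>k=j..r. hankel eps (u k)) \<in> borel_measurable (lborel_pow r)"
    using j by (intro measurable_sum_hankel) auto
  have N: "N \<in> sets (lborel_pow r)"
  proof -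
    have "N = (\<lambda>u. \<Sum>k=j..r. hankel eps (u k)) -` {a} \<inter> space (lborel_pow r)" by (auto simp: N_def)
    thus ?thesis using measurable_sets[OF meas, of "{a}"] by simp
  qed
  have I: "insert j ?I = {1..r}" using j by auto
  have "emeasure (lborel_pow r) N = (\<integral>\<^sup>+ u. indicator N u \<partial>Pi\<^sub>M (insert j ?I) (\<lambda>_. lborel))"
    using N unfolding I by simp
  also have "\<dots> = (\<integral>\<^sup>+ x. (\<integral>\<^sup>+ y. indicator N (x(j := y)) \<partial>lborel) \<partial>Pi\<^sub>M ?I (\<lambda>_. lborel))"
  proof -
    have "indicator N \<in> borel_measurable (Pi\<^sub>M (insert j ?I) (\<lambda>_. lborel :: real measure))"
      using N unfolding I by simp
    from product_nn_integral_insert[OF _ _ this] show ?thesis by simp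
  qed
  also have "\<dots> = (\<integral>\<^sup>+ x. 0 \<partial>Pi\<^sub>M ?I (\<lambda>_. lborel :: real measure))"
  proof (rule nn_integral_cong)
    fix x :: "nat \<Rightarrow> real"
    define c where "c = a - (\<Sum>k\<in>{j..r} - {j}. hankel eps (x k))"
    have sub: "indicator N (x(j := y)) \<le> (indicator {u. hankel eps u = c} y :: ennreal)" for y
    proof (cases "x(j := y) \<in> N")
      case True
      hence "a = (\<Sum>k=j..r. hankel eps ((x(j := y)) k))" by (simp add: N_def)
      also have "\<dots> = hankel eps y + (\<Sum>k\<in>{j..r} - {j}. hankel eps ((x(j := y)) k))"
        using j by (subst sum.remove[of _ j]) auto
      also have "(\<Sum>k\<in>{j..r} - {j}. hankel eps ((x(j := y)) k)) = a - c"
        unfolding c_def diff_diff_eq2 add_diff_cancel_left' by (rule sum.cong) auto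
      finally have "hankel eps y = c" by simp
      thus ?thesis using True by simp
    qed simp
    have cn: "countable {u. hankel eps u = c}" by (rule countable_hankel_fiber)
    have "(\<integral>\<^sup>+ y. indicator N (x(j := y)) \<partial>lborel) \<le> (\<integral>\<^sup>+ y. indicator {u. hankel eps u = c} y \<partial>lborel)"
      using sub by (intro nn_integral_mono)
    also have "\<dots> = emeasure lborel {u. hankel eps u = c}"
      using sets.countable[OF _ cn, of lborel] by (intro nn_integral_indicator) simp
    also have "\<dots> = 0" by (rule emeasure_lborel_countable[OF cn])
    finally show "(\<integral>\<^sup>+ y. indicator N (x(j := y)) \<partial>lborel) = 0" by simp
  qed
  finally have "emeasure (lborel_pow r) N = 0" by simp
  hence "N \<in> null_sets (lborel_pow r)" using N by (auto intro: null_setsI)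
  thus ?thesis by (rule AE_I') (auto simp: N_def)
qed

end

section \<open>The kernels\<close>

lemma entire_divided_difference:
  assumes "f holomorphic_on UNIV"
  shows "\<exists>g. g holomorphic_on UNIV \<and> g 0 = deriv f 0 \<and> (\<forall>w. f w = f 0 + w * g w)"
proof -
  define g where "g = (\<lambda>z. if z = 0 then deriv f 0 else (f z - f 0) / (z - 0))"
  have "g holomorphic_on UNIV" unfolding g_def by (rule pole_lemma[OF assms]) simp
  thus ?thesis by (intro exI[of _ g]) (auto simp: g_def)
qed

text \<open>The entire function (e^(-w) - 1 + w) / w^2, obtained from two divided differences. The
  choice is unambiguous: the equation fixes the value off 0 and continuity fixes it at 0.\<close>

definition exp_rem :: "complex \<Rightarrow> complex" where
  "exp_rem = (SOME g. g holomorphic_on UNIV \<and> (\<forall>w. exp (- w) = 1 - w + w\<^sup>2 * g w))"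

lemma exp_rem: "exp_rem holomorphic_on UNIV" "exp (- w) = 1 - w + w\<^sup>2 * exp_rem w"
proof -
  have d: "deriv (\<lambda>w::complex. exp (- w)) 0 = -1"
    by (rule DERIV_imp_deriv) (auto intro!: derivative_eq_intros)
  have "(\<lambda>w::complex. exp (- w)) holomorphic_on UNIV" by (intro holomorphic_intros)
  from entire_divided_difference[OF this] d obtain g1 where
    g1: "g1 holomorphic_on UNIV" "g1 0 = -1" "\<And>w. exp (- w) = 1 + w * g1 w" by auto
  from entire_divided_difference[OF g1(1)] g1(2) obtain g2 where
    g2: "g2 holomorphic_on UNIV" "\<And>w. g1 w = -1 + w * g2 w" by auto
  have "exp (- w) = 1 - w + w\<^sup>2 * g2 w" for w
    unfolding g1(3) g2(2) by (simp add: power2_eq_square algebra_simps)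
  with g2(1) have "\<exists>g. g holomorphic_on UNIV \<and> (\<forall>w. exp (- w) = 1 - w + w\<^sup>2 * g w)" by blast
  from someI_ex[OF this]
  show "exp_rem holomorphic_on UNIV" "exp (- w) = 1 - w + w\<^sup>2 * exp_rem w"
    unfolding exp_rem_def by blast+
qed

text \<open>The entire function (1 - e^(-w)) / w, with value 1 at 0.\<close>

definition exp_quot :: "complex \<Rightarrow> complex" where
  "exp_quot w = 1 - w * exp_rem w"

lemma exp_minus_one: "exp (- w) - 1 = - w * exp_quot w"
  by (simp add: exp_rem(2) exp_quot_def power2_eq_square algebra_simps)

text \<open>The zeros are 2 \<pi> i n with n \<noteq> 0, and 3 < 2 \<pi>. The bound is wider than
  \<open>strip 1\<close> to cover points of it scaled by up to 5/4 and the estimates on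
  \<open>strip 2\<close>.\<close>

lemma exp_quot_nonzero:
  assumes "\<bar>Im w\<bar> < 3" shows "exp_quot w \<noteq> 0"
proof
  assume 0: "exp_quot w = 0"
  hence "exp (- w) = 1" using exp_minus_one[of w] by simp
  then obtain n :: int where n: "Re w = 0" "Im (- w) = of_int (2 * n) * pi"
    unfolding exp_eq_1 by auto
  have "n = 0"
  proof (rule ccontr)
    assume "n \<noteq> 0"
    hence "1 \<le> \<bar>real_of_int n\<bar>" by linarith
    hence "2 * (1 * 2) \<le> 2 * (\<bar>real_of_int n\<bar> * pi)" using pi_ge_two by (intro mult_left_mono mult_mono) auto
    moreover have "\<bar>Im w\<bar> = 2 * (\<bar>real_of_int n\<bar> * pi)" using n(2) by (simp add: abs_mult flip: abs_minus_cancel[of "Im w"])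
    ultimately show False using assms by linarith
  qed
  hence "w = 0" using n by (simp add: complex_eq_iff)
  thus False using 0 by (simp add: exp_quot_def)
qed

text \<open>\<open>Li\<^bsup>des\<^esup>(0)\<close> in the variable \<open>w = log t\<close>, in a form in which the singularity at
  \<open>w = 0\<close> is visibly removable.\<close>

definition li_kernel :: "complex \<Rightarrow> complex" where
  "li_kernel w = (exp_rem w + w * exp_rem w - 1) / (exp_quot w)\<^sup>2"

lemma li_kernel_eq:
  assumes "w \<noteq> 0"
  shows "li_kernel w = 1 / (exp (- w) - 1) + w * exp (- w) / (exp (- w) - 1)\<^sup>2"
proof (cases "exp_quot w = 0")
  \<comment> \<open>All denominators are 0 here and both sides are 0 by convention, so the identity
    also holds at the points 2 \<pi> i n with n \<noteq> 0.\<close>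
  case True
  thus ?thesis by (simp add: li_kernel_def exp_minus_one)
next
  case False
  have e: "exp (- w) = 1 - w * exp_quot w" using exp_minus_one[of w] by (simp add: algebra_simps)
  have "1 / (exp (- w) - 1) + w * exp (- w) / (exp (- w) - 1)\<^sup>2 =
      (1 - w * exp_quot w - exp_quot w) / (w * (exp_quot w)\<^sup>2)"
    unfolding exp_minus_one e using False assms by (simp add: field_simps power2_eq_square)
  also have "1 - w * exp_quot w - exp_quot w = w * (exp_rem w + w * exp_rem w - 1)"
    by (simp add: exp_quot_def algebra_simps)
  also have "\<dots> / (w * (exp_quot w)\<^sup>2) = li_kernel w" using assms by (simp add: li_kernel_def)
  finally show ?thesis by simp
qed

lemma holomorphic_exp_quot: "exp_quot holomorphic_on A"
  unfolding exp_quot_def[abs_def]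
  by (intro holomorphic_intros holomorphic_on_subset[OF exp_rem(1)]) auto

lemma holomorphic_li_kernel: "li_kernel holomorphic_on strip 3"
proof -
  have "exp_rem holomorphic_on strip 3" by (rule holomorphic_on_subset[OF exp_rem(1)]) simp
  thus ?thesis unfolding li_kernel_def[abs_def]
    by (intro holomorphic_intros holomorphic_exp_quot) (use exp_quot_nonzero in \<open>auto simp: strip_def\<close>)
qed

lemma entire_imp_borel: "f holomorphic_on UNIV \<Longrightarrow> f \<in> borel_measurable borel" for f :: "complex \<Rightarrow> complex"
  by (rule borel_measurable_continuous_onI[OF holomorphic_on_imp_continuous_on])

lemma borel_measurable_li_kernel: "li_kernel \<in> borel_measurable borel"
proof -
  note [measurable] = entire_imp_borel[OF exp_rem(1)] entire_imp_borel[OF holomorphic_exp_quot]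
  show ?thesis unfolding li_kernel_def[abs_def] by measurable
qed

lemma li_kernel_bound_left:
  assumes w: "Re w \<le> -1" "\<bar>Im w\<bar> \<le> 2"
  shows "norm (li_kernel w) \<le> 12 * exp (2 / 3 * Re w)"
proof -
  define x where "x = - Re w"
  have x: "x \<ge> 1" using w by (simp add: x_def)
  have w0: "w \<noteq> 0" using w by auto
  have ex: "exp x \<ge> 2" using exp_ge_add_one_self[of x] x by linarith
  have ne: "norm (exp (- w)) = exp x" by (simp add: x_def)
  have "norm (exp (- w) - 1) \<ge> norm (exp (- w)) - norm (1::complex)" by (rule norm_triangle_ineq2)
  hence low: "norm (exp (- w) - 1) \<ge> exp x / 2" using ne ex by simp
  have lowpos: "0 < norm (exp (- w) - 1)" using low exp_gt_zero[of x] by linarith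
  have nw: "norm w \<le> x + 2" using cmod_le[of w] w by (simp add: x_def)
  have 1: "norm (1 / (exp (- w) - 1)) \<le> 2 * exp (- x)"
  proof -
    have "1 / norm (exp (- w) - 1) \<le> 1 / (exp x / 2)"
      by (rule frac_le) (use low in auto)
    also have "1 / (exp x / 2) = 2 * exp (- x)" by (simp add: exp_minus field_simps)
    finally show ?thesis by (simp add: norm_divide)
  qed
  have 2: "norm (w * exp (- w) / (exp (- w) - 1)\<^sup>2) \<le> 4 * (x + 2) * exp (- x)"
  proof -
    have "norm (w * exp (- w) / (exp (- w) - 1)\<^sup>2) = norm w * exp x / (norm (exp (- w) - 1))\<^sup>2"
      by (simp add: norm_divide norm_mult norm_power ne[simplified])
    also have "\<dots> \<le> (x + 2) * exp x / (exp x / 2)\<^sup>2"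
      using nw low lowpos x by (intro frac_le mult_right_mono power_mono) auto
    also have "\<dots> = 4 * (x + 2) * exp (- x)" by (simp add: power2_eq_square exp_minus field_simps)
    finally show ?thesis .
  qed
  have "norm (li_kernel w) \<le> 2 * exp (- x) + 4 * (x + 2) * exp (- x)"
    unfolding li_kernel_eq[OF w0] by (rule norm_triangle_le[OF add_mono[OF 1 2]])
  also have "\<dots> = (4 * x + 10) * exp (- x)" by (simp add: algebra_simps)
  \<comment> \<open>The linear factor costs a third of the rate: 12 e^(x/3) \<ge> 12 + 4 x by the
    tangent of exp at 0, whence the constant 12 and the rate 2/3.\<close>
  also have "\<dots> \<le> (12 * exp (x / 3)) * exp (- x)"
    using exp_ge_add_one_self[of "x / 3"] by (intro mult_right_mono) (simp_all add: field_simps)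
  also have "\<dots> = 12 * exp (2 / 3 * Re w)" by (simp add: x_def flip: exp_add)
  finally show ?thesis .
qed

lemma li_kernel_bound: "\<exists>K\<ge>0. \<forall>w\<in>strip 2. norm (li_kernel w) \<le> K * exp (2 / 3 * Re w)"
proof -
  let ?S = "cbox (Complex (-1) (-2)) (Complex 2 2)"
  have "?S \<subseteq> strip 3" by (auto simp: strip_def in_cbox_complex_iff)
  hence "continuous_on ?S li_kernel"
    using holomorphic_on_imp_continuous_on[OF holomorphic_li_kernel] continuous_on_subset by blast
  hence "bounded (li_kernel ` ?S)" by (intro compact_imp_bounded compact_continuous_image) auto
  then obtain B where B: "\<forall>w\<in>?S. norm (li_kernel w) \<le> B" unfolding bounded_iff by auto
  show ?thesis
  \<comment> \<open>On the rectangle exp (2 / 3 * Re w) can be as small as e^(-2/3); the factor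
    e^(2/3) compensates.\<close>
  proof (intro exI[of _ "12 + \<bar>B\<bar> * exp (2 / 3)"] conjI ballI)
    fix w assume w: "w \<in> strip 2"
    show "norm (li_kernel w) \<le> (12 + \<bar>B\<bar> * exp (2 / 3)) * exp (2 / 3 * Re w)"
    proof (cases "Re w \<le> -1")
      case True
      have "norm (li_kernel w) \<le> 12 * exp (2 / 3 * Re w)"
        using True w by (intro li_kernel_bound_left) (auto simp: strip_def)
      also have "\<dots> \<le> (12 + \<bar>B\<bar> * exp (2 / 3)) * exp (2 / 3 * Re w)" by (intro mult_right_mono) auto
      finally show ?thesis .
    next
      case False
      hence "w \<in> ?S" using w by (auto simp: strip_def in_cbox_complex_iff)
      hence "norm (li_kernel w) \<le> \<bar>B\<bar> * 1" using B by force
      also have "\<dots> \<le> \<bar>B\<bar> * exp (2 / 3 + 2 / 3 * Re w)" using False by (intro mult_left_mono) auto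
      also have "\<dots> \<le> (12 + \<bar>B\<bar> * exp (2 / 3)) * exp (2 / 3 * Re w)"
        by (simp add: exp_add algebra_simps)
      finally show ?thesis .
    qed
  qed auto
qed

text \<open>Origin of the range of l: to the left of 0, 2/3 * 3/4 = 1/2 is exactly the rate of
  \<open>dec_bound\<close>; to the right the excess exponent is bounded because Re w < 1.\<close>

lemma exp_two_thirds_le:
  assumes "w \<in> strip 1" "3 / 4 \<le> l" "l \<le> 5 / 4"
  shows "exp (2 / 3 * (l * Re w)) \<le> 3 * exp (Re w / 2)"
proof -
  have "2 / 3 * (l * Re w) \<le> 1 + Re w / 2"
  proof (cases "Re w \<le> 0")
    case True
    hence "l * Re w \<le> 3 / 4 * Re w" using assms(2) by (intro mult_right_mono_neg) auto
    thus ?thesis by simp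
  next
    case False
    hence "l * Re w \<le> 5 / 4 * Re w" "Re w < 1" using assms by (auto simp: strip_def intro: mult_right_mono)
    thus ?thesis by simp
  qed
  hence "exp (2 / 3 * (l * Re w)) \<le> exp 1 * exp (Re w / 2)" by (simp flip: exp_add)
  also have "\<dots> \<le> 3 * exp (Re w / 2)" using exp_le by (intro mult_right_mono) auto
  finally show ?thesis .
qed

lemma li_kernel_scaled_bound:
  "\<exists>K. \<forall>l\<in>{3 / 4..5 / 4}. dec_bound 1 K (\<lambda>w. li_kernel (of_real l * w))"
proof -
  obtain K where K: "K \<ge> 0" "\<And>w. w \<in> strip 2 \<Longrightarrow> norm (li_kernel w) \<le> K * exp (2 / 3 * Re w)"
    using li_kernel_bound by blast
  show ?thesis unfolding dec_bound_def
  proof (intro exI[of _ "K * 3"] ballI conjI)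
    fix w l assume w: "w \<in> strip 1" and "l \<in> {3 / 4..5 / 4 :: real}"
    hence l: "3 / 4 \<le> l" "l \<le> 5 / 4" by auto
    have "l * Re w < 2"
    proof (cases "Re w \<le> 0")
      case True
      hence "l * Re w \<le> 0" using l by (intro mult_nonneg_nonpos) auto
      thus ?thesis by simp
    next
      case False
      hence "l * Re w \<le> 5 / 4 * 1" using w l by (intro mult_mono) (auto simp: strip_def)
      thus ?thesis by simp
    qed
    moreover have "\<bar>l * Im w\<bar> \<le> 5 / 4 * 1"
      unfolding abs_mult using w l by (intro mult_mono) (auto simp: strip_def)
    ultimately have "of_real l * w \<in> strip 2" by (simp add: strip_def)
    from K(2)[OF this] have "norm (li_kernel (of_real l * w)) \<le> K * exp (2 / 3 * (l * Re w))" by simp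
    also have "\<dots> \<le> K * (3 * exp (Re w / 2))"
      by (rule mult_left_mono[OF exp_two_thirds_le[OF w l] K(1)])
    finally show "norm (li_kernel (of_real l * w)) \<le> K * 3 * exp (Re w / 2)" by simp
  qed (use K in auto)
qed

lemma decaying_li_kernel: "decaying li_kernel"
  unfolding decaying_def
proof (intro conjI allI impI)
  show "li_kernel holomorphic_on strip 1"
    by (rule holomorphic_on_subset[OF holomorphic_li_kernel]) (auto intro!: strip_mono)
  fix \<delta> :: real assume "\<delta> < 1"
  obtain K where K: "\<And>l. l \<in> {3 / 4..5 / 4} \<Longrightarrow> dec_bound 1 K (\<lambda>w. li_kernel (of_real l * w))"
    using li_kernel_scaled_bound by blast
  have "dec_bound 1 K li_kernel" using K[of 1] by simp
  thus "\<exists>K. dec_bound \<delta> K li_kernel" using dec_bound_mono \<open>\<delta> < 1\<close> less_imp_le by blast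
qed

text \<open>An antiderivative of \<open>li_kernel (l * w)\<close> in l, not in w: l / (e^(-l w) - 1)
  + 1 / w with the singularity at w = 0 removed. The term 1 / w cancels in differences, which leaves
  the kernel of the desingularized zeta function.\<close>

definition li_primitive :: "complex \<Rightarrow> complex \<Rightarrow> complex" where
  "li_primitive l w = - l * exp_rem (l * w) / exp_quot (l * w)"

text \<open>The kernel of the desingularized zeta function is, up to the factor \<open>1 - c\<close>, the average of
  \<open>li_kernel (l * w)\<close> over \<open>l\<close> between \<open>1\<close> and \<open>c\<close>.\<close>

definition li_average :: "real \<Rightarrow> complex \<Rightarrow> complex" where
  "li_average c w = (li_primitive 1 w - li_primitive (of_real c) w) / (1 - of_real c)"

lemma li_primitive_eq:
  assumes "w \<noteq> 0" "l \<noteq> 0" "exp_quot (l * w) \<noteq> 0"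
  shows "li_primitive l w = l / (exp (- (l * w)) - 1) + 1 / w"
proof -
  have "l / (exp (- (l * w)) - 1) + 1 / w = (exp_quot (l * w) - 1) / (w * exp_quot (l * w))"
    unfolding exp_minus_one using assms by (simp add: field_simps)
  also have "exp_quot (l * w) - 1 = w * (- l * exp_rem (l * w))" by (simp add: exp_quot_def)
  also have "\<dots> / (w * exp_quot (l * w)) = li_primitive l w" using assms by (simp add: li_primitive_def)
  finally show ?thesis by simp
qed

lemma li_primitive_deriv:
  assumes w: "w \<noteq> 0" and l: "l \<noteq> 0" "\<bar>Im (l * w)\<bar> < 3"
  shows "((\<lambda>l. li_primitive l w) has_field_derivative li_kernel (l * w)) (at l)"
proof -
  define S where "S = {l. l \<noteq> 0 \<and> \<bar>Im (l * w)\<bar> < 3}"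
  have S: "open S" unfolding S_def
    by (intro open_Collect_conj open_Collect_neq open_Collect_less continuous_intros)
  have e0: "exp (- (l * w)) - 1 \<noteq> 0"
    unfolding exp_minus_one using w l exp_quot_nonzero[OF l(2)] by simp
  have "((\<lambda>l. l / (exp (- (l * w)) - 1) + 1 / w) has_field_derivative
      (1 * (exp (- (l * w)) - 1) - l * (exp (- (l * w)) * (- w))) / ((exp (- (l * w)) - 1) * (exp (- (l * w)) - 1))) (at l)"
    using e0 by (auto intro!: derivative_eq_intros)
  also have "(1 * (exp (- (l * w)) - 1) - l * (exp (- (l * w)) * (- w))) / ((exp (- (l * w)) - 1) * (exp (- (l * w)) - 1)) =
      li_kernel (l * w)"
  proof -
    have "(1 * E - l * (X * (- w))) / (E * E) = 1 / E + l * w * X / E\<^sup>2" if "E \<noteq> 0" for E X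
      using that by (simp add: field_simps power2_eq_square)
    from this[OF e0] show ?thesis using w l by (simp add: li_kernel_eq)
  qed
  finally show ?thesis
    by (rule has_field_derivative_transform_within_open[OF _ S])
       (use w l in \<open>auto simp: S_def li_primitive_eq exp_quot_nonzero\<close>)
qed

lemma abs_Im_scaled: "w \<in> strip 1 \<Longrightarrow> 0 \<le> c \<Longrightarrow> c \<le> 5 / 4 \<Longrightarrow> \<bar>Im (of_real c * w)\<bar> < 3"
  using mult_mono[of c "5 / 4" "\<bar>Im w\<bar>" 1] by (auto simp: strip_def abs_mult)

text \<open>The mean value inequality on the segment from 1 to c transfers the bound for
  \<open>li_kernel (l * w)\<close> to the average, uniformly in c; this provides the majorant for
  the limit c -> 1.\<close>

lemma li_average_bound:
  "\<exists>K. \<forall>c. 3 / 4 < c \<and> c < 5 / 4 \<and> c \<noteq> 1 \<longrightarrow> dec_bound 1 K (li_average c)"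
proof -
  obtain K where K: "\<And>l. l \<in> {3 / 4..5 / 4} \<Longrightarrow> dec_bound 1 K (\<lambda>w. li_kernel (of_real l * w))"
    using li_kernel_scaled_bound by blast
  have K0: "0 \<le> K" using dec_bound_nonneg[OF K[of 1]] by simp
  show ?thesis
  proof (intro exI[of _ "K + norm (exp_rem 0)"] allI impI)
    fix c :: real assume "3 / 4 < c \<and> c < 5 / 4 \<and> c \<noteq> 1"
    hence c: "3 / 4 < c" "c < 5 / 4" "c \<noteq> 1" by auto
    show "dec_bound 1 (K + norm (exp_rem 0)) (li_average c)"
      unfolding dec_bound_def
    proof (intro conjI ballI)
      fix w assume w: "w \<in> strip 1"
      show "norm (li_average c w) \<le> (K + norm (exp_rem 0)) * exp (Re w / 2)"
      proof (cases "w = 0")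
        \<comment> \<open>\<open>li_primitive_deriv\<close> is confined to w \<noteq> 0. At w = 0
          the average is - \<open>exp_rem 0\<close> for every c, whence the second summand of the
          constant.\<close>
        case True
        have "li_average c 0 = - exp_rem 0" using c(3)
          by (simp add: li_average_def li_primitive_def exp_quot_def divide_eq_eq algebra_simps)
        thus ?thesis using True K0 by simp
      next
        case False
        let ?S = "closed_segment (1::complex) (of_real c)"
        have seg: "\<exists>l'. l = of_real l' \<and> 3 / 4 \<le> l' \<and> l' \<le> 5 / 4" if l: "l \<in> ?S" for l
        proof -
          have "l \<in> of_real ` closed_segment 1 c" using l closed_segment_of_real[of 1 c, where ?'a = complex] by simp
          then obtain l' where "l = of_real l'" "l' \<in> closed_segment 1 c" by blast
          thus ?thesis using c by (auto simp: closed_segment_eq_real_ivl split: if_splits intro!: exI[of _ l'])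
        qed
        have "norm (li_primitive 1 w - li_primitive (of_real c) w) \<le> (K * exp (Re w / 2)) * norm (1 - complex_of_real c)"
        proof (rule field_differentiable_bound[where S = ?S])
          fix l assume l: "l \<in> ?S"
          then obtain l' where l': "l = of_real l'" "3 / 4 \<le> l'" "l' \<le> 5 / 4" using seg by blast
          have "\<bar>Im (l * w)\<bar> < 3" unfolding l'(1) using l' by (intro abs_Im_scaled[OF w]) auto
          thus "((\<lambda>l. li_primitive l w) has_field_derivative li_kernel (l * w)) (at l within ?S)"
            by (intro has_field_derivative_at_within[OF li_primitive_deriv[OF False]]) (use l' in auto)
          show "norm (li_kernel (l * w)) \<le> K * exp (Re w / 2)" using dec_boundD[OF K w, of l'] l' by simp
        qed auto
        hence "norm (li_average c w) \<le> K * exp (Re w / 2)"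
          using c(3) by (simp add: li_average_def norm_divide divide_le_eq)
        also have "\<dots> \<le> (K + norm (exp_rem 0)) * exp (Re w / 2)" by (intro mult_right_mono) auto
        finally show ?thesis .
      qed
    qed (use K0 in auto)
  qed
qed

lemma borel_measurable_li_average: "li_average c \<in> borel_measurable borel"
proof -
  note [measurable] = entire_imp_borel[OF exp_rem(1)] entire_imp_borel[OF holomorphic_exp_quot]
  show ?thesis unfolding li_average_def[abs_def] li_primitive_def by measurable
qed

lemma decaying_li_average:
  assumes c: "3 / 4 < c" "c < 5 / 4" "c \<noteq> 1"
  shows "decaying (li_average c)"
  unfolding decaying_def
proof (intro conjI allI impI)
  have "(\<lambda>w. li_primitive (of_real l) w) holomorphic_on strip 1" if l: "0 \<le> l" "l \<le> 5 / 4" for l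
  proof -
    have "(\<lambda>w. exp_rem (of_real l * w)) holomorphic_on strip 1"
      by (rule holomorphic_on_compose_gen[OF _ exp_rem(1), unfolded o_def]) (auto intro!: holomorphic_intros)
    moreover have "(\<lambda>w. exp_quot (of_real l * w)) holomorphic_on strip 1"
      by (rule holomorphic_on_compose_gen[OF _ holomorphic_exp_quot[of UNIV], unfolded o_def]) (auto intro!: holomorphic_intros)
    ultimately show ?thesis unfolding li_primitive_def
      using exp_quot_nonzero[OF abs_Im_scaled] l by (intro holomorphic_intros) auto
  qed
  from this[of 1] this[of c] c show "li_average c holomorphic_on strip 1"
    unfolding li_average_def[abs_def] by (intro holomorphic_intros) auto
  fix \<delta> :: real assume "\<delta> < 1"
  obtain K where "dec_bound 1 K (li_average c)" using li_average_bound c by blast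
  from dec_bound_mono[OF this, of \<delta>] \<open>\<delta> < 1\<close>
  show "\<exists>K. dec_bound \<delta> K (li_average c)" by auto
qed

lemma li_average_tendsto:
  assumes "w \<in> strip 1" "w \<noteq> 0"
  shows "((\<lambda>c. li_average c w) \<longlongrightarrow> li_kernel w) (at 1)"
proof -
  have "((\<lambda>l. li_primitive l w) has_field_derivative li_kernel (1 * w)) (at 1)"
    using assms by (intro li_primitive_deriv) (auto simp: strip_def)
  hence "((\<lambda>l. (li_primitive l w - li_primitive 1 w) / (l - 1)) \<longlongrightarrow> li_kernel w) (at 1)"
    by (simp add: has_field_derivative_iff)
  moreover have "filterlim complex_of_real (at 1) (at 1)"
    unfolding filterlim_at by (auto intro!: tendsto_eq_intros simp: eventually_at_filter)
  ultimately have "((\<lambda>c. (li_primitive (of_real c) w - li_primitive 1 w) / (of_real c - 1)) \<longlongrightarrow> li_kernel w) (at 1)"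
    by (rule filterlim_compose)
  moreover have "(li_primitive (of_real c) w - li_primitive 1 w) / (of_real c - 1) = li_average c w" for c
    unfolding li_average_def by (metis minus_diff_eq minus_divide_divide)
  ultimately show ?thesis by simp
qed

section \<open>Identification of the given kernels\<close>

lemma zeta_des_kernel_eq:
  assumes c: "3 / 4 < c" "c < 5 / 4" "c \<noteq> 1" and X: "- X \<in> strip 1" "X \<noteq> 0"
  shows "zeta_des_kernel c X = (1 - of_real c) * li_average c (- X)"
proof -
  have "exp_quot (1 * - X) \<noteq> 0" using exp_quot_nonzero[OF abs_Im_scaled[OF X(1), of 1]] by simp
  moreover have "exp_quot (of_real c * - X) \<noteq> 0"
    using exp_quot_nonzero[OF abs_Im_scaled[OF X(1), of c]] c by simp
  moreover have "- X \<noteq> 0" "complex_of_real c \<noteq> 0" "1 - complex_of_real c \<noteq> 0" using X c by auto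
  ultimately show ?thesis
    unfolding li_average_def zeta_des_kernel_def
    using li_primitive_eq[of "- X" 1] li_primitive_eq[of "- X" "of_real c"] by simp
qed

lemma zeta_hat_kernel_eq:
  assumes "0 < t" "X \<noteq> of_real (ln t)"
  shows "zeta_hat_kernel t X = li_kernel (of_real (ln t) - X)"
proof -
  have e: "1 / complex_of_real t * exp X = exp (- (of_real (ln t) - X))"
    using assms by (simp add: exp_diff exp_of_real divide_simps)
  have "of_real (ln t) - X \<noteq> 0" using assms by auto
  thus ?thesis
    unfolding zeta_hat_kernel_def mult.assoc e by (rule li_kernel_eq[symmetric])
qed

lemma Li_des_0_eq:
  assumes "0 < t" "t < 1"
  shows "complex_of_real (Li_des_0 t) = li_kernel (of_real (ln t))"
proof -
  have "complex_of_real (ln t) \<noteq> 0" using assms by simp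
  hence "li_kernel (of_real (ln t)) = of_real (1 / (1 / t - 1) + ln t * (1 / t) / (1 / t - 1)\<^sup>2)"
    using assms by (simp add: li_kernel_eq exp_minus exp_of_real divide_inverse flip: of_real_minus)
  also have "1 / (1 / t - 1) + ln t * (1 / t) / (1 / t - 1)\<^sup>2 = Li_des_0 t"
    using assms by (simp add: Li_des_0_def field_simps power2_eq_square)
  finally show ?thesis by simp
qed

section \<open>Real operators and the main theorem\<close>

lemma of_real_ln_strip: "0 < z \<Longrightarrow> z < 1 \<Longrightarrow> 0 < \<delta> \<Longrightarrow> complex_of_real (ln z) \<in> strip \<delta>"
  by (auto simp: strip_def intro: less_trans[of _ 0])

lemma J_cpow_ln_derivative:
  assumes "decaying G" "0 < z" "z < 1"
  shows "((\<lambda>z. J_cpow s G (of_real (ln z))) has_vector_derivative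
    of_real (1 / z) * J_cpow (s - 1) G (of_real (ln z))) (at z)"
proof -
  have "((\<lambda>z. complex_of_real (ln z)) has_vector_derivative of_real (1 / z)) (at z)"
    using assms by (intro has_vector_derivative_of_real) (auto intro!: derivative_eq_intros)
  from field_vector_diff_chain_at[OF this has_field_derivative_J_cpow[OF assms(1) of_real_ln_strip]]
  show ?thesis using assms by (simp add: o_def)
qed

text \<open>By the chain rule the next power, taken at log z, is an antiderivative of f(z) / z, and
  its decay makes it the one that vanishes at z = 0.\<close>

lemma J_op_eq:
  assumes G: "decaying G" and t: "0 < t" "t < 1"
    and f: "\<And>z. 0 < z \<Longrightarrow> z < 1 \<Longrightarrow> complex_of_real (f z) = J_cpow s G (of_real (ln z))"
  shows "complex_of_real (J_op f t) = J_cpow (s + 1) G (of_real (ln t))"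
proof -
  \<comment> \<open>The value of ln at 0 is a default; the limit 0 is put in by hand to get
    continuity on the closed interval.\<close>
  define \<Phi> where "\<Phi> = (\<lambda>z::real. if z = 0 then 0 else J_cpow (s + 1) G (of_real (ln z)))"
  have dJ: "decaying (J_cpow (s + 1) G)" by (rule decaying_J_cpow[OF G])
  have der: "(\<Phi> has_vector_derivative of_real (f z / z)) (at z)" if z: "0 < z" "z < 1" for z
  proof -
    have "((\<lambda>z. J_cpow (s + 1) G (of_real (ln z))) has_vector_derivative of_real (f z / z)) (at z)"
      using J_cpow_ln_derivative[OF G z, of "s + 1"] f[OF z, symmetric] by simp
    thus ?thesis
      by (rule has_vector_derivative_transform_within_open[of _ _ _ "{0<..}"]) (use z in \<open>auto simp: \<Phi>_def\<close>)
  qed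
  obtain K where K: "dec_bound (1 / 2) K (J_cpow (s + 1) G)" using decaying_bound[OF dJ, of "1 / 2"] by auto
  have lim: "(\<Phi> \<longlongrightarrow> 0) (at 0 within {0..t})"
  proof (rule Lim_null_comparison)
    \<comment> \<open>Decay at rate 1/2 in log z is the factor sqrt z in z.\<close>
    show "\<forall>\<^sub>F z in at 0 within {0..t}. norm (\<Phi> z) \<le> K * sqrt z"
    proof (rule eventually_at_topological[THEN iffD2], intro exI[of _ UNIV] conjI ballI impI)
      fix z assume "z \<noteq> 0" "z \<in> {0..t}"
      hence z: "0 < z" "z < 1" using t by auto
      have "norm (\<Phi> z) \<le> K * exp (ln z / 2)" using dec_boundD[OF K of_real_ln_strip[OF z]] z by (simp add: \<Phi>_def)
      also have "exp (ln z / 2) = sqrt z" using z by (simp add: ln_sqrt[symmetric])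
      finally show "norm (\<Phi> z) \<le> K * sqrt z" .
    qed auto
    have "((\<lambda>z. K * sqrt z) \<longlongrightarrow> K * sqrt 0) (at 0 within {0..t})" by (intro tendsto_intros)
    thus "((\<lambda>z. K * sqrt z) \<longlongrightarrow> 0) (at 0 within {0..t})" by simp
  qed
  have cont: "continuous_on {0..t} \<Phi>"
    unfolding continuous_on_def
  proof
    fix z assume z: "z \<in> {0..t}"
    show "(\<Phi> \<longlongrightarrow> \<Phi> z) (at z within {0..t})"
    proof (cases "z = 0")
      case True
      thus ?thesis using lim by (simp add: \<Phi>_def)
    next
      case False
      hence "(\<Phi> has_vector_derivative of_real (f z / z)) (at z)" using z t by (intro der) auto
      hence "continuous (at z) \<Phi>" by (rule has_vector_derivative_continuous)
      thus ?thesis by (simp add: isCont_def tendsto_within_subset[of _ _ _ UNIV])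
    qed
  qed
  have I: "((\<lambda>z. complex_of_real (f z / z)) has_integral \<Phi> t - \<Phi> 0) {0..t}"
    using t der by (intro fundamental_theorem_of_calculus_interior[OF _ cont]) auto
  have \<Phi>0: "\<Phi> 0 = 0" and \<Phi>t: "\<Phi> t = J_cpow (s + 1) G (of_real (ln t))" using t by (auto simp: \<Phi>_def)
  have "((\<lambda>z. f z / z) has_integral Re (\<Phi> t)) {0..t}"
    using has_integral_linear[OF I bounded_linear_Re] by (simp add: o_def \<Phi>0)
  hence 1: "J_op f t = Re (\<Phi> t)" unfolding J_op_def by (rule integral_unique)
  \<comment> \<open>That the complex power is real is not known beforehand; it comes out here, since
    the imaginary part of the integral of a real function is 0.\<close>
  have "((\<lambda>z. 0) has_integral Im (\<Phi> t)) {0..t}"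
    using has_integral_linear[OF I bounded_linear_Im] by (simp add: o_def \<Phi>0)
  hence 2: "Im (\<Phi> t) = 0" by (simp add: has_integral_0_eq)
  show ?thesis using 1 2 \<Phi>t by (simp add: complex_eq_iff)
qed

text \<open>As t is interior to (0,1), the identity there determines \<open>deriv f t\<close>; the
  derivative is real because the imaginary part is constantly 0 nearby.\<close>

lemma D_op_eq:
  assumes G: "decaying G" and t: "0 < t" "t < 1"
    and f: "\<And>z. 0 < z \<Longrightarrow> z < 1 \<Longrightarrow> complex_of_real (f z) = J_cpow s G (of_real (ln z))"
  shows "complex_of_real (D_op f t) = J_cpow (s - 1) G (of_real (ln t))"
proof -
  have d: "((\<lambda>z. complex_of_real (f z)) has_vector_derivative
      of_real (1 / t) * J_cpow (s - 1) G (of_real (ln t))) (at t)"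
    by (rule has_vector_derivative_transform_within_open[OF J_cpow_ln_derivative[OF G t], of "{0<..<1}"])
       (use t f in auto)
  have "((\<lambda>z. Re (complex_of_real (f z))) has_vector_derivative Re (of_real (1 / t) * J_cpow (s - 1) G (of_real (ln t)))) (at t)"
    by (rule bounded_linear.has_vector_derivative[OF bounded_linear_Re d])
  hence "(f has_field_derivative Re (of_real (1 / t) * J_cpow (s - 1) G (of_real (ln t)))) (at t)"
    by (simp add: has_real_derivative_iff_has_vector_derivative)
  hence 1: "deriv f t = Re (of_real (1 / t) * J_cpow (s - 1) G (of_real (ln t)))" by (rule DERIV_imp_deriv)
  have "((\<lambda>z. Im (complex_of_real (f z))) has_vector_derivative Im (of_real (1 / t) * J_cpow (s - 1) G (of_real (ln t)))) (at t)"
    by (rule bounded_linear.has_vector_derivative[OF bounded_linear_Im d])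
  hence "((\<lambda>z. 0 :: real) has_vector_derivative Im (of_real (1 / t) * J_cpow (s - 1) G (of_real (ln t)))) (at t)"
    by simp
  hence 2: "Im (of_real (1 / t) * J_cpow (s - 1) G (of_real (ln t))) = 0"
    using has_vector_derivative_const vector_derivative_unique_at by blast
  show ?thesis using 1 2 t by (simp add: D_op_def complex_eq_iff)
qed

text \<open>Starting from J^0 = id, each \<open>J_op\<close> or \<open>D_op\<close> shifts the
  exponent by one, using the previous identity on all of (0,1) and not only at t.\<close>

lemma J_pow_eq:
  assumes G: "decaying G" and t: "0 < t" "t < 1"
    and g: "\<And>z. 0 < z \<Longrightarrow> z < 1 \<Longrightarrow> complex_of_real (g z) = G (of_real (ln z))"
  shows "complex_of_real (J_pow m g t) = J_cpow (of_int m) G (of_real (ln t))"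
proof -
  have J0: "complex_of_real (g z) = J_cpow 0 G (of_real (ln z))" if "0 < z" "z < 1" for z
    using J_cpow_0[OF G of_real_ln_strip[OF that]] g[OF that] by simp
  have pos: "complex_of_real ((J_op ^^ n) g t) = J_cpow (of_nat n) G (of_real (ln t))" if "0 < t" "t < 1" for n t
    using that
  proof (induction n arbitrary: t)
    case (Suc n)
    show ?case using J_op_eq[OF G Suc.prems Suc.IH] by (simp add: add.commute)
  qed (simp add: J0)
  have neg: "complex_of_real ((D_op ^^ n) g t) = J_cpow (- of_nat n) G (of_real (ln t))" if "0 < t" "t < 1" for n t
    using that
  proof (induction n arbitrary: t)
    case (Suc n)
    have "- of_nat n - 1 = (- of_nat (Suc n) :: complex)" by simp
    with D_op_eq[OF G Suc.prems Suc.IH] show ?case by (simp only: funpow.simps o_apply)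
  qed (simp add: J0)
  show ?thesis
  proof (cases "0 \<le> m")
    case True
    hence "(of_nat (nat m) :: complex) = of_int m" by simp
    thus ?thesis using pos[OF t, of "nat m"] True by (simp add: J_pow_def)
  next
    case False
    hence "(- of_nat (nat (- m)) :: complex) = of_int m" by simp
    thus ?thesis using neg[OF t, of "nat (- m)"] False by (simp add: J_pow_def)
  qed
qed

lemma Li_des_eq_iter_J:
  assumes "0 < t" "t < 1"
  shows "complex_of_real (Li_des r k t) = iter_J li_kernel r (\<lambda>j. of_int (k j)) (of_real (ln t))"
  using assms
proof (induction r arbitrary: t)
  case (Suc r)
  have "complex_of_real (J_pow (k (Suc r)) (\<lambda>t. Li_des_0 t * Li_des r k t) t) =
      J_cpow (of_int (k (Suc r))) (\<lambda>w. li_kernel w * iter_J li_kernel r (\<lambda>j. of_int (k j)) w) (of_real (ln t))"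
    by (rule J_pow_eq[OF decaying_mult_iter_J[OF decaying_li_kernel] Suc.prems])
       (simp add: Li_des_0_eq Suc.IH)
  thus ?case by simp
qed simp

section \<open>From Hankel integrals to iterated operators\<close>

definition gamma_factor :: "nat \<Rightarrow> (nat \<Rightarrow> complex) \<Rightarrow> complex" where
  "gamma_factor r s = (\<Prod>k=1..r. (exp (2 * of_real pi * \<i> * s k) - 1) * Gamma (s k))"

lemma hankel_factor_inverse:
  assumes "\<forall>k\<in>{1..r}. s k \<notin> \<int>"
  shows "hankel_factor r s * gamma_factor r s = 1"
proof -
  have "1 / ((exp (2 * of_real pi * \<i> * s k) - 1) * Gamma (s k)) *
      ((exp (2 * of_real pi * \<i> * s k) - 1) * Gamma (s k)) = 1" if k: "k \<in> {1..r}" for k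
  proof -
    have s: "s k \<notin> \<int>" using assms k by blast
    hence "Gamma (s k) \<noteq> 0" using nonpos_Ints_Int by (auto simp: Gamma_eq_zero_iff)
    moreover have "exp (2 * of_real pi * \<i> * s k) \<noteq> 1"
    proof
      assume "exp (2 * of_real pi * \<i> * s k) = 1"
      then obtain n :: int where "2 * of_real pi * \<i> * s k = of_real (real_of_int (2 * n) * pi) * \<i>"
        using exp_eq[of _ 0] by auto
      hence "s k = of_int n" by simp
      thus False using s by simp
    qed
    ultimately show ?thesis by simp
  qed
  thus ?thesis unfolding hankel_factor_def gamma_factor_def prod.distrib[symmetric] by simp
qed

lemma hankel_integral_eqI:
  assumes "\<forall>\<^sub>F eps in at_right 0. hankel_integral_radius eps r g s = I"
  shows "hankel_integral r g s = I"
  unfolding hankel_integral_def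
proof (rule the_equality[where P = "\<lambda>I. \<forall>\<^sub>F eps in at_right 0. hankel_integral_radius eps r g s = I", OF assms])
  fix I' assume "\<forall>\<^sub>F eps in at_right 0. hankel_integral_radius eps r g s = I'"
  with assms have "\<forall>\<^sub>F eps in at_right (0::real). I' = I" by eventually_elim simp
  thus "I' = I" by (simp add: eventually_const_iff)
qed

text \<open>\<kappa> is a kernel as given and q its holomorphic replacement; agreement off X = w
  suffices almost everywhere. The factor b is 1 for one zeta function and 1 - c for the
  other.\<close>

lemma hankel_integral_eq_iter_J:
  assumes q: "decaying q" "q \<in> borel_measurable borel" and \<kappa>: "\<kappa> \<in> borel_measurable borel"
    and w: "w \<in> strip 1" and s: "\<forall>k\<in>{1..r}. s k \<notin> \<int>"
    and eq: "\<And>X. w - X \<in> strip 1 \<Longrightarrow> X \<noteq> w \<Longrightarrow> \<kappa> X = b * q (w - X)"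
  shows "hankel_integral r (\<lambda>x. \<Prod>j=1..r. \<kappa> (\<Sum>k=j..r. x k)) s = b ^ r * (gamma_factor r s * iter_J q r s w)"
proof (rule hankel_integral_eqI)
  obtain \<delta> where \<delta>: "\<delta> < 1" "w \<in> strip \<delta>" using strip_shrink[OF w] by blast
  \<comment> \<open>Below this threshold all partial sums of contour points stay within the strip,
    so the integral no longer depends on the radius.\<close>
  have "((\<lambda>eps. \<delta> + real r * eps) \<longlongrightarrow> \<delta> + real r * 0) (at_right 0)" by (intro tendsto_intros)
  hence "\<forall>\<^sub>F eps in at_right 0. \<delta> + real r * eps < 1" using \<delta>(1) by (intro order_tendstoD) auto
  moreover have "\<forall>\<^sub>F eps in at_right (0::real). eps > 0" by (simp add: eventually_at_right_less)
  ultimately show "\<forall>\<^sub>F eps in at_right 0. hankel_integral_radius eps r (\<lambda>x. \<Prod>j=1..r. \<kappa> (\<Sum>k=j..r. x k)) s =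
      b ^ r * (gamma_factor r s * iter_J q r s w)"
  proof eventually_elim
    case (elim eps)
    have "hankel_integral_radius eps r (\<lambda>x. \<Prod>j=1..r. \<kappa> (\<Sum>k=j..r. x k)) s =
        (LINT u|lborel_pow r. b ^ r * multi_integrand eps q r s w u)"
      unfolding hankel_integral_radius_eq
    proof (rule integral_cong_AE)
      have "(\<lambda>u. \<kappa> (\<Sum>k=j..r. hankel eps (u k))) \<in> borel_measurable (lborel_pow r)" if "1 \<le> j" for j
        by (rule measurable_compose[OF measurable_sum_hankel[OF elim(2) that] \<kappa>])
      thus "(\<lambda>u. (\<Prod>j=1..r. \<kappa> (\<Sum>k=j..r. hankel eps (u k))) * (\<Prod>k=1..r. hankel_kernel eps (s k) (u k))) \<in> borel_measurable (lborel_pow r)"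
        by (intro borel_measurable_times borel_measurable_prod measurable_coordinate measurable_hankel_kernel[OF elim(2)]) auto
      show "(\<lambda>u. b ^ r * multi_integrand eps q r s w u) \<in> borel_measurable (lborel_pow r)"
        using measurable_multi_integrand[OF elim(2) q(2)] by measurable
      have "AE u in lborel_pow r. \<forall>j\<in>{1..r}. (\<Sum>k=j..r. hankel eps (u k)) \<noteq> w"
        by (rule AE_finite_allI) (auto intro: AE_sum_hankel_neq[OF elim(2)])
      thus "AE u in lborel_pow r. (\<Prod>j=1..r. \<kappa> (\<Sum>k=j..r. hankel eps (u k))) * (\<Prod>k=1..r. hankel_kernel eps (s k) (u k)) =
          b ^ r * multi_integrand eps q r s w u"
      proof eventually_elim
        case (elim u)
        have "(\<Prod>j=1..r. \<kappa> (\<Sum>k=j..r. hankel eps (u k))) = (\<Prod>j=1..r. b * q (w - (\<Sum>k=j..r. hankel eps (u k))))"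
        proof (rule prod.cong[OF refl])
          fix j assume j: "j \<in> {1..r}"
          show "\<kappa> (\<Sum>k=j..r. hankel eps (u k)) = b * q (w - (\<Sum>k=j..r. hankel eps (u k)))"
            using j elim \<open>\<delta> + real r * eps < 1\<close>
            by (intro eq strip_diff_sum_hankel'[OF \<open>0 < eps\<close> \<delta>(2), of r]) auto
        qed
        thus ?case by (simp add: multi_integrand_def prod.distrib mult.assoc)
      qed
    qed
    also have "\<dots> = b ^ r * multi_hankel eps q r s w" by (simp add: multi_hankel_def)
    also have "multi_hankel eps q r s w = gamma_factor r s * iter_J q r s w"
      unfolding gamma_factor_def by (rule multi_hankel_eq_iter_J[OF elim(2) q \<delta>(2) elim(1) s])
    finally show ?case .
  qed
qed

section \<open>The two zeta functions\<close>

lemma borel_measurable_cexp: "(exp :: complex \<Rightarrow> complex) \<in> borel_measurable borel"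
  by (rule borel_measurable_continuous_onI) (intro continuous_intros)

lemma zeta_hat_des_eq_iter_J:
  assumes t: "0 < t" "t < 1"
  shows "zeta_hat_des r s t = iter_J li_kernel r s (of_real (ln t))"
proof -
  have w: "complex_of_real (ln t) \<in> strip 1" using of_real_ln_strip[OF t] by simp
  have m: "zeta_hat_kernel t \<in> borel_measurable borel"
    unfolding zeta_hat_kernel_def[abs_def] using borel_measurable_cexp by measurable
  have "entire_extension r (\<lambda>s. hankel_factor r s *
      hankel_integral r (\<lambda>x. \<Prod>j=1..r. zeta_hat_kernel t (\<Sum>k=j..r. x k)) s) =
      (\<lambda>s. iter_J li_kernel r s (of_real (ln t)))"
  proof (rule entire_extension_eqI[OF entire_fun_iter_J[OF decaying_li_kernel w]])
    fix s :: "nat \<Rightarrow> complex" assume s: "\<forall>k\<in>{1..r}. s k \<notin> \<int>"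
    have "hankel_integral r (\<lambda>x. \<Prod>j=1..r. zeta_hat_kernel t (\<Sum>k=j..r. x k)) s =
        1 ^ r * (gamma_factor r s * iter_J li_kernel r s (of_real (ln t)))"
      using zeta_hat_kernel_eq[OF t(1)]
      by (intro hankel_integral_eq_iter_J[OF decaying_li_kernel borel_measurable_li_kernel m w s]) simp
    thus "iter_J li_kernel r s (of_real (ln t)) = hankel_factor r s *
        hankel_integral r (\<lambda>x. \<Prod>j=1..r. zeta_hat_kernel t (\<Sum>k=j..r. x k)) s"
      using hankel_factor_inverse[OF s] by (simp flip: mult.assoc)
  qed
  thus ?thesis unfolding zeta_hat_des_def by simp
qed

text \<open>With the radius fixed, \<open>multi_weight\<close> dominates all integrands near c = 1
  at once. Pointwise convergence is available off w = 0, so the points where a partial sum of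
  contour points vanishes are discarded as a null set.\<close>

lemma multi_hankel_li_average_tendsto:
  assumes "0 < eps" "real r * eps < 1 / 2"
  shows "((\<lambda>c. multi_hankel eps (li_average c) r s 0) \<longlongrightarrow> multi_hankel eps li_kernel r s 0) (at 1)"
proof -
  \<comment> \<open>The contour may use up half of the strip: 1/4 + 1/2 = 3/4 < 1.\<close>
  have w: "0 \<in> strip (1 / 4)" "1 / 4 + real r * eps \<le> 3 / 4"
    using assms by (simp add: strip_def, linarith)
  obtain K where K: "\<And>c. 3 / 4 < c \<Longrightarrow> c < 5 / 4 \<Longrightarrow> c \<noteq> 1 \<Longrightarrow> dec_bound 1 K (li_average c)"
    using li_average_bound by blast
  have conv: "(\<lambda>n. multi_hankel eps (li_average (X n)) r s 0) \<longlonglongrightarrow> multi_hankel eps li_kernel r s 0"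
    if X: "X \<longlonglongrightarrow> 1" "\<And>n. X n \<noteq> 1" "\<And>n. 3 / 4 < X n" "\<And>n. X n < 5 / 4" for X
    unfolding multi_hankel_def
  proof (rule integral_dominated_convergence)
    show "multi_integrand eps li_kernel r s 0 \<in> borel_measurable (lborel_pow r)"
      by (rule measurable_multi_integrand[OF assms(1) borel_measurable_li_kernel])
    show "multi_integrand eps (li_average (X n)) r s 0 \<in> borel_measurable (lborel_pow r)" for n
      by (rule measurable_multi_integrand[OF assms(1) borel_measurable_li_average])
    show "integrable (lborel_pow r) (\<lambda>u. (2 * K) ^ r * multi_weight eps r s u)"
      using integrable_multi_weight[OF assms(1)] by simp
    show "AE u in lborel_pow r. norm (multi_integrand eps (li_average (X n)) r s 0 u) \<le> (2 * K) ^ r * multi_weight eps r s u" for n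
      using dec_bound_mono[OF K[OF X(3,4,2)], of "3 / 4"]
      by (intro AE_I2 norm_multi_integrand_le[OF assms(1) _ w]) auto
    have "AE u in lborel_pow r. \<forall>j\<in>{1..r}. (\<Sum>k=j..r. hankel eps (u k)) \<noteq> 0"
      by (rule AE_finite_allI) (auto intro: AE_sum_hankel_neq[OF assms(1)])
    thus "AE u in lborel_pow r. (\<lambda>n. multi_integrand eps (li_average (X n)) r s 0 u) \<longlonglongrightarrow> multi_integrand eps li_kernel r s 0 u"
    proof eventually_elim
      case (elim u)
      have "(\<lambda>n. li_average (X n) (0 - (\<Sum>k=j..r. hankel eps (u k)))) \<longlonglongrightarrow> li_kernel (0 - (\<Sum>k=j..r. hankel eps (u k)))"
        if j: "j \<in> {1..r}" for j
      proof -
        have "0 - (\<Sum>k=j..r. hankel eps (u k)) \<in> strip 1"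
          using w(2) j by (intro strip_diff_sum_hankel'[OF assms(1) w(1), of r]) (linarith, simp)
        hence "((\<lambda>c. li_average c (0 - (\<Sum>k=j..r. hankel eps (u k)))) \<longlongrightarrow> li_kernel (0 - (\<Sum>k=j..r. hankel eps (u k)))) (at 1)"
          using elim j by (intro li_average_tendsto) auto
        thus ?thesis
          by (rule filterlim_compose) (use X(1,2) in \<open>auto simp: filterlim_at\<close>)
      qed
      thus ?case unfolding multi_integrand_def by (intro tendsto_mult tendsto_prod tendsto_const) auto
    qed
  qed
  show ?thesis unfolding tendsto_at_iff_sequentially
  proof (intro allI impI)
    fix X :: "nat \<Rightarrow> real" assume X: "\<forall>i. X i \<in> UNIV - {1}" "X \<longlonglongrightarrow> 1"
    have "\<forall>\<^sub>F n in sequentially. 3 / 4 < X n" "\<forall>\<^sub>F n in sequentially. X n < 5 / 4"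
      using order_tendstoD[OF X(2), of "3 / 4"] order_tendstoD[OF X(2), of "5 / 4"] by auto
    hence "\<forall>\<^sub>F n in sequentially. 3 / 4 < X n \<and> X n < 5 / 4" by eventually_elim simp
    then obtain N where N: "\<And>n. n \<ge> N \<Longrightarrow> 3 / 4 < X n \<and> X n < 5 / 4"
      unfolding eventually_sequentially by blast
    have "(\<lambda>n. multi_hankel eps (li_average (X (n + N))) r s 0) \<longlonglongrightarrow> multi_hankel eps li_kernel r s 0"
      using X N LIMSEQ_ignore_initial_segment[OF X(2), of N] by (intro conv) auto
    thus "((\<lambda>c. multi_hankel eps (li_average c) r s 0) \<circ> X) \<longlonglongrightarrow> multi_hankel eps li_kernel r s 0"
      unfolding o_def by (rule LIMSEQ_offset)
  qed
qed

lemma zeta_des_eq_iter_J: "zeta_des r s = iter_J li_kernel r s 0"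
proof -
  have w: "0 \<in> strip 1" by (simp add: strip_def)
  \<comment> \<open>One radius serves all c near 1, so the limit is taken under a single
    integral.\<close>
  define eps where "eps = 1 / (2 * (real r + 1))"
  have eps: "0 < eps" "real r * eps < 1 / 2" by (auto simp: eps_def field_simps)
  have w': "0 \<in> strip (1 / 4)" "1 / 4 + real r * eps < 1" using eps by (auto simp: strip_def)
  let ?I = "\<lambda>c. hankel_integral r (\<lambda>x. \<Prod>j=1..r. zeta_des_kernel c (\<Sum>k=j..r. x k))"
  have "entire_extension r (\<lambda>s. Lim (at (1::real)) (\<lambda>c. 1 / (1 - complex_of_real c) ^ r * hankel_factor r s * ?I c s)) =
      (\<lambda>s. iter_J li_kernel r s 0)"
  proof (rule entire_extension_eqI[OF entire_fun_iter_J[OF decaying_li_kernel w]])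
    fix s :: "nat \<Rightarrow> complex" assume s: "\<forall>k\<in>{1..r}. s k \<notin> \<int>"
    have val: "1 / (1 - complex_of_real c) ^ r * hankel_factor r s * ?I c s =
        hankel_factor r s * multi_hankel eps (li_average c) r s 0"
      if c: "3 / 4 < c" "c < 5 / 4" "c \<noteq> 1" for c
    proof -
      have m: "zeta_des_kernel c \<in> borel_measurable borel"
        unfolding zeta_des_kernel_def[abs_def] using borel_measurable_cexp by measurable
      have "?I c s = (1 - of_real c) ^ r * (gamma_factor r s * iter_J (li_average c) r s 0)"
        using zeta_des_kernel_eq[OF c]
        by (intro hankel_integral_eq_iter_J[OF decaying_li_average[OF c] borel_measurable_li_average m w s]) auto
      also have "gamma_factor r s * iter_J (li_average c) r s 0 = multi_hankel eps (li_average c) r s 0"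
        unfolding gamma_factor_def
        by (rule multi_hankel_eq_iter_J[OF eps(1) decaying_li_average[OF c] borel_measurable_li_average w' s, symmetric])
      finally show ?thesis using c by simp
    qed
    have "((\<lambda>c. hankel_factor r s * multi_hankel eps (li_average c) r s 0) \<longlongrightarrow>
        hankel_factor r s * multi_hankel eps li_kernel r s 0) (at 1)"
      by (intro tendsto_mult tendsto_const multi_hankel_li_average_tendsto[OF eps])
    also have "hankel_factor r s * multi_hankel eps li_kernel r s 0 = iter_J li_kernel r s 0"
      using multi_hankel_eq_iter_J[OF eps(1) decaying_li_kernel borel_measurable_li_kernel w' s] hankel_factor_inverse[OF s]
      unfolding gamma_factor_def by (simp flip: mult.assoc)
    finally have lim: "((\<lambda>c. hankel_factor r s * multi_hankel eps (li_average c) r s 0) \<longlongrightarrow> iter_J li_kernel r s 0) (at 1)" .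
    have "\<forall>\<^sub>F c in at (1::real). 3 / 4 < c \<and> c < 5 / 4 \<and> c \<noteq> 1"
      unfolding eventually_at by (rule exI[of _ "1 / 4"]) (auto simp: dist_real_def abs_if split: if_splits)
    hence "\<forall>\<^sub>F c in at 1. 1 / (1 - complex_of_real c) ^ r * hankel_factor r s * ?I c s =
        hankel_factor r s * multi_hankel eps (li_average c) r s 0"
      by eventually_elim (use val in blast)
    from tendsto_cong[OF this] lim
    have "((\<lambda>c. 1 / (1 - complex_of_real c) ^ r * hankel_factor r s * ?I c s) \<longlongrightarrow> iter_J li_kernel r s 0) (at 1)" by blast
    from tendsto_Lim[OF _ this]
    show "iter_J li_kernel r s 0 = Lim (at (1::real)) (\<lambda>c. 1 / (1 - complex_of_real c) ^ r * hankel_factor r s * ?I c s)"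
      by simp
  qed
  thus ?thesis unfolding zeta_des_def by simp
qed

theorem theorem4p6:
  fixes r :: nat and k :: "nat \<Rightarrow> int"
  assumes "r \<ge> 1"
  shows "(\<forall>t\<in>{0<..<1::real}.
            zeta_hat_des r (\<lambda>j. of_int (k j)) t = complex_of_real (Li_des r k t)) \<and>
         ((\<lambda>t. complex_of_real (Li_des r k t)) \<longlongrightarrow> zeta_des r (\<lambda>j. of_int (k j))) (at_left 1)"
proof
  show "\<forall>t\<in>{0<..<1}. zeta_hat_des r (\<lambda>j. of_int (k j)) t = complex_of_real (Li_des r k t)"
    by (simp add: zeta_hat_des_eq_iter_J Li_des_eq_iter_J)
  let ?F = "iter_J li_kernel r (\<lambda>j. of_int (k j))"
  have "?F holomorphic_on strip 1"
    using strip_bounded_iter_J[OF decaying_li_kernel] by (simp add: strip_bounded_def)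
  \<comment> \<open>0 is an interior point of \<open>strip 1\<close>, so the limit t -> 1 from the
    left is an evaluation at log 1.\<close>
  hence "isCont ?F 0"
    using holomorphic_on_imp_continuous_on continuous_on_interior[of "strip 1" ?F 0] open_strip
    by (simp add: interior_open strip_def)
  hence "(?F \<longlongrightarrow> ?F 0) (nhds 0)" by (simp add: isCont_def tendsto_nhds_iff)
  moreover have "((\<lambda>t::real. complex_of_real (ln t)) \<longlongrightarrow> of_real (ln 1)) (at_left 1)"
    by (intro tendsto_intros) auto
  hence "filterlim (\<lambda>t::real. complex_of_real (ln t)) (nhds 0) (at_left 1)" by simp
  ultimately have "((\<lambda>t. ?F (of_real (ln t))) \<longlongrightarrow> ?F 0) (at_left 1)" by (rule filterlim_compose)
  moreover have "\<forall>\<^sub>F t in at_left 1. ?F (of_real (ln t)) = complex_of_real (Li_des r k t)"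
    using eventually_at_left_real[of 0 1] by (auto elim!: eventually_mono simp: Li_des_eq_iter_J)
  ultimately show "((\<lambda>t. complex_of_real (Li_des r k t)) \<longlongrightarrow> zeta_des r (\<lambda>j. of_int (k j))) (at_left 1)"
    unfolding zeta_des_eq_iter_J by (rule Lim_transform_eventually)
qed

end
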